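(* Assume $\eta>r_a$ and let $\{\varepsilon_n\}$ be a sequence of positive numbers converging to $0$. Then there exist $T>0$, a subsequence $\{\varepsilon_{n'}\}$ of $\{\varepsilon_n\}$, and an $N$-solution $\mu$ of the LS equation on $[0,T]$ with mass $m$ (with initial data $u^{\rm in},\mu^{\rm in}$), such that $f^{\varepsilon_{n'}}\to\mu$ as $n'\to+\infty$ in $\mathcal C([0,T];w\text{-}*\text{-}\mathcal M_f([0,+\infty)))$, where the nucleation rate is, for all $u\ge 0$, $$N(u)=\alpha u^2 .$$
   Context: **Rescaled Becker–Döring (BD) system.** Fix $\eta\ge 0$. For each $\varepsilon>0$ let $\alpha^\varepsilon,\beta^\varepsilon,(a_i^\varepsilon)_{i\ge2},(b_i^\varepsilon)_{i\ge3}$ be positive numbers for which there is a constant $K(\varepsilon)>0$ with $a_{i+1}^\varepsilon-a_i^\varepsilon\le K(\varepsilon)$ ($i\ge2$) and $b_i^\varepsilon-b_{i+1}^\varepsilon\le K(\varepsilon)$ ($i\ge3$). Let $u^\varepsilon$ and $(c_i^\varepsilon)_{i\ge2}$ be non-negative functions in $\mathcal C([0,+\infty))$ forming a global solution of $$\frac{d}{dt}u^\varepsilon=-\varepsilon J_1^\varepsilon-\varepsilon\sum_{i\ge1}J_i^\varepsilon,\qquad \frac{d}{dt}c_i^\varepsilon=\frac1\varepsilon\big[J_{i-1}^\varepsilon-J_i^\varepsilon\big]\quad(i\ge2),$$ $$J_1^\varepsilon=\alpha^\varepsilon(u^\varepsilon)^2-\varepsilon^\eta\beta^\varepsilon c_2^\varepsilon,\qquad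 J_i^\varepsilon=a_i^\varepsilon u^\varepsilon c_i^\varepsilon-b_{i+1}^\varepsilon c_{i+1}^\varepsilon\quad(i\ge2),$$ with non-negative initial data $u^{{\rm in},\varepsilon},(c_i^{{\rm in},\varepsilon})_{i\ge2}$, and satisfying the mass balance $u^\varepsilon(t)+\sum_{i\ge2}\varepsilon^2 i\,c_i^\varepsilon(t)=m^\varepsilon$ for all $t\ge0$, with $m^\varepsilon<\infty$ constant. Put $\Lambda_i^\varepsilon=[(i-\frac12)\varepsilon,(i+\frac12)\varepsilon)$ and $$f^\varepsilon(t,x)=\sum_{i\ge2}c_i^\varepsilon(t)\mathbf 1_{\Lambda_i^\varepsilon}(x),\quad f^{{\rm in},\varepsilon}=f^\varepsilon(0,\cdot),\quad a^\varepsilon(x)=\sum_{i\ge2}a_i^\varepsilon\mathbf 1_{\Lambda_i^\varepsilon}(x),\quad b^\varepsilon(x)=\sum_{i\ge3}b_i^\varepsilon\mathbf 1_{\Lambda_i^\varepsilon}(x).$$ **Assumptions on the rates.** $\alpha,\beta>0$; $a,b$ are non-negative continuous functions on $[0,+\infty)$, positive on $(0,+\infty)$. As $\varepsilon\to0$: $\alpha^\varepsilon\to\alpha$, $\beta^\varepsilon\to\beta$, and $a^\varepsilon\to a$, $b^\varepsilon\to b$ uniformly on compact subsets of $[0,+\infty)$. There are $K_a,K_b>0$ with $a^\varepsilon(x)\le K_a(1+x)$ and $b^\varepsilon(x)\le K_b(1+x)$ for all $x\ge0$, $\varepsilon>0$. There are $r_a\in[0,1)$, $r_b\ge r_a$,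 $\overline a>0$, $\overline b>0$ with $a(x)\sim_{0^+}\overline a x^{r_a}$, $b(x)\sim_{0^+}\overline b x^{r_b}$, and $a^\varepsilon(\varepsilon i)=a(\varepsilon i)+o((\varepsilon i)^{r_a})$, $b^\varepsilon(\varepsilon i)=b(\varepsilon i)+o((\varepsilon i)^{r_b})$, where the Landau symbol refers to $\varepsilon i\to0$ ($i\ge2$ for $a$, $i\ge3$ for $b$). Set $\rho:=\lim_{x\to0^+}b(x)/a(x)=\lim_{x\to 0^+}\frac{\overline b}{\overline a}x^{r_b-r_a}\in[0,+\infty)$. **Assumptions on the initial data.** $\mathcal M_f(U)$ is the set of non-negative finite regular Borel measures on $U$, with the weak-$*$ topology: $\nu^n\to\nu$ iff $\int\varphi\,d\nu^n\to\int\varphi\,d\nu$ for all $\varphi\in\mathcal C_c(U)$; a density $f$ is identified with $f(x)dx$. There are $u^{\rm in}>\rho$ and $\mu^{\rm in}\in\mathcal M_f([0,+\infty))$ such that, as $\varepsilon\to0$, $u^{{\rm in},\varepsilon}\to u^{\rm in}$ and $f^{{\rm in},\varepsilon}\to\mu^{\rm in}$ weak-$*$ in $\mathcal M_f([0,+\infty))$. Let $\mathcal U$ be the set of non-negative convex functions $\Phi\in\mathcal C^1([0,+\infty))$, piecewise $\mathcal C^2$, with $\Phi(0)=0$, $\Phi'$ concave, $\Phi'(0)\ge0$, $\Phi(x)/x\to+\infty$ as $x\to+\infty$. There is $\Phi\in\mathcal U$ with $\sup_{\varepsilon>0}\int_0^\infty\Phi(x)f^{{\rm in},\varepsilon}(x)dx<\infty$.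 For all $z\in(0,1)$, $\sup_{\varepsilon>0}\sum_{i\ge2}\varepsilon^{r_a}c_i^{{\rm in},\varepsilon}e^{-iz}<\infty$. Set $m:=u^{\rm in}+\int_0^\infty x\,\mu^{\rm in}(dx)$. **$N$-solution.** Given $T>0$ and a function $N\in L^\infty_{loc}(\mathbb R_+)$ (nucleation rate), $\mu\in L^\infty([0,T];\mathcal M_f([0,+\infty)))$ is an $N$-solution of the LS equation (in measure) on $[0,T]$ with mass $m$ if: (i) there is a non-negative $u\in\mathcal C([0,T])$ with $u(0)=u^{\rm in}$, $\inf_{[0,T]}u>\rho$, and $u(t)+\int_0^\infty x\,\mu_t(dx)=m$ for all $t\in[0,T]$ (for a suitable representative of $\mu$); (ii) for all $\varphi\in\mathcal C^1_c([0,T)\times[0,+\infty))$, $$\int_0^T\!\!\int_0^\infty\big[\partial_t\varphi(t,x)+(a(x)u(t)-b(x))\partial_x\varphi(t,x)\big]\mu_t(dx)\,dt+\int_0^\infty\varphi(0,x)\mu^{\rm in}(dx)+\int_0^T\varphi(s,0)N(u(s))\,ds=0.$$ $\mathcal C([0,T];w\text{-}*\text{-}\mathcal M_f([0,+\infty)))$ is the space of measure-valued functions on $[0,T]$ continuous in time for the weak-$*$ topology (with uniform-in-time convergence). *)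

theory Defs
  imports "HOL-Analysis.Analysis" "HOL-Library.Landau_Symbols"
begin

text \<open>Finite Borel measures on a subset \<open>U\<close> of the line. For the set \<open>[0, \<infinity>)\<close> used below, such
  measures are automatically regular, so regularity is not listed.\<close>

definition M_f :: "real set \<Rightarrow> real measure set" where
  "M_f U = {\<mu>. sets \<mu> = sets (restrict_space borel U) \<and> finite_measure \<mu>}"

definition C_c :: "real set \<Rightarrow> (real \<Rightarrow> real) set" where
  "C_c U = {\<phi>. continuous_on U \<phi> \<and> (\<exists>K. compact K \<and> K \<subseteq> U \<and> (\<forall>x\<in>U - K. \<phi> x = 0))}"

definition wstar_tendsto :: "('i \<Rightarrow> real measure) \<Rightarrow> real measure \<Rightarrow> 'i filter \<Rightarrow> bool" where
  "wstar_tendsto \<nu> \<mu> F \<longleftrightarrow>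
     (\<forall>\<phi>\<in>C_c {0..}. ((\<lambda>n. \<integral>x. \<phi> x \<partial>\<nu> n) \<longlongrightarrow> (\<integral>x. \<phi> x \<partial>\<mu>)) F)"

definition density_measure :: "(real \<Rightarrow> real) \<Rightarrow> real measure" where
  "density_measure f = density (restrict_space lborel {0..}) (\<lambda>x. ennreal (f x))"

definition C_wstar :: "real \<Rightarrow> (real \<Rightarrow> real measure) set" where
  "C_wstar T = {\<mu>. (\<forall>t\<in>{0..T}. \<mu> t \<in> M_f {0..}) \<and>
     (\<forall>\<phi>\<in>C_c {0..}. continuous_on {0..T} (\<lambda>t. \<integral>x. \<phi> x \<partial>\<mu> t))}"

definition C_wstar_tendsto ::
    "real \<Rightarrow> (nat \<Rightarrow> real \<Rightarrow> real measure) \<Rightarrow> (real \<Rightarrow> real measure) \<Rightarrow> bool" where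
  "C_wstar_tendsto T \<nu> \<mu> \<longleftrightarrow> (\<forall>n. \<nu> n \<in> C_wstar T) \<and> \<mu> \<in> C_wstar T \<and>
     (\<forall>\<phi>\<in>C_c {0..}. uniform_limit {0..T} (\<lambda>n t. \<integral>x. \<phi> x \<partial>\<nu> n t) (\<lambda>t. \<integral>x. \<phi> x \<partial>\<mu> t) sequentially)"

text \<open>Representatives of elements of \<open>L\<^sup>\<infinity>([0,T]; M_f([0,\<infinity>)))\<close>; measurability in time is
  understood in the weak-* sense.\<close>

definition Linf_M_f :: "real \<Rightarrow> (real \<Rightarrow> real measure) set" where
  "Linf_M_f T = {\<mu>. (\<forall>t\<in>{0..T}. \<mu> t \<in> M_f {0..}) \<and>
     (\<forall>\<phi>\<in>C_c {0..}. (\<lambda>t. \<integral>x. \<phi> x \<partial>\<mu> t) \<in> borel_measurable (lebesgue_on {0..T})) \<and>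
     (\<exists>C. AE t in lebesgue_on {0..T}. measure (\<mu> t) {0..} \<le> C)}"

definition Linf_loc :: "(real \<Rightarrow> real) set" where
  "Linf_loc = {N. N \<in> borel_measurable (lebesgue_on {0..}) \<and>
     (\<forall>R. \<exists>C. AE v in lebesgue_on {0..R}. \<bar>N v\<bar> \<le> C)}"

text \<open>\<open>C1_c T \<phi> \<phi>t \<phi>x\<close>: the function \<open>\<phi>\<close> lies in \<open>C\<^sup>1\<^sub>c([0,T) \<times> [0,\<infinity>))\<close> and its partial
  derivatives are \<open>\<phi>t\<close> and \<open>\<phi>x\<close> (one-sided at the boundary).\<close>

definition C1_c :: "real \<Rightarrow> (real \<Rightarrow> real \<Rightarrow> real) \<Rightarrow> (real \<Rightarrow> real \<Rightarrow> real) \<Rightarrow> (real \<Rightarrow> real \<Rightarrow> real) \<Rightarrow> bool"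
where
  "C1_c T \<phi> \<phi>t \<phi>x \<longleftrightarrow>
     (\<forall>t\<in>{0..<T}. \<forall>x\<in>{0..}.
        ((\<lambda>(s, y). \<phi> s y) has_derivative (\<lambda>(h, k). \<phi>t t x * h + \<phi>x t x * k))
          (at (t, x) within {0..<T} \<times> {0..})) \<and>
     continuous_on ({0..<T} \<times> {0..}) (\<lambda>(t, x). \<phi>t t x) \<and>
     continuous_on ({0..<T} \<times> {0..}) (\<lambda>(t, x). \<phi>x t x) \<and>
     (\<exists>K. compact K \<and> K \<subseteq> {0..<T} \<times> {0..} \<and> (\<forall>(t, x)\<in>{0..<T} \<times> {0..} - K. \<phi> t x = 0))"

text \<open>As \<open>\<mu>\<close> stands for a class of families that agree for almost every time, the mass balance
  at every time is asked of some representative \<open>\<nu>\<close> of that class.\<close>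

definition N_solution ::
    "(real \<Rightarrow> real) \<Rightarrow> (real \<Rightarrow> real) \<Rightarrow> real \<Rightarrow> real \<Rightarrow> real measure \<Rightarrow> real \<Rightarrow> (real \<Rightarrow> real) \<Rightarrow> real \<Rightarrow>
     (real \<Rightarrow> real measure) \<Rightarrow> bool" where
  "N_solution a b \<rho> u_in \<mu>_in m N T \<mu> \<longleftrightarrow>
     0 < T \<and> N \<in> Linf_loc \<and> \<mu> \<in> Linf_M_f T \<and>
     (\<exists>u. continuous_on {0..T} u \<and> (\<forall>t\<in>{0..T}. 0 \<le> u t) \<and> u 0 = u_in \<and> (INF t\<in>{0..T}. u t) > \<rho> \<and>
        (\<exists>\<nu>. (\<forall>t\<in>{0..T}. \<nu> t \<in> M_f {0..}) \<and> (AE t in lebesgue_on {0..T}. \<nu> t = \<mu> t) \<and>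
           (\<forall>t\<in>{0..T}. integrable (\<nu> t) (\<lambda>x. x) \<and> u t + (\<integral>x. x \<partial>\<nu> t) = m)) \<and>
        (\<forall>\<phi> \<phi>t \<phi>x. C1_c T \<phi> \<phi>t \<phi>x \<longrightarrow>
           (\<integral>t. (\<integral>x. \<phi>t t x + (a x * u t - b x) * \<phi>x t x \<partial>\<mu> t) \<partial>lebesgue_on {0..T}) +
           (\<integral>x. \<phi> 0 x \<partial>\<mu>_in) +
           (\<integral>s. \<phi> s 0 * N (u s) \<partial>lebesgue_on {0..T}) = 0))"

definition BD_flux ::
    "real \<Rightarrow> real \<Rightarrow> real \<Rightarrow> real \<Rightarrow> (nat \<Rightarrow> real) \<Rightarrow> (nat \<Rightarrow> real) \<Rightarrow> real \<Rightarrow> (nat \<Rightarrow> real) \<Rightarrow> nat \<Rightarrow> real"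
where
  "BD_flux \<eta> \<epsilon> \<alpha> \<beta> a b u c i =
     (if i = 1 then \<alpha> * u\<^sup>2 - \<epsilon> powr \<eta> * \<beta> * c 2
      else a i * u * c i - b (i + 1) * c (i + 1))"

definition BD_solution ::
    "real \<Rightarrow> real \<Rightarrow> real \<Rightarrow> real \<Rightarrow> (nat \<Rightarrow> real) \<Rightarrow> (nat \<Rightarrow> real) \<Rightarrow> (real \<Rightarrow> real) \<Rightarrow> (nat \<Rightarrow> real \<Rightarrow> real) \<Rightarrow> bool"
where
  "BD_solution \<eta> \<epsilon> \<alpha> \<beta> a b u c \<longleftrightarrow>
     continuous_on {0..} u \<and> (\<forall>t\<ge>0. 0 \<le> u t) \<and>
     (\<forall>i\<ge>2. continuous_on {0..} (c i) \<and> (\<forall>t\<ge>0. 0 \<le> c i t)) \<and>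
     (\<forall>t\<ge>0. let J = BD_flux \<eta> \<epsilon> \<alpha> \<beta> a b (u t) (\<lambda>i. c i t) in
        summable (\<lambda>i. J (i + 1)) \<and>
        (u has_real_derivative (- \<epsilon> * J 1 - \<epsilon> * (\<Sum>i. J (i + 1)))) (at t within {0..}) \<and>
        (\<forall>i\<ge>2. (c i has_real_derivative ((1 / \<epsilon>) * (J (i - 1) - J i))) (at t within {0..})))"

definition cell :: "real \<Rightarrow> nat \<Rightarrow> real set" where
  "cell \<epsilon> i = {(real i - 1/2) * \<epsilon> ..< (real i + 1/2) * \<epsilon>}"

definition step_fun :: "nat \<Rightarrow> real \<Rightarrow> (nat \<Rightarrow> real) \<Rightarrow> real \<Rightarrow> real" where
  "step_fun k \<epsilon> v x = (\<Sum>\<^sub>\<infinity>i\<in>{k..}. v i * indicat_real (cell \<epsilon> i) x)"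

text \<open>The breakpoints of the piecewise \<open>C\<^sup>2\<close> functions are only required to be locally finite
  in \<open>[0, \<infinity>)\<close>.\<close>

definition superlinear_weights :: "(real \<Rightarrow> real) set" where
  "superlinear_weights = {\<Phi>. (\<forall>x\<ge>0. 0 \<le> \<Phi> x) \<and> convex_on {0..} \<Phi> \<and> \<Phi> 0 = 0 \<and>
     (\<exists>\<Phi>'. (\<forall>x\<ge>0. (\<Phi> has_real_derivative \<Phi>' x) (at x within {0..})) \<and>
        continuous_on {0..} \<Phi>' \<and>
        (\<forall>R>0. \<Phi>' piecewise_C1_differentiable_on {0..R}) \<and>
        concave_on {0..} \<Phi>' \<and> 0 \<le> \<Phi>' 0) \<and>
     filterlim (\<lambda>x. \<Phi> x / x) at_top at_top}"

end

theory Submission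
  imports Defs "HOL-Probability.Helly_Selection"
begin

text \<open>The cluster equations are a conservative scheme for the transport equation with velocity
  \<open>a u - b\<close>. Testing them with \<open>\<phi>(t, \<epsilon> i)\<close> gives an exact identity (\<open>tested_deriv\<close>) between sums of the form
  \<open>\<Sum> \<epsilon> \<psi>(\<epsilon> i) c\<^sub>i\<close>, plus the flux \<open>\<alpha> u\<^sup>2 - \<epsilon>\<^sup>\<eta> \<beta> c\<^sub>2\<close> into the smallest size, tested at \<open>x = 2 \<epsilon>\<close>. The limit measure
  lives on the closed half-line and may charge the origin. Since \<open>\<phi>\<close>, \<open>\<phi>x a\<close> and \<open>\<phi>x b\<close> are continuous up to
  the origin, every other term passes to the limit by weak-* convergence (\<open>Q_limit\<close>). The boundary
  condition is thus decided by the limit of \<open>\<epsilon>\<^sup>\<eta> c\<^sub>2\<close> alone, and the claim \<open>N(u) = \<alpha> u\<^sup>2\<close> says that it is 0.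

  This is where \<open>u > \<rho>\<close> and the exponential moments are used. As long as \<open>u\<close> exceeds \<open>\<rho>\<close> by a fixed amount,
  \<open>a u - e\<^sup>z b \<ge> \<kappa> x\<^sup>r\<close> near the origin for some small \<open>z > 0\<close>, with \<open>r = r_a\<close> (\<open>coercivity\<close>): small clusters are carried
  away from the origin. The moment \<open>H = \<Sum> e\<^sup>-\<^sup>i\<^sup>z c\<^sub>i\<close> then satisfies \<open>\<epsilon> H' \<le> C - \<kappa>' \<epsilon>\<^sup>r H\<close>, so \<open>\<epsilon>\<^sup>r H\<close> stays bounded
  because it is bounded initially (\<open>small_clusters_bound\<close>). Hence \<open>\<epsilon>\<^sup>r c\<^sub>2\<close> is bounded, and \<open>\<eta> > r\<close> gives
  \<open>\<epsilon>\<^sup>\<eta> c\<^sub>2 \<rightarrow> 0\<close>. The time \<open>T\<close> is chosen from a Lipschitz bound on \<open>u\<close> so that \<open>u\<close> cannot reach \<open>\<rho>\<close> before (\<open>uniform_bounds\<close>).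

  Number and mass of the clusters are bounded, and the tested sums are equicontinuous in time. Helly's
  selection theorem and a diagonal argument then give a subsequence that converges uniformly in time
  (\<open>compactness_of_densities\<close>, \<open>compactness\<close>). The superlinear moment is propagated by a Gronwall argument
  (\<open>superlinear_moment_propagation\<close>) and prevents mass from escaping to infinity. So the mass balance
  survives (\<open>first_moment\<close>), and it identifies the limit of \<open>u\<close>.

  All this rests on the moment equation for weights of linear growth (\<open>mom_deriv\<close>). It is proved for the
  infinite system by Dini's theorem: the mass is a continuous function of time, so the tails of the
  series in the cluster size are small uniformly in time.\<close>

section \<open>Step densities and their sampled sums\<close>

lemma mem_cell_iff:
  assumes "0 < \<epsilon>" "1 \<le> i"
  shows "x \<in> cell \<epsilon> i \<longleftrightarrow> nat \<lfloor>x / \<epsilon> + 1/2\<rfloor> = i"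
proof -
  have "x \<in> cell \<epsilon> i \<longleftrightarrow> \<lfloor>x / \<epsilon> + 1/2\<rfloor> = int i"
    using assms(1) by (auto simp: cell_def floor_eq_iff field_simps)
  also have "\<dots> \<longleftrightarrow> nat \<lfloor>x / \<epsilon> + 1/2\<rfloor> = i" using assms(2) by linarith
  finally show ?thesis .
qed

lemma step_fun_eq:
  assumes "0 < \<epsilon>" "1 \<le> k"
  shows "step_fun k \<epsilon> v x = (let i = nat \<lfloor>x / \<epsilon> + 1/2\<rfloor> in if k \<le> i then v i else 0)"
proof -
  define j where "j = nat \<lfloor>x / \<epsilon> + 1/2\<rfloor>"
  have c: "indicat_real (cell \<epsilon> i) x = (if i = j then 1 else 0)" if "k \<le> i" for i
    using mem_cell_iff[OF assms(1), of i x] that assms(2) by (auto simp: j_def indicator_def)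
  have "step_fun k \<epsilon> v x = (\<Sum>\<^sub>\<infinity>i\<in>{j} \<inter> {k..}. v i)"
    unfolding step_fun_def by (rule infsum_cong_neutral) (auto simp: c split: if_splits)
  also have "\<dots> = (if k \<le> j then v j else 0)"
    by auto
  finally show ?thesis by (simp add: j_def Let_def)
qed

lemma step_fun_on_cell:
  assumes "0 < \<epsilon>" "1 \<le> k" "k \<le> i" "x \<in> cell \<epsilon> i"
  shows "step_fun k \<epsilon> v x = v i"
proof -
  have "nat \<lfloor>x / \<epsilon> + 1/2\<rfloor> = i" using assms by (simp add: mem_cell_iff[symmetric])
  then show ?thesis using assms by (simp add: step_fun_eq)
qed

lemma centre_in_cell: "0 < \<epsilon> \<Longrightarrow> \<epsilon> * real i \<in> cell \<epsilon> i"
  by (simp add: cell_def algebra_simps)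

lemma step_fun_centre:
  "0 < \<epsilon> \<Longrightarrow> 1 \<le> k \<Longrightarrow> k \<le> i \<Longrightarrow> step_fun k \<epsilon> v (\<epsilon> * real i) = v i"
  by (rule step_fun_on_cell) (auto intro: centre_in_cell)

lemma borel_measurable_step_fun:
  assumes "0 < \<epsilon>" "1 \<le> k"
  shows "step_fun k \<epsilon> v \<in> borel_measurable borel"
proof -
  have eq: "step_fun k \<epsilon> v = (\<lambda>i. if k \<le> i then v i else 0) \<circ> (\<lambda>x. nat \<lfloor>x / \<epsilon> + 1/2\<rfloor>)"
    using assms by (auto simp: step_fun_eq Let_def fun_eq_iff)
  have "(\<lambda>x. nat \<lfloor>x / \<epsilon> + 1/2\<rfloor>) \<in> borel \<rightarrow>\<^sub>M count_space UNIV"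
    by measurable
  then show ?thesis unfolding eq by (rule measurable_comp) simp
qed

lemma step_fun_nonneg:
  assumes "0 < \<epsilon>" "1 \<le> k" "\<And>i. k \<le> i \<Longrightarrow> 0 \<le> v i"
  shows "0 \<le> step_fun k \<epsilon> v x"
  using assms by (auto simp: step_fun_eq Let_def)

lemma step_fun_sums:
  assumes "0 < \<epsilon>" "1 \<le> k"
  shows "(\<lambda>j. v (j + k) * indicat_real (cell \<epsilon> (j + k)) x) sums step_fun k \<epsilon> v x"
proof -
  define i where "i = nat \<lfloor>x / \<epsilon> + 1/2\<rfloor>"
  have c: "indicat_real (cell \<epsilon> (j + k)) x = (if j + k = i then 1 else 0)" for j
    using mem_cell_iff[OF assms(1), of "j + k" x] assms(2) by (auto simp: i_def indicator_def)
  have "(\<lambda>j. v (j + k) * indicat_real (cell \<epsilon> (j + k)) x) sums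
     (\<Sum>j\<in>{i - k}. v (j + k) * indicat_real (cell \<epsilon> (j + k)) x)"
    by (rule sums_finite) (auto simp: c)
  also have "(\<Sum>j\<in>{i - k}. v (j + k) * indicat_real (cell \<epsilon> (j + k)) x) = step_fun k \<epsilon> v x"
    using assms by (auto simp: c step_fun_eq i_def[symmetric] Let_def)
  finally show ?thesis .
qed

lemma space_density_measure: "space (density_measure f) = {0..}"
  by (simp add: density_measure_def)

lemma sets_density_measure: "sets (density_measure f) = sets (restrict_space borel {0..})"
  unfolding density_measure_def by (simp cong: sets_restrict_space_cong)

lemma measurable_restrict_borel: "f \<in> borel_measurable borel \<Longrightarrow> f \<in> borel_measurable (restrict_space lborel A)"
  by (simp add: measurable_restrict_space1)

lemma
  fixes f \<phi> :: "real \<Rightarrow> real"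
  assumes [measurable]: "f \<in> borel_measurable borel" "\<phi> \<in> borel_measurable borel" and nn: "\<And>x. 0 \<le> f x"
  shows integrable_density_measure:
      "integrable (density_measure f) \<phi> \<longleftrightarrow> integrable lborel (\<lambda>x. indicator {0..} x * (f x * \<phi> x))"
    and integral_density_measure:
      "(\<integral>x. \<phi> x \<partial>density_measure f) = (\<integral>x. indicator {0..} x * (f x * \<phi> x) \<partial>lborel)"
proof -
  have m: "f \<in> borel_measurable (restrict_space lborel {0..})" "\<phi> \<in> borel_measurable (restrict_space lborel {0..})"
    by (auto intro!: measurable_restrict_borel)
  show "integrable (density_measure f) \<phi> \<longleftrightarrow> integrable lborel (\<lambda>x. indicator {0..} x * (f x * \<phi> x))"
    unfolding density_measure_def using m nn
    by (subst integrable_density) (auto simp: integrable_restrict_space)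
  show "(\<integral>x. \<phi> x \<partial>density_measure f) = (\<integral>x. indicator {0..} x * (f x * \<phi> x) \<partial>lborel)"
    unfolding density_measure_def using m nn
    by (subst integral_density) (auto simp: integral_restrict_space)
qed

lemma cell_subset: "0 < \<epsilon> \<Longrightarrow> 1 \<le> i \<Longrightarrow> cell \<epsilon> i \<subseteq> {0..}"
proof
  fix x assume a: "0 < \<epsilon>" "1 \<le> i" "x \<in> cell \<epsilon> i"
  have "0 \<le> (real i - 1/2) * \<epsilon>" using a by simp
  also have "\<dots> \<le> x" using a by (simp add: cell_def)
  finally show "x \<in> {0..}" by simp
qed

lemma
  assumes e: "0 < \<epsilon>" "1 \<le> k" and v: "\<And>i. k \<le> i \<Longrightarrow> 0 \<le> v i"
    and meas[measurable]: "\<phi> \<in> borel_measurable borel"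
    and int: "\<And>j. set_integrable lborel (cell \<epsilon> (j + k)) \<phi>"
    and summ: "summable (\<lambda>j. v (j + k) * (LINT x:cell \<epsilon> (j + k)|lborel. \<bar>\<phi> x\<bar>))"
  shows integrable_step_measure: "integrable (density_measure (step_fun k \<epsilon> v)) \<phi>"
    and sums_step_measure: "(\<lambda>j. v (j + k) * (LINT x:cell \<epsilon> (j + k)|lborel. \<phi> x)) sums
      (\<integral>x. \<phi> x \<partial>density_measure (step_fun k \<epsilon> v))"
proof -
  note [measurable] = borel_measurable_step_fun[OF e]
  define F where "F j x = v (j + k) * (indicat_real (cell \<epsilon> (j + k)) x * \<phi> x)" for j x
  have F: "integrable lborel (F j)" for j
    unfolding F_def using int[of j] by (intro integrable_mult_right) (simp add: set_integrable_def)
  have nF: "norm (F j x) = v (j + k) * (indicat_real (cell \<epsilon> (j + k)) x * \<bar>\<phi> x\<bar>)" for j x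
    using v[of "j + k"] by (simp add: F_def abs_mult)
  have ev: "norm (F j x) = (v (j + k) * indicat_real (cell \<epsilon> (j + k)) x) * \<bar>\<phi> x\<bar>" for j x
    unfolding nF by simp
  have s1: "summable (\<lambda>j. norm (F j x))" for x
    unfolding ev by (rule summable_mult2) (rule sums_summable[OF step_fun_sums[OF e]])
  have s2: "summable (\<lambda>j. \<integral>x. norm (F j x) \<partial>lborel)"
    using summ unfolding nF by (simp add: set_lebesgue_integral_def)
  have lim: "(\<Sum>j. F j x) = indicator {0..} x * (step_fun k \<epsilon> v x * \<phi> x)" for x
  proof -
    have "F j x = (v (j + k) * indicat_real (cell \<epsilon> (j + k)) x) * (indicator {0..} x * \<phi> x)" for j
      using cell_subset[of \<epsilon> "j + k"] e by (auto simp: F_def indicator_def)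
    then have "F j x = (v (j + k) * indicat_real (cell \<epsilon> (j + k)) x) * (indicator {0..} x * \<phi> x)" for j
      by simp
    moreover have "(\<lambda>j. (v (j + k) * indicat_real (cell \<epsilon> (j + k)) x) * (indicator {0..} x * \<phi> x)) sums
       (step_fun k \<epsilon> v x * (indicator {0..} x * \<phi> x))"
      by (rule sums_mult2[OF step_fun_sums[OF e]])
    ultimately show ?thesis by (simp add: sums_iff mult.left_commute)
  qed
  show "integrable (density_measure (step_fun k \<epsilon> v)) \<phi>"
    using integrable_suminf[OF F _ s2] s1 step_fun_nonneg[OF e v]
    by (subst integrable_density_measure) (auto simp: lim)
  have "(\<lambda>j. integral\<^sup>L lborel (F j)) sums (\<integral>x. (\<Sum>j. F j x) \<partial>lborel)"
    using s1 by (intro sums_integral F s2) auto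
  then show "(\<lambda>j. v (j + k) * (LINT x:cell \<epsilon> (j + k)|lborel. \<phi> x)) sums
      (\<integral>x. \<phi> x \<partial>density_measure (step_fun k \<epsilon> v))"
    using step_fun_nonneg[OF e v]
    by (subst integral_density_measure) (auto simp: lim, simp add: F_def[abs_def] set_lebesgue_integral_def)
qed

lemma emeasure_cell: "0 < \<epsilon> \<Longrightarrow> emeasure lborel (cell \<epsilon> i) = ennreal \<epsilon>"
  by (simp add: cell_def field_simps)

lemma sets_cell[measurable]: "cell \<epsilon> i \<in> sets borel"
  by (simp add: cell_def)

lemma bounded_integrable_cell:
  fixes B :: real
  assumes "0 < \<epsilon>" and [measurable]: "\<phi> \<in> borel_measurable borel" and b: "\<And>x. x \<in> cell \<epsilon> i \<Longrightarrow> \<bar>\<phi> x\<bar> \<le> B"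
  shows "set_integrable lborel (cell \<epsilon> i) \<phi>"
  unfolding set_integrable_def
proof (rule Bochner_Integration.integrable_bound[where f="\<lambda>x. indicat_real (cell \<epsilon> i) x * B"])
  show "integrable lborel (\<lambda>x. indicat_real (cell \<epsilon> i) x * B)"
    using emeasure_cell[OF assms(1), of i] by (intro integrable_mult_left) auto
  show "AE x in lborel. norm (indicat_real (cell \<epsilon> i) x *\<^sub>R \<phi> x) \<le> norm (indicat_real (cell \<epsilon> i) x * B)"
    using b by (intro AE_I2) (auto simp: indicator_def intro: order_trans[OF _ abs_ge_self])
qed simp

lemma integral_cell_const: "0 < \<epsilon> \<Longrightarrow> (LINT x:cell \<epsilon> i|lborel. c) = \<epsilon> * c"
  using emeasure_cell[of \<epsilon> i]
  by (simp add: set_lebesgue_integral_def measure_def)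

lemma integral_cell_close:
  assumes e: "0 < \<epsilon>" and m: "\<phi> \<in> borel_measurable borel" and b: "\<And>x. x \<in> cell \<epsilon> i \<Longrightarrow> \<bar>\<phi> x - y\<bar> \<le> w"
  shows "\<bar>(LINT x:cell \<epsilon> i|lborel. \<phi> x) - \<epsilon> * y\<bar> \<le> \<epsilon> * w"
proof -
  have detach: "\<bar>\<phi> x\<bar> \<le> w + \<bar>y\<bar>" if "x \<in> cell \<epsilon> i" for x using b[OF that] by linarith
  have I: "set_integrable lborel (cell \<epsilon> i) \<phi>" by (rule bounded_integrable_cell[OF e m detach])
  have C: "set_integrable lborel (cell \<epsilon> i) (\<lambda>x. z)" for z :: real
    by (rule bounded_integrable_cell[OF e, where B="\<bar>z\<bar>"]) auto
  have "(LINT x:cell \<epsilon> i|lborel. \<phi> x) \<le> (LINT x:cell \<epsilon> i|lborel. y + w)"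
    by (rule set_integral_mono[OF I C]) (use b in \<open>force simp: abs_le_iff\<close>)
  moreover have "(LINT x:cell \<epsilon> i|lborel. y - w) \<le> (LINT x:cell \<epsilon> i|lborel. \<phi> x)"
    by (rule set_integral_mono[OF C I]) (use b in \<open>force simp: abs_le_iff\<close>)
  ultimately show ?thesis using e by (simp add: integral_cell_const algebra_simps abs_le_iff)
qed

lemma
  assumes e: "0 < \<epsilon>" "1 \<le> k" and v: "\<And>i. k \<le> i \<Longrightarrow> 0 \<le> v i" and summ: "summable (\<lambda>j. v (j + k))"
  shows finite_measure_step: "finite_measure (density_measure (step_fun k \<epsilon> v))"
    and measure_step: "measure (density_measure (step_fun k \<epsilon> v)) {0..} = (\<Sum>j. \<epsilon> * v (j + k))"
proof -
  have s: "summable (\<lambda>j. v (j + k) * (LINT x:cell \<epsilon> (j + k)|lborel. \<bar>1 :: real\<bar>))"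
    using e summ by (simp add: integral_cell_const summable_mult2)
  have i: "set_integrable lborel (cell \<epsilon> (j + k)) (\<lambda>x. 1 :: real)" for j
    by (rule bounded_integrable_cell[where B=1]) (use e in auto)
  have I: "integrable (density_measure (step_fun k \<epsilon> v)) (\<lambda>x. 1 :: real)"
    by (rule integrable_step_measure[OF e v _ i s]) auto
  show f: "finite_measure (density_measure (step_fun k \<epsilon> v))"
  proof (rule finite_measureI)
    have "(\<integral>\<^sup>+x. ennreal (norm (1 :: real)) \<partial>density_measure (step_fun k \<epsilon> v)) < \<infinity>"
      using I by (simp only: integrable_iff_bounded)
    then show "emeasure (density_measure (step_fun k \<epsilon> v)) (space (density_measure (step_fun k \<epsilon> v))) \<noteq> \<infinity>"
      by simp
  qed
  then interpret finite_measure "density_measure (step_fun k \<epsilon> v)" .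
  have "(\<lambda>j. v (j + k) * (LINT x:cell \<epsilon> (j + k)|lborel. 1)) sums
      (\<integral>x. 1 \<partial>density_measure (step_fun k \<epsilon> v))"
    by (rule sums_step_measure[OF e v _ i s]) auto
  then show "measure (density_measure (step_fun k \<epsilon> v)) {0..} = (\<Sum>j. \<epsilon> * v (j + k))"
    using e by (simp add: space_density_measure integral_cell_const sums_iff mult.commute)
qed

text \<open>A test function that varies by at most \<open>w\<close> across each cell may be sampled at the cell centres. This
  lets all later estimates be made for sums over cluster sizes.\<close>

lemma
  assumes e: "0 < \<epsilon>" "1 \<le> k" and v: "\<And>i. k \<le> i \<Longrightarrow> 0 \<le> v i" and summ: "summable (\<lambda>j. v (j + k))"
    and meas[measurable]: "\<phi> \<in> borel_measurable borel"
    and abs: "summable (\<lambda>j. v (j + k) * \<bar>\<phi> (\<epsilon> * real (j + k))\<bar>)"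
    and w: "\<And>i x. k \<le> i \<Longrightarrow> x \<in> cell \<epsilon> i \<Longrightarrow> \<bar>\<phi> x - \<phi> (\<epsilon> * real i)\<bar> \<le> w"
  shows integrable_step_measure_sampled: "integrable (density_measure (step_fun k \<epsilon> v)) \<phi>"
    and integral_step_measure_sampled:
      "\<bar>(\<integral>x. \<phi> x \<partial>density_measure (step_fun k \<epsilon> v)) - (\<Sum>j. \<epsilon> * \<phi> (\<epsilon> * real (j + k)) * v (j + k))\<bar>
        \<le> w * (\<Sum>j. \<epsilon> * v (j + k))"
proof -
  have w0: "\<bar>(LINT x:cell \<epsilon> (j + k)|lborel. \<phi> x) - \<epsilon> * \<phi> (\<epsilon> * real (j + k))\<bar> \<le> \<epsilon> * w" for j
    by (rule integral_cell_close[OF e(1) meas]) (rule w, auto)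
  have aw: "\<bar>\<bar>\<phi> x\<bar> - \<bar>\<phi> (\<epsilon> * real (j + k))\<bar>\<bar> \<le> w" if "x \<in> cell \<epsilon> (j + k)" for x j
    using w[of "j + k" x] that by simp
  have wa: "\<bar>(LINT x:cell \<epsilon> (j + k)|lborel. \<bar>\<phi> x\<bar>) - \<epsilon> * \<bar>\<phi> (\<epsilon> * real (j + k))\<bar>\<bar> \<le> \<epsilon> * w" for j
    by (rule integral_cell_close[OF e(1)]) (use aw in auto)
  have "0 \<le> (LINT x:cell \<epsilon> i|lborel. \<bar>\<phi> x\<bar>)" for i
    unfolding set_lebesgue_integral_def by (rule integral_nonneg_AE) auto
  then have nb: "\<bar>v (j + k) * (LINT x:cell \<epsilon> (j + k)|lborel. \<bar>\<phi> x\<bar>)\<bar>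
      \<le> \<epsilon> * (v (j + k) * \<bar>\<phi> (\<epsilon> * real (j + k))\<bar>) + (\<epsilon> * w) * v (j + k)" for j
  proof -
    have "v (j + k) * (LINT x:cell \<epsilon> (j + k)|lborel. \<bar>\<phi> x\<bar>)
        \<le> v (j + k) * (\<epsilon> * \<bar>\<phi> (\<epsilon> * real (j + k))\<bar> + \<epsilon> * w)"
      by (rule mult_left_mono) (use wa[of j] v[of "j + k"] in auto)
    moreover have "0 \<le> v (j + k) * (LINT x:cell \<epsilon> (j + k)|lborel. \<bar>\<phi> x\<bar>)"
      using v[of "j + k"] \<open>\<And>i. 0 \<le> (LINT x:cell \<epsilon> i|lborel. \<bar>\<phi> x\<bar>)\<close> by simp
    ultimately show ?thesis by (simp add: algebra_simps)
  qed
  have i: "set_integrable lborel (cell \<epsilon> (j + k)) \<phi>" for j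
    by (rule bounded_integrable_cell[where B="w + \<bar>\<phi> (\<epsilon> * real (j + k))\<bar>"]) (use e aw[of _ j] in force)+
  have s: "summable (\<lambda>j. v (j + k) * (LINT x:cell \<epsilon> (j + k)|lborel. \<bar>\<phi> x\<bar>))"
    by (rule summable_comparison_test'[OF summable_add[OF summable_mult[OF abs] summable_mult[OF summ]]])
       (use nb in auto)
  show "integrable (density_measure (step_fun k \<epsilon> v)) \<phi>"
    by (rule integrable_step_measure[OF e v meas i s])
  have I: "(\<lambda>j. v (j + k) * (LINT x:cell \<epsilon> (j + k)|lborel. \<phi> x)) sums
      (\<integral>x. \<phi> x \<partial>density_measure (step_fun k \<epsilon> v))"
    by (rule sums_step_measure[OF e v meas i s])
  have abs': "summable (\<lambda>j. v (j + k) * \<phi> (\<epsilon> * real (j + k)))"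
    by (rule summable_comparison_test'[OF abs]) (use v in \<open>simp add: abs_mult\<close>)
  then have S: "(\<lambda>j. \<epsilon> * (v (j + k) * \<phi> (\<epsilon> * real (j + k)))) sums (\<Sum>j. \<epsilon> * (v (j + k) * \<phi> (\<epsilon> * real (j + k))))"
    by (intro summable_sums summable_mult)
  note D = sums_diff[OF I S]
  have db: "norm (v (j + k) * (LINT x:cell \<epsilon> (j + k)|lborel. \<phi> x) - \<epsilon> * (v (j + k) * \<phi> (\<epsilon> * real (j + k))))
      \<le> w * (\<epsilon> * v (j + k))" for j
  proof -
    have "norm (v (j + k) * (LINT x:cell \<epsilon> (j + k)|lborel. \<phi> x) - \<epsilon> * (v (j + k) * \<phi> (\<epsilon> * real (j + k))))
      = v (j + k) * \<bar>(LINT x:cell \<epsilon> (j + k)|lborel. \<phi> x) - \<epsilon> * \<phi> (\<epsilon> * real (j + k))\<bar>"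
    proof -
      have "v (j + k) * (LINT x:cell \<epsilon> (j + k)|lborel. \<phi> x) - \<epsilon> * (v (j + k) * \<phi> (\<epsilon> * real (j + k)))
        = v (j + k) * ((LINT x:cell \<epsilon> (j + k)|lborel. \<phi> x) - \<epsilon> * \<phi> (\<epsilon> * real (j + k)))"
        by (simp add: right_diff_distrib)
      then show ?thesis using v[of "j + k"] by (simp only: real_norm_def abs_mult) simp
    qed
    also have "\<dots> \<le> v (j + k) * (\<epsilon> * w)" by (rule mult_left_mono[OF w0]) (use v in auto)
    finally show ?thesis by (simp add: algebra_simps)
  qed
  have "norm (\<Sum>j. v (j + k) * (LINT x:cell \<epsilon> (j + k)|lborel. \<phi> x) - \<epsilon> * (v (j + k) * \<phi> (\<epsilon> * real (j + k))))
      \<le> (\<Sum>j. w * (\<epsilon> * v (j + k)))"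
    by (rule norm_suminf_le[OF db]) (intro summable_mult summ)
  also have "\<dots> = w * (\<Sum>j. \<epsilon> * v (j + k))"
    by (intro suminf_mult summable_mult summ)
  finally show "\<bar>(\<integral>x. \<phi> x \<partial>density_measure (step_fun k \<epsilon> v)) - (\<Sum>j. \<epsilon> * \<phi> (\<epsilon> * real (j + k)) * v (j + k))\<bar>
        \<le> w * (\<Sum>j. \<epsilon> * v (j + k))"
    using D by (simp add: sums_iff mult_ac)
qed

text \<open>On the right half of a cell a nondecreasing weight is at least its value at the centre; giving up
  the left half costs the factor 2.\<close>

lemma sampled_sum_le_nn_integral:
  assumes e: "0 < \<epsilon>" "1 \<le> k" and v: "\<And>i. k \<le> i \<Longrightarrow> 0 \<le> v i"
    and \<Phi>: "\<And>x y. 0 \<le> x \<Longrightarrow> x \<le> y \<Longrightarrow> \<Phi> x \<le> \<Phi> y" "\<And>x. 0 \<le> x \<Longrightarrow> 0 \<le> \<Phi> x"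
  shows "ennreal (\<Sum>j<N. \<epsilon> * \<Phi> (\<epsilon> * real (j + k)) * v (j + k))
    \<le> 2 * (\<integral>\<^sup>+x\<in>{0..}. ennreal (\<Phi> x * step_fun k \<epsilon> v x) \<partial>lborel)"
proof -
  define R where "R j = {\<epsilon> * real (j + k) ..< (real (j + k) + 1/2) * \<epsilon>}" for j
  have R: "emeasure lborel (R j) = ennreal (\<epsilon> / 2)" for j
    using e by (simp add: R_def field_simps)
  have [measurable]: "R j \<in> sets borel" for j by (simp add: R_def)
  have Rc: "R j \<subseteq> cell \<epsilon> (j + k)" for j
    using e by (auto simp: R_def cell_def algebra_simps)
  have nn: "0 \<le> \<Phi> (\<epsilon> * real (j + k)) * v (j + k)" for j
    using e v \<Phi>(2) by simp
  have "ennreal (\<Sum>j<N. \<epsilon> * \<Phi> (\<epsilon> * real (j + k)) * v (j + k))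
      = (\<Sum>j<N. 2 * (ennreal (\<Phi> (\<epsilon> * real (j + k)) * v (j + k)) * ennreal (\<epsilon> / 2)))"
  proof -
    have "ennreal (\<epsilon> * \<Phi> (\<epsilon> * real (j + k)) * v (j + k)) = 2 * (ennreal (\<Phi> (\<epsilon> * real (j + k)) * v (j + k)) * ennreal (\<epsilon> / 2))" for j
    proof -
      define X where "X = \<Phi> (\<epsilon> * real (j + k)) * v (j + k)"
      have "2 * (ennreal X * ennreal (\<epsilon> / 2)) = ennreal 2 * ennreal (X * (\<epsilon> / 2))"
        using nn[of j] e by (subst ennreal_mult) (auto simp: X_def)
      also have "\<dots> = ennreal (2 * (X * (\<epsilon> / 2)))"
        using nn[of j] e by (subst ennreal_mult) (auto simp: X_def)
      also have "2 * (X * (\<epsilon> / 2)) = \<epsilon> * \<Phi> (\<epsilon> * real (j + k)) * v (j + k)"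
        by (simp add: X_def)
      finally show ?thesis by (simp add: X_def)
    qed
    moreover have "0 \<le> \<epsilon> * \<Phi> (\<epsilon> * real (j + k)) * v (j + k)" for j
      using nn[of j] e by (simp add: mult.assoc)
    ultimately show ?thesis by (simp add: sum_ennreal[symmetric])
  qed
  also have "\<dots> = 2 * (\<Sum>j<N. \<integral>\<^sup>+x. ennreal (\<Phi> (\<epsilon> * real (j + k)) * v (j + k)) * indicator (R j) x \<partial>lborel)"
    by (simp add: sum_distrib_left nn_integral_cmult_indicator R)
  also have "\<dots> = 2 * (\<integral>\<^sup>+x. (\<Sum>j<N. ennreal (\<Phi> (\<epsilon> * real (j + k)) * v (j + k)) * indicator (R j) x) \<partial>lborel)"
    by (subst nn_integral_sum) auto
  also have "\<dots> \<le> 2 * (\<integral>\<^sup>+x\<in>{0..}. ennreal (\<Phi> x * step_fun k \<epsilon> v x) \<partial>lborel)"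
  proof (intro mult_left_mono nn_integral_mono)
    fix x :: real
    show "(\<Sum>j<N. ennreal (\<Phi> (\<epsilon> * real (j + k)) * v (j + k)) * indicator (R j) x)
        \<le> ennreal (\<Phi> x * step_fun k \<epsilon> v x) * indicator {0..} x"
    proof (cases "0 \<le> x")
      case False
      have "x \<notin> R j" for j using Rc[of j] cell_subset[of \<epsilon> "j + k"] e False by auto
      then show ?thesis by simp
    next
      case True
      have "ennreal (\<Phi> (\<epsilon> * real (j + k)) * v (j + k)) * indicator (R j) x
          \<le> ennreal (\<Phi> x * (v (j + k) * indicat_real (cell \<epsilon> (j + k)) x))" for j
      proof (cases "x \<in> R j")
        case True
        then have "\<Phi> (\<epsilon> * real (j + k)) \<le> \<Phi> x" using e by (intro \<Phi>) (auto simp: R_def)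
        moreover have "x \<in> cell \<epsilon> (j + k)" using True Rc[of j] by auto
        ultimately have "\<Phi> (\<epsilon> * real (j + k)) * v (j + k) \<le> \<Phi> x * (v (j + k) * indicat_real (cell \<epsilon> (j + k)) x)"
          using v[of "j + k"] by (simp add: mult_right_mono)
        then show ?thesis using True by (simp add: ennreal_leI)
      qed simp
      then have "(\<Sum>j<N. ennreal (\<Phi> (\<epsilon> * real (j + k)) * v (j + k)) * indicator (R j) x)
          \<le> (\<Sum>j<N. ennreal (\<Phi> x * (v (j + k) * indicat_real (cell \<epsilon> (j + k)) x)))"
        by (rule sum_mono)
      also have "\<dots> = ennreal (\<Phi> x * (\<Sum>j<N. v (j + k) * indicat_real (cell \<epsilon> (j + k)) x))"
        unfolding sum_distrib_left using \<Phi>(2)[OF True] v by (intro sum_ennreal) auto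
      also have "\<dots> \<le> ennreal (\<Phi> x * step_fun k \<epsilon> v x)"
      proof (intro ennreal_leI mult_left_mono \<Phi>(2)[OF True])
        note S = step_fun_sums[OF e, of v x]
        show "(\<Sum>j<N. v (j + k) * indicat_real (cell \<epsilon> (j + k)) x) \<le> step_fun k \<epsilon> v x"
          unfolding sums_unique[OF S] using v by (intro sum_le_suminf sums_summable[OF S]) auto
      qed
      finally show ?thesis using True by simp
    qed
  qed simp
  finally show ?thesis .
qed

section \<open>Selection of convergent families of densities\<close>

lemma continuous_on_compose_max:
  fixes \<phi> :: "real \<Rightarrow> real"
  assumes "continuous_on {0..} \<phi>"
  shows "continuous_on UNIV (\<lambda>x. \<phi> (max 0 x))"
  by (rule continuous_on_compose2[OF assms]) (auto intro!: continuous_intros)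

lemma C_c_continuous: "\<phi> \<in> C_c {0..} \<Longrightarrow> continuous_on {0..} \<phi>"
  by (simp add: C_c_def)

lemma C_c_support:
  assumes "\<phi> \<in> C_c {0..}"
  shows "\<exists>X>0. \<forall>x\<ge>X. \<phi> x = 0"
proof -
  obtain K where K: "compact K" "\<forall>x\<in>{0..} - K. \<phi> x = 0" using assms by (auto simp: C_c_def)
  obtain B where B: "\<forall>x\<in>K. \<bar>x\<bar> \<le> B" using compact_imp_bounded[OF K(1)] by (auto simp: bounded_iff)
  have "\<phi> x = 0" if "max 0 B + 1 \<le> x" for x
    using B K(2) that by force
  then show ?thesis by (intro exI[of _ "max 0 B + 1"]) auto
qed

lemma C_c_intro:
  assumes "continuous_on {0..} \<phi>" "\<And>x. X \<le> x \<Longrightarrow> \<phi> x = 0"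
  shows "\<phi> \<in> C_c {0..}"
proof -
  have "compact {0..X}" "{0..X} \<subseteq> {0..}" "\<forall>x\<in>{0..} - {0..X}. \<phi> x = 0" using assms by auto
  then show ?thesis using assms(1) unfolding C_c_def by blast
qed

lemma C_c_bounded:
  assumes "\<phi> \<in> C_c {0..}"
  shows "\<exists>B>0. \<forall>x\<ge>0. \<bar>\<phi> x\<bar> \<le> B"
proof -
  obtain X where X: "0 < X" "\<And>x. X \<le> x \<Longrightarrow> \<phi> x = 0" using C_c_support[OF assms] by blast
  have "compact (\<phi> ` {0..X})"
    by (intro compact_continuous_image continuous_on_subset[OF C_c_continuous[OF assms]]) auto
  then obtain B where B: "\<forall>x\<in>{0..X}. \<bar>\<phi> x\<bar> \<le> B" using compact_imp_bounded by (fastforce simp: bounded_iff)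
  have "\<bar>\<phi> x\<bar> \<le> max 1 B" if "0 \<le> x" for x
    using B X(2)[of x] that by (cases "x \<le> X") force+
  then show ?thesis by (intro exI[of _ "max 1 B"]) auto
qed

lemma C_c_uniformly_continuous:
  assumes "\<phi> \<in> C_c {0..}" "0 < \<delta>"
  shows "\<exists>d>0. \<forall>x\<ge>0. \<forall>y\<ge>0. \<bar>x - y\<bar> \<le> d \<longrightarrow> \<bar>\<phi> x - \<phi> y\<bar> \<le> \<delta>"
proof -
  obtain X where X: "0 < X" "\<And>x. X \<le> x \<Longrightarrow> \<phi> x = 0" using C_c_support[OF assms(1)] by blast
  have "uniformly_continuous_on {0..X} \<phi>"
    by (intro compact_uniformly_continuous continuous_on_subset[OF C_c_continuous[OF assms(1)]]) auto
  then obtain d where d: "0 < d" "\<And>x y. x \<in> {0..X} \<Longrightarrow> y \<in> {0..X} \<Longrightarrow> dist x y < d \<Longrightarrow> dist (\<phi> x) (\<phi> y) < \<delta>"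
    using assms(2) unfolding uniformly_continuous_on_def by metis
  have cutoff: "\<phi> x = \<phi> (min x X)" for x using X(2)[of x] X(2)[of X] by (auto simp: min_def)
  have "\<bar>\<phi> x - \<phi> y\<bar> \<le> \<delta>" if "0 \<le> x" "0 \<le> y" "\<bar>x - y\<bar> \<le> d / 2" for x y
  proof -
    have "dist (\<phi> (min x X)) (\<phi> (min y X)) < \<delta>"
      using that X(1) d(1) by (intro d(2)) (auto simp: dist_real_def min_def)
    then show ?thesis using cutoff[of x] cutoff[of y] by (simp add: dist_real_def)
  qed
  then show ?thesis using d(1) by (intro exI[of _ "d / 2"]) auto
qed

lemma integral_density_measure_max:
  "(\<integral>x. \<phi> x \<partial>density_measure f) = (\<integral>x. \<phi> (max 0 x) \<partial>density_measure f)"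
  by (rule Bochner_Integration.integral_cong) (auto simp: space_density_measure)

lemma M_f_D:
  assumes "M \<in> M_f {0..}"
  shows "space M = {0..}" "finite_measure M" "sets M = sets (restrict_space borel {0..})"
  using assms sets_eq_imp_space_eq[of M "restrict_space borel {0..}"] by (auto simp: M_f_def)

lemma borel_measurable_M_f:
  fixes \<phi> :: "real \<Rightarrow> real"
  assumes "M \<in> M_f {0..}" "continuous_on {0..} \<phi>"
  shows "\<phi> \<in> borel_measurable M"
proof -
  have "\<phi> \<in> borel_measurable (restrict_space borel {0..})"
    by (rule borel_measurable_continuous_on_restrict[OF assms(2)])
  then show ?thesis using M_f_D(3)[OF assms(1)] by (simp cong: measurable_cong_sets)
qed

lemma integrable_M_f:
  fixes \<phi> :: "real \<Rightarrow> real"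
  assumes M: "M \<in> M_f {0..}" "continuous_on {0..} \<phi>" "\<And>x. 0 \<le> x \<Longrightarrow> \<bar>\<phi> x\<bar> \<le> B"
  shows "integrable M \<phi>"
proof -
  interpret finite_measure M by (rule M_f_D[OF M(1)])
  show ?thesis
    by (rule integrable_const_bound[where B=B]) (use M M_f_D[OF M(1)] borel_measurable_M_f in auto)
qed

lemma real_distribution_density:
  assumes int: "integrable lborel w" and nn: "\<And>x. 0 \<le> w x" and one: "(\<integral>x. w x \<partial>lborel) = 1"
  shows "real_distribution (density lborel (\<lambda>x. ennreal (w x)))"
proof -
  have "emeasure (density lborel (\<lambda>x. ennreal (w x))) UNIV = (\<integral>\<^sup>+x. ennreal (w x) \<partial>lborel)"
    using int by (subst emeasure_density) (auto dest: borel_measurable_integrable)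
  also have "\<dots> = 1" using nn_integral_eq_integral[OF int] nn one by simp
  finally show ?thesis
    by (auto simp: real_distribution_def real_distribution_axioms_def intro!: prob_spaceI)
qed

text \<open>Helly's theorem speaks of probability measures on the whole line. So each measure is divided by
  \<open>C\<close>, and the missing mass is parked uniformly on \<open>[-2, -1]\<close>, where test functions extended from the
  half-line can be made to vanish. The first moments give tightness, and restricting the limit law
  to the half-line forgets the parked mass again.\<close>

lemma Helly_densities:
  fixes f :: "nat \<Rightarrow> real \<Rightarrow> real"
  assumes meas[measurable]: "\<And>n. f n \<in> borel_measurable borel" and nn: "\<And>n x. 0 \<le> f n x" and C: "0 < C"
    and fin: "\<And>n. finite_measure (density_measure (f n))"
    and mass: "\<And>n. measure (density_measure (f n)) {0..} \<le> C"
    and int1: "\<And>n. integrable (density_measure (f n)) (\<lambda>x. x)"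
    and mom: "\<And>n. (\<integral>x. x \<partial>density_measure (f n)) \<le> C"
  obtains r M where "strict_mono (r :: nat \<Rightarrow> nat)" "M \<in> M_f {0..}" "measure M {0..} \<le> C"
    "wstar_tendsto (\<lambda>n. density_measure (f (r n))) M sequentially"
proof -
  define p where "p n = measure (density_measure (f n)) {0..} / C" for n
  define w where "w n x = indicator {0..} x * f n x / C + (1 - p n) * indicator {-2..-1} x" for n x
  define P where "P n = density lborel (\<lambda>x. ennreal (w n x))" for n
  have p: "0 \<le> p n" "p n \<le> 1" for n using mass[of n] C by (auto simp: p_def)
  have wnn: "0 \<le> w n x" for n x using p[of n] nn[of n x] C by (simp add: w_def)
  have i0: "integrable lborel (\<lambda>x. indicator {0..} x * f n x)" for n
  proof -
    interpret finite_measure "density_measure (f n)" by (rule fin)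
    have "integrable (density_measure (f n)) (\<lambda>x. 1 :: real)" by simp
    then show ?thesis by (subst (asm) integrable_density_measure) (auto simp: nn)
  qed
  have v0: "(\<integral>x. indicator {0..} x * f n x \<partial>lborel) = C * p n" for n
  proof -
    interpret finite_measure "density_measure (f n)" by (rule fin)
    have "(\<integral>x. 1 \<partial>density_measure (f n)) = measure (density_measure (f n)) {0..}"
      by (simp add: space_density_measure)
    then show ?thesis using C by (subst (asm) integral_density_measure) (auto simp: nn p_def)
  qed
  have i1: "integrable lborel (\<lambda>x. indicator {0..} x * (f n x * x))" for n
    using int1[of n] by (subst (asm) integrable_density_measure) (auto simp: nn)
  have v1: "(\<integral>x. indicator {0..} x * (f n x * x) \<partial>lborel) \<le> C" for n
    using mom[of n] by (subst (asm) integral_density_measure) (auto simp: nn)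
  have iI: "integrable lborel (\<lambda>x. indicat_real {-2..-1::real} x)" 
    by (intro integrable_real_indicator) auto
  have iw: "integrable lborel (w n)" for n
    unfolding w_def using i0[of n] iI by auto
  have wm[measurable]: "w n \<in> borel_measurable borel" for n
    unfolding w_def by measurable
  have vw: "(\<integral>x. w n x \<partial>lborel) = 1" for n
    unfolding w_def using i0[of n] iI v0[of n] C by simp
  have P: "real_distribution (P n)" for n
    unfolding P_def by (rule real_distribution_density[OF iw wnn vw])
  have intP: "(\<integral>x. g x \<partial>P n) = (\<integral>x. w n x * g x \<partial>lborel)" if "g \<in> borel_measurable borel" for g :: "real \<Rightarrow> real" and n
    unfolding P_def using that wnn by (subst integral_density) auto
  have "tight P"
    unfolding tight_def
  proof (intro conjI allI impI P)
    fix e :: real assume e: "0 < e"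
    define b where "b = 2 / e"
    have b: "0 < b" using e by (simp add: b_def)
    have "1 - e < measure (P n) {-3<..b}" for n
    proof -
      interpret real_distribution "P n" by (rule P)
      have "1 - 1 / b \<le> (\<integral>x. w n x - indicator {0..} x * (f n x * x) / (b * C) \<partial>lborel)"
        using iw[of n] i1[of n] v1[of n] b C vw[of n] by (simp add: field_simps)
      also have "\<dots> \<le> (\<integral>x. w n x * indicat_real {-3<..b} x \<partial>lborel)"
      proof (rule integral_mono)
        show "integrable lborel (\<lambda>x. w n x - indicator {0..} x * (f n x * x) / (b * C))"
          using iw[of n] i1[of n] by auto
        show "integrable lborel (\<lambda>x. w n x * indicat_real {-3<..b} x)"
          using integrable_mult_indicator[OF _ iw[of n], of "{-3<..b}"] by (simp add: mult.commute)
        fix x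
        have "f n x / C \<le> f n x * x / (b * C)" if "b < x"
        proof -
          have "f n x * b \<le> f n x * x" using that nn[of n x] by (intro mult_left_mono) auto
          then show ?thesis using b C by (simp add: field_simps)
        qed
        then show "w n x - indicator {0..} x * (f n x * x) / (b * C) \<le> w n x * indicat_real {-3<..b} x"
          using b C nn[of n x] by (auto simp: w_def indicator_def)
      qed
      also have "\<dots> = measure (P n) {-3<..b}"
        by (subst intP[symmetric]) auto
      finally show ?thesis using e by (simp add: b_def)
    qed
    then show "\<exists>a b. a < b \<and> (\<forall>n. 1 - e < measure (P n) {a<..b})"
      using b by (intro exI[of _ "-3"] exI[of _ b]) auto
  qed
  then obtain r Q where r: "strict_mono r" and Q: "real_distribution Q" and wc: "weak_conv_m (P \<circ> id \<circ> r) Q"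
    using tight_imp_convergent_subsubsequence[of P id] by (auto simp: strict_mono_def)
  interpret Q: real_distribution Q by (rule Q)
  have conv: "(\<lambda>n. \<integral>x. g x \<partial>P (r n)) \<longlonglongrightarrow> (\<integral>x. g x \<partial>Q)"
    if "continuous_on UNIV g" "\<And>x. \<bar>g x\<bar> \<le> B" for g :: "real \<Rightarrow> real" and B
  proof -
    have "(\<lambda>n. \<integral>x. g x \<partial>(P \<circ> id \<circ> r) n) \<longlonglongrightarrow> (\<integral>x. g x \<partial>Q)"
      by (rule weak_conv_imp_integral_bdd_continuous_conv[OF _ Q wc, where B=B])
         (use that P in \<open>auto simp: continuous_on_eq_continuous_at\<close>)
    then show ?thesis by simp
  qed
  define M where "M = density (restrict_space Q {0..}) (\<lambda>_. ennreal C)"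
  have setsM: "sets M = sets (restrict_space borel {0..})"
    unfolding M_def by (simp add: sets_restrict_space_cong[OF Q.events_eq_borel])
  have em: "emeasure M {0..} = ennreal C * emeasure Q {0..}"
    unfolding M_def by (subst emeasure_density) (auto simp: nn_integral_restrict_space sets_restrict_space ac_simps nn_integral_cmult_indicator mult.assoc[symmetric] indicator_inter_arith[symmetric])
  have em': "emeasure M {0..} \<le> ennreal C"
    unfolding em using mult_left_mono[OF Q.emeasure_le_1, of "ennreal C" "{0..}"] by simp
  have sp: "space M = {0..}" using sets_eq_imp_space_eq[OF setsM] by simp
  have finM: "finite_measure M"
    by (rule finite_measureI) (use em' in \<open>auto simp: sp top_unique\<close>)
  have M: "M \<in> M_f {0..}" using setsM finM by (simp add: M_f_def)
  have mM: "measure M {0..} \<le> C"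
    using em' C by (simp add: measure_def enn2real_leI)
  \<comment> \<open>the limit law does not charge the gap between the parked mass and the half-line\<close>
  have gap: "AE x in Q. \<not> (-1 < x \<and> x < 0)"
  proof -
    define g where "g x = max 0 (min (x + 1) (- x))" for x :: real
    have gc: "continuous_on UNIV g" unfolding g_def by (intro continuous_intros)
    have gb: "\<bar>g x\<bar> \<le> 1" for x by (auto simp: g_def)
    have [measurable]: "g \<in> borel_measurable borel" using gc by (rule borel_measurable_continuous_onI)
    have "(\<integral>x. g x \<partial>P n) = 0" for n
    proof -
      have "w n x * g x = 0" for x by (auto simp: w_def g_def indicator_def)
      then have "(\<lambda>x. w n x * g x) = (\<lambda>x. 0)" by (rule ext)
      then show ?thesis using intP[of g n] by simp
    qed
    then have z: "(\<integral>x. g x \<partial>Q) = 0" using conv[OF gc gb] by (simp add: LIMSEQ_const_iff)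
    have "integrable Q g" by (rule Q.integrable_const_bound[where B=1]) (use gb in auto)
    then have "AE x in Q. g x = 0"
      using z by (subst (asm) integral_nonneg_eq_0_iff_AE) (auto simp: g_def)
    then show ?thesis by eventually_elim (auto simp: g_def split: if_splits)
  qed
  have "wstar_tendsto (\<lambda>n. density_measure (f (r n))) M sequentially"
    unfolding wstar_tendsto_def
  proof
    fix \<phi> assume \<phi>: "\<phi> \<in> C_c {0..}"
    obtain B where B: "0 < B" "\<And>x. 0 \<le> x \<Longrightarrow> \<bar>\<phi> x\<bar> \<le> B" using C_c_bounded[OF \<phi>] by blast
    define g where "g x = max 0 (min 1 (x + 1)) * \<phi> (max 0 x)" for x
    have gc: "continuous_on UNIV g" unfolding g_def
      by (intro continuous_intros continuous_on_compose_max C_c_continuous[OF \<phi>])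
    have gb: "\<bar>g x\<bar> \<le> B" for x
    proof -
      have "\<bar>g x\<bar> \<le> 1 * B" unfolding g_def abs_mult by (intro mult_mono B) auto
      then show ?thesis by simp
    qed
    have [measurable]: "g \<in> borel_measurable borel" using gc by (rule borel_measurable_continuous_onI)
    have g_eq: "indicator {0..} x * \<phi> x = indicator {0..} x * g x" for x by (auto simp: g_def indicator_def)
    have m\<phi>[measurable]: "(\<lambda>x. \<phi> (max 0 x)) \<in> borel_measurable borel"
      using continuous_on_compose_max[OF C_c_continuous[OF \<phi>]] by (rule borel_measurable_continuous_onI)
    have 1: "(\<integral>x. \<phi> x \<partial>density_measure (f n)) = C * (\<integral>x. g x \<partial>P n)" for n
    proof -
      have "(\<integral>x. \<phi> x \<partial>density_measure (f n)) = (\<integral>x. indicator {0..} x * (f n x * \<phi> (max 0 x)) \<partial>lborel)"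
        by (subst integral_density_measure_max) (rule integral_density_measure, auto simp: nn)
      also have "\<dots> = (\<integral>x. C * (w n x * g x) \<partial>lborel)"
        by (rule Bochner_Integration.integral_cong) (use C in \<open>auto simp: g_def w_def indicator_def\<close>)
      finally show ?thesis by (subst intP) auto
    qed
    have 2: "(\<integral>x. \<phi> x \<partial>M) = C * (\<integral>x. g x \<partial>Q)"
    proof -
      have "(\<integral>x. \<phi> x \<partial>M) = (\<integral>x. g x \<partial>M)"
        by (rule Bochner_Integration.integral_cong) (auto simp: sp g_def)
      also have "\<dots> = (\<integral>x. C * g x \<partial>restrict_space Q {0..})"
        unfolding M_def using C by (subst integral_density) (auto intro!: measurable_restrict_space1)
      also have "\<dots> = (\<integral>x. indicator {0..} x * (C * g x) \<partial>Q)"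
        by (subst integral_restrict_space) auto
      also have "\<dots> = (\<integral>x. C * g x \<partial>Q)"
        by (rule integral_cong_AE, measurable) (use gap in eventually_elim, auto simp: g_def indicator_def)
      finally show ?thesis by simp
    qed
    show "(\<lambda>n. \<integral>x. \<phi> x \<partial>density_measure (f (r n))) \<longlonglongrightarrow> (\<integral>x. \<phi> x \<partial>M)"
      unfolding 1 2 by (intro tendsto_mult_left conv[OF gc gb])
  qed
  then show ?thesis using that r M mM by blast
qed

text \<open>The functions need to be equicontinuous only for large indices: integrals against step densities
  are close to sums that are Lipschitz in time, up to an error that vanishes with the cell width.
  The points \<open>T j / N\<close> serve as a countable dense set of times.\<close>

lemma uniformly_convergent_asymp_equicontinuous:
  fixes F :: "nat \<Rightarrow> real \<Rightarrow> real"
  assumes T: "0 \<le> T"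
    and eq: "\<And>\<eta>. 0 < \<eta> \<Longrightarrow> \<exists>\<delta>>0. \<forall>\<^sub>F n in sequentially. \<forall>s\<in>{0..T}. \<forall>t\<in>{0..T}.
        \<bar>s - t\<bar> < \<delta> \<longrightarrow> \<bar>F n s - F n t\<bar> < \<eta>"
    and conv: "\<And>N j. j \<le> N \<Longrightarrow> convergent (\<lambda>n. F n (T * real j / real N))"
  shows "uniformly_convergent_on {0..T} F"
proof (rule Cauchy_uniformly_convergent)
  show "uniformly_Cauchy_on {0..T} F"
    unfolding uniformly_Cauchy_on_def
  proof (intro allI impI)
    fix e :: real assume "0 < e"
    then obtain \<delta> where \<delta>: "0 < \<delta>" and ev: "\<forall>\<^sub>F n in sequentially. \<forall>s\<in>{0..T}. \<forall>t\<in>{0..T}.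
        \<bar>s - t\<bar> < \<delta> \<longrightarrow> \<bar>F n s - F n t\<bar> < e / 3"
      using eq[of "e / 3"] by auto
    obtain N where N: "T / \<delta> < real N" "0 < N"
      using reals_Archimedean2[of "max 1 (T / \<delta>)"] T \<delta> by fastforce
    then have TN: "T / real N < \<delta>" using \<delta> by (simp add: field_simps)
    have "\<exists>M. \<forall>m\<ge>M. \<forall>n\<ge>M. dist (F m (T * real j / real N)) (F n (T * real j / real N)) < e / 3"
      if "j \<le> N" for j
      using conv[OF that] convergent_Cauchy metric_CauchyD[of _ "e / 3"] \<open>0 < e\<close> by fastforce
    then obtain M where M: "\<And>j m n. j \<le> N \<Longrightarrow> M j \<le> m \<Longrightarrow> M j \<le> n \<Longrightarrow>
        dist (F m (T * real j / real N)) (F n (T * real j / real N)) < e / 3"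
      by metis
    obtain M0 where M0: "\<And>n s t. M0 \<le> n \<Longrightarrow> s \<in> {0..T} \<Longrightarrow> t \<in> {0..T} \<Longrightarrow> \<bar>s - t\<bar> < \<delta> \<Longrightarrow> \<bar>F n s - F n t\<bar> < e / 3"
      using ev unfolding eventually_sequentially by blast
    define L where "L = max M0 (Max (M ` {..N}))"
    have LM: "M j \<le> L" if "j \<le> N" for j
      using that by (auto simp: L_def intro!: max.coboundedI2 Max_ge)
    show "\<exists>M. \<forall>x\<in>{0..T}. \<forall>m\<ge>M. \<forall>n\<ge>M. dist (F m x) (F n x) < e"
    proof (intro exI[of _ L] ballI allI impI)
      fix t m n assume t: "t \<in> {0..T}" and mn: "L \<le> m" "L \<le> n"
      define j where "j = nat \<lfloor>t * real N / T\<rfloor>"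
      define q where "q = T * real j / real N"
      have near: "j \<le> N \<and> q \<in> {0..T} \<and> \<bar>t - q\<bar> < \<delta>"
      proof (cases "T = 0")
        case True then show ?thesis using t \<delta> by (simp add: j_def q_def)
      next
        case False
        then have T: "0 < T" using T by simp
        have nn: "0 \<le> t * real N / T" using t T by simp
        then have j: "real j \<le> t * real N / T" "t * real N / T < real j + 1"
          unfolding j_def by linarith+
        have "t * real N \<le> T * real N" using t by (intro mult_right_mono) auto
        then have "t * real N / T \<le> real N" using T by (simp add: divide_le_eq mult.commute)
        then have "j \<le> N" using j(1) by linarith
        moreover have "q \<le> t" using j T N(2) by (auto simp: q_def field_simps)
        moreover have "t - q < T / real N"
        proof -
          have "t * real N < T * real j + T" using j(2) T by (simp add: field_simps)
          then have "t < (T * real j + T) / real N" using N(2) by (simp add: pos_less_divide_eq)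
          then show ?thesis by (simp add: q_def add_divide_distrib)
        qed
        moreover have "0 \<le> q" using T by (simp add: q_def)
        ultimately show ?thesis using t TN by auto
      qed
      have "\<bar>F m t - F m q\<bar> < e / 3" "\<bar>F n t - F n q\<bar> < e / 3"
        using near t mn M0[of m t q] M0[of n t q] by (auto simp: L_def)
      moreover have "dist (F m q) (F n q) < e / 3"
        unfolding q_def using near mn LM[of j] by (intro M) auto
      ultimately show "dist (F m t) (F n t) < e" unfolding dist_real_def by linarith
    qed
  qed
qed

text \<open>A diagonal argument selects a subsequence that converges at countably many times, and
  equicontinuity turns this into uniform convergence of \<open>t \<mapsto> \<integral> \<phi>\<close> for every \<open>\<phi>\<close>. That the limiting
  functional at an arbitrary time is given by a measure follows by applying Helly's theorem once more
  at that time: a further subsequence has a limit measure, and the limit of the functionals is already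
  known.\<close>

lemma compactness_of_densities:
  fixes f :: "nat \<Rightarrow> real \<Rightarrow> real \<Rightarrow> real"
  assumes T: "0 \<le> T" and C: "0 < C"
    and meas: "\<And>n t. 0 \<le> t \<Longrightarrow> t \<le> T \<Longrightarrow> f n t \<in> borel_measurable borel"
    and nn: "\<And>n t x. 0 \<le> t \<Longrightarrow> t \<le> T \<Longrightarrow> 0 \<le> f n t x"
    and fin: "\<And>n t. 0 \<le> t \<Longrightarrow> t \<le> T \<Longrightarrow> finite_measure (density_measure (f n t))"
    and mass: "\<And>n t. 0 \<le> t \<Longrightarrow> t \<le> T \<Longrightarrow> measure (density_measure (f n t)) {0..} \<le> C"
    and int1: "\<And>n t. 0 \<le> t \<Longrightarrow> t \<le> T \<Longrightarrow> integrable (density_measure (f n t)) (\<lambda>x. x)"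
    and mom: "\<And>n t. 0 \<le> t \<Longrightarrow> t \<le> T \<Longrightarrow> (\<integral>x. x \<partial>density_measure (f n t)) \<le> C"
    and cont: "\<And>n \<phi>. \<phi> \<in> C_c {0..} \<Longrightarrow> continuous_on {0..T} (\<lambda>t. \<integral>x. \<phi> x \<partial>density_measure (f n t))"
    and equicont: "\<And>\<phi> \<eta>. \<phi> \<in> C_c {0..} \<Longrightarrow> 0 < \<eta> \<Longrightarrow>
        \<exists>\<delta>>0. \<forall>\<^sub>F n in sequentially. \<forall>s\<in>{0..T}. \<forall>t\<in>{0..T}. \<bar>s - t\<bar> < \<delta> \<longrightarrow>
          \<bar>(\<integral>x. \<phi> x \<partial>density_measure (f n s)) - (\<integral>x. \<phi> x \<partial>density_measure (f n t))\<bar> < \<eta>"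
  shows "\<exists>r \<mu>. strict_mono (r :: nat \<Rightarrow> nat) \<and> (\<forall>t\<in>{0..T}. measure (\<mu> t) {0..} \<le> C) \<and>
    C_wstar_tendsto T (\<lambda>n t. density_measure (f (r n) t)) \<mu>"
proof -
  define q where "q k = (let (N, j) = prod_decode k in if j \<le> N then T * real j / real N else 0)" for k
  have q: "0 \<le> q k" "q k \<le> T" for k
  proof -
    obtain N j where Nj: "prod_decode k = (N, j)" by force
    have "real j / real N \<le> 1" if "j \<le> N" using that by (simp add: divide_le_eq)
    then have "j \<le> N \<Longrightarrow> T * (real j / real N) \<le> T * 1" using T by (intro mult_left_mono) auto
    then show "0 \<le> q k" "q k \<le> T" using T by (auto simp: q_def Nj)
  qed
  define Q where "Q k s \<longleftrightarrow> (\<forall>\<phi>\<in>C_c {0..}. convergent (\<lambda>n. \<integral>x. \<phi> x \<partial>density_measure (f (s n) (q k))))"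
    for k and s :: "nat \<Rightarrow> nat"
  interpret subseqs Q
  proof
    fix k and s :: "nat \<Rightarrow> nat"
    obtain r M where "strict_mono (r :: nat \<Rightarrow> nat)"
      "wstar_tendsto (\<lambda>n. density_measure (f (s (r n)) (q k))) M sequentially"
      using Helly_densities[of "\<lambda>n. f (s n) (q k)" C] meas nn C fin mass int1 mom q by metis
    then show "\<exists>r. strict_mono r \<and> Q k (s \<circ> r)"
      by (auto simp: Q_def wstar_tendsto_def convergent_def)
  qed
  define r where "r = diagseq"
  have r: "strict_mono r" unfolding r_def by (rule subseq_diagseq)
  have Qr: "convergent (\<lambda>n. \<integral>x. \<phi> x \<partial>density_measure (f (r n) (q k)))" if \<phi>: "\<phi> \<in> C_c {0..}" for \<phi> k
  proof -
    have "Q k (diagseq \<circ> (+) (Suc k))"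
    proof (rule diagseq_holds)
      fix r s :: "nat \<Rightarrow> nat" and n assume "strict_mono r" "Q n s"
      then show "Q n (s \<circ> r)"
        unfolding Q_def using convergent_subseq_convergent by (fastforce simp: o_def)
    qed
    then have "convergent (\<lambda>n. \<integral>x. \<phi> x \<partial>density_measure (f (r (n + Suc k)) (q k)))"
      using \<phi> by (auto simp: Q_def r_def add.commute)
    then show ?thesis
      using convergent_ignore_initial_segment[of "\<lambda>n. \<integral>x. \<phi> x \<partial>density_measure (f (r n) (q k))" "Suc k"] by simp
  qed
  have uc: "uniformly_convergent_on {0..T} (\<lambda>n t. \<integral>x. \<phi> x \<partial>density_measure (f (r n) t))" if \<phi>: "\<phi> \<in> C_c {0..}" for \<phi>
  proof (rule uniformly_convergent_asymp_equicontinuous[OF T])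
    fix \<eta> :: real assume "0 < \<eta>"
    then obtain \<delta> where "0 < \<delta>" and ev: "\<forall>\<^sub>F n in sequentially. \<forall>s\<in>{0..T}. \<forall>t\<in>{0..T}. \<bar>s - t\<bar> < \<delta> \<longrightarrow>
          \<bar>(\<integral>x. \<phi> x \<partial>density_measure (f n s)) - (\<integral>x. \<phi> x \<partial>density_measure (f n t))\<bar> < \<eta>"
      using equicont[OF \<phi>] by blast
    show "\<exists>\<delta>>0. \<forall>\<^sub>F n in sequentially. \<forall>s\<in>{0..T}. \<forall>t\<in>{0..T}. \<bar>s - t\<bar> < \<delta> \<longrightarrow>
          \<bar>(\<integral>x. \<phi> x \<partial>density_measure (f (r n) s)) - (\<integral>x. \<phi> x \<partial>density_measure (f (r n) t))\<bar> < \<eta>"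
      using \<open>0 < \<delta>\<close> eventually_subseq[OF r ev] by blast
  next
    fix N j :: nat assume "j \<le> N"
    then have "q (prod_encode (N, j)) = T * real j / real N" by (simp add: q_def)
    then show "convergent (\<lambda>n. \<integral>x. \<phi> x \<partial>density_measure (f (r n) (T * real j / real N)))"
      using Qr[OF \<phi>, of "prod_encode (N, j)"] by simp
  qed
  have "\<exists>M. M \<in> M_f {0..} \<and> measure M {0..} \<le> C \<and>
      (\<forall>\<phi>\<in>C_c {0..}. (\<lambda>n. \<integral>x. \<phi> x \<partial>density_measure (f (r n) t)) \<longlonglongrightarrow> (\<integral>x. \<phi> x \<partial>M))" if t: "t \<in> {0..T}" for t
  proof -
    obtain s M where s: "strict_mono (s :: nat \<Rightarrow> nat)" and M: "M \<in> M_f {0..}" "measure M {0..} \<le> C"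
      "wstar_tendsto (\<lambda>n. density_measure (f (r (s n)) t)) M sequentially"
      using Helly_densities[of "\<lambda>n. f (r n) t" C] meas nn C fin mass int1 mom t by (metis atLeastAtMost_iff)
    have "(\<lambda>n. \<integral>x. \<phi> x \<partial>density_measure (f (r n) t)) \<longlonglongrightarrow> (\<integral>x. \<phi> x \<partial>M)" if \<phi>: "\<phi> \<in> C_c {0..}" for \<phi>
    proof -
      have "convergent (\<lambda>n. \<integral>x. \<phi> x \<partial>density_measure (f (r n) t))"
        using uniformly_convergent_imp_convergent[OF uc[OF \<phi>] t] .
      then obtain l where l: "(\<lambda>n. \<integral>x. \<phi> x \<partial>density_measure (f (r n) t)) \<longlonglongrightarrow> l" by (auto simp: convergent_def)
      have "(\<lambda>n. \<integral>x. \<phi> x \<partial>density_measure (f (r (s n)) t)) \<longlonglongrightarrow> l"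
        using LIMSEQ_subseq_LIMSEQ[OF l s] by (simp add: o_def)
      then show ?thesis using l M(3) \<phi> LIMSEQ_unique unfolding wstar_tendsto_def by blast
    qed
    then show ?thesis using M by blast
  qed
  then obtain \<mu> where \<mu>: "\<And>t. t \<in> {0..T} \<Longrightarrow> \<mu> t \<in> M_f {0..}" "\<And>t. t \<in> {0..T} \<Longrightarrow> measure (\<mu> t) {0..} \<le> C"
      "\<And>t \<phi>. t \<in> {0..T} \<Longrightarrow> \<phi> \<in> C_c {0..} \<Longrightarrow>
        (\<lambda>n. \<integral>x. \<phi> x \<partial>density_measure (f (r n) t)) \<longlonglongrightarrow> (\<integral>x. \<phi> x \<partial>\<mu> t)"
    by metis
  have ul: "uniform_limit {0..T} (\<lambda>n t. \<integral>x. \<phi> x \<partial>density_measure (f (r n) t)) (\<lambda>t. \<integral>x. \<phi> x \<partial>\<mu> t) sequentially"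
    if \<phi>: "\<phi> \<in> C_c {0..}" for \<phi>
  proof -
    obtain l where l: "uniform_limit {0..T} (\<lambda>n t. \<integral>x. \<phi> x \<partial>density_measure (f (r n) t)) l sequentially"
      using uc[OF \<phi>] by (auto simp: uniformly_convergent_on_def)
    have lt: "l t = (\<integral>x. \<phi> x \<partial>\<mu> t)" if "t \<in> {0..T}" for t
      using tendsto_uniform_limitI[OF l that] \<mu>(3)[OF that \<phi>] LIMSEQ_unique by blast
    show ?thesis using l unfolding uniform_limit_iff by (simp add: lt)
  qed
  have cw: "\<mu> \<in> C_wstar T"
    unfolding C_wstar_def using \<mu>(1) uniform_limit_theorem[OF _ ul] cont by (auto intro!: always_eventually)
  moreover have "(\<lambda>t. density_measure (f (r n) t)) \<in> C_wstar T" for n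
    unfolding C_wstar_def M_f_def using cont fin sets_density_measure by auto
  ultimately have "C_wstar_tendsto T (\<lambda>n t. density_measure (f (r n) t)) \<mu>"
    unfolding C_wstar_tendsto_def using ul by blast
  then show ?thesis using r \<mu>(2) by blast
qed

section \<open>Dini's theorem and differential inequalities\<close>

theorem Dini_uniform_limit:
  fixes f :: "nat \<Rightarrow> 'a::metric_space \<Rightarrow> real"
  assumes S: "compact S" and f: "\<And>n. continuous_on S (f n)" and l: "continuous_on S l"
    and mono: "\<And>x n. x \<in> S \<Longrightarrow> f n x \<le> f (Suc n) x"
    and lim: "\<And>x. x \<in> S \<Longrightarrow> (\<lambda>n. f n x) \<longlonglongrightarrow> l x"
  shows "uniform_limit S f l sequentially"
proof (rule uniform_limitI)
  fix e :: real assume e: "0 < e"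
  have monoN: "f m x \<le> f n x" if "x \<in> S" "m \<le> n" for x m n
    using lift_Suc_mono_le[of "\<lambda>n. f n x" m n] mono that by auto
  have le: "f n x \<le> l x" if "x \<in> S" for x n
    by (rule LIMSEQ_le_const[OF lim[OF that]]) (use monoN[OF that] in auto)
  have "\<exists>N d. 0 < d \<and> (\<forall>y\<in>S. dist y x < d \<longrightarrow> l y - f N y < e)" if x: "x \<in> S" for x
  proof -
    obtain N where N: "l x - f N x < e / 2"
    proof -
      have "\<exists>N. \<forall>n\<ge>N. l x - e / 2 < f n x"
        using order_tendstoD(1)[OF lim[OF x], of "l x - e / 2"] e by (simp add: eventually_sequentially)
      then obtain N where "l x - e / 2 < f N x" by blast
      then show ?thesis using that[of N] by linarith
    qed
    have "continuous_on S (\<lambda>y. l y - f N y)" by (intro continuous_intros f l)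
    then obtain d where "0 < d" "\<forall>y\<in>S. dist y x < d \<longrightarrow> dist (l y - f N y) (l x - f N x) < e / 2"
      using x e unfolding continuous_on_iff by (meson half_gt_zero)
    moreover have "l y - f N y < e" if "dist (l y - f N y) (l x - f N x) < e / 2" for y
      using N that unfolding dist_real_def by linarith
    ultimately show ?thesis by blast
  qed
  then obtain N d where Nd: "\<And>x. x \<in> S \<Longrightarrow> 0 < d x"
      "\<And>x y. x \<in> S \<Longrightarrow> y \<in> S \<Longrightarrow> dist y x < d x \<Longrightarrow> l y - f (N x) y < e" by metis
  have "S \<subseteq> (\<Union>x\<in>S. ball x (d x))" using Nd(1) by auto
  then obtain C where C: "C \<subseteq> S" "finite C" "S \<subseteq> (\<Union>x\<in>C. ball x (d x))"
    using compactE_image[OF S, of S "\<lambda>x. ball x (d x)"] open_ball by metis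
  show "\<forall>\<^sub>F n in sequentially. \<forall>x\<in>S. dist (f n x) (l x) < e"
    unfolding eventually_sequentially
  proof (intro exI[of _ "Max (insert 0 (N ` C))"] allI impI ballI)
    fix n y assume n: "Max (insert 0 (N ` C)) \<le> n" and y: "y \<in> S"
    obtain x where x: "x \<in> C" "dist y x < d x" using C(3) y by (auto simp: dist_commute)
    have "N x \<le> n" using n C(2) x(1) by simp
    then have "f (N x) y \<le> f n y" by (rule monoN[OF y])
    moreover have "l y - f (N x) y < e" using Nd(2) x C(1) y by blast
    ultimately have "l y - f n y < e" by linarith
    then show "dist (f n y) (l y) < e" using le[OF y, of n] by (simp add: dist_real_def)
  qed
qed

lemma increment_le:
  fixes f :: "real \<Rightarrow> real"
  assumes st: "s \<le> t" "{s..t} \<subseteq> S"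
    and d: "\<And>x. x \<in> S \<Longrightarrow> (f has_real_derivative f' x) (at x within S)" "\<And>x. x \<in> S \<Longrightarrow> f' x \<le> K"
  shows "f t - f s \<le> K * (t - s)"
proof -
  have "\<exists>x\<in>{s..t}. f t - f s = f' x * (t - s)"
  proof (intro mvt_very_simple st)
    fix x assume "s \<le> x" "x \<le> t"
    then have "x \<in> S" using st by auto
    then show "(f has_derivative (*) (f' x)) (at x within {s..t})"
      using d(1) st(2) has_derivative_subset unfolding has_field_derivative_def by blast
  qed
  then obtain x where x: "x \<in> {s..t}" "f t - f s = f' x * (t - s)" by blast
  have "f' x \<le> K" using x(1) st(2) d(2) by blast
  then show ?thesis unfolding x(2) using st(1) by (intro mult_right_mono) auto
qed

lemma increment_abs_le:
  fixes f :: "real \<Rightarrow> real"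
  assumes S: "convex S" "s \<in> S" "t \<in> S"
    and d: "\<And>x. x \<in> S \<Longrightarrow> (f has_real_derivative f' x) (at x within S)" "\<And>x. x \<in> S \<Longrightarrow> \<bar>f' x\<bar> \<le> K"
  shows "\<bar>f t - f s\<bar> \<le> K * \<bar>t - s\<bar>"
proof -
  have "norm (f t - f s) \<le> K * norm (t - s)"
    by (rule field_differentiable_bound[OF S(1) d(1)]) (use d(2) S in auto)
  then show ?thesis by simp
qed

text \<open>The bound does not grow in time, because \<open>C / k\<close> is the equilibrium of \<open>y' = C - k y\<close>.\<close>

lemma gronwall_damped:
  fixes y :: "real \<Rightarrow> real"
  assumes k: "0 < k" and t: "0 \<le> t" "t \<le> T" and C: "0 \<le> C" "0 \<le> y 0"
    and d: "\<And>s. s \<in> {0..T} \<Longrightarrow> (y has_real_derivative y' s) (at s within {0..T})"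
      "\<And>s. s \<in> {0..T} \<Longrightarrow> y' s \<le> C - k * y s"
  shows "y t \<le> y 0 + C / k"
proof -
  have "exp (k * t) * (y t - C / k) - exp (k * 0) * (y 0 - C / k) \<le> 0 * (t - 0)"
  proof (rule increment_le)
    fix s assume s: "s \<in> {0..T}"
    show "((\<lambda>t. exp (k * t) * (y t - C / k)) has_real_derivative
        k * exp (k * s) * (y s - C / k) + exp (k * s) * y' s) (at s within {0..T})"
      by (rule derivative_eq_intros d(1)[OF s] refl)+ (simp add: algebra_simps)
    have "k * (y s - C / k) = k * y s - C" using k by (simp add: right_diff_distrib)
    then have "k * (y s - C / k) + y' s \<le> 0" using d(2)[OF s] by linarith
    then have "exp (k * s) * (k * (y s - C / k) + y' s) \<le> 0" by (simp add: mult_nonneg_nonpos)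
    moreover have "k * exp (k * s) * (y s - C / k) + exp (k * s) * y' s = exp (k * s) * (k * (y s - C / k) + y' s)"
      by (simp only: distrib_left mult_ac)
    ultimately show "k * exp (k * s) * (y s - C / k) + exp (k * s) * y' s \<le> 0" by (simp only:)
  qed (use t in auto)
  then have 1: "exp (k * t) * (y t - C / k) \<le> y 0 - C / k" by simp
  show ?thesis
  proof (rule ccontr)
    assume "\<not> ?thesis"
    then have 2: "y 0 < y t - C / k" by simp
    then have "0 \<le> y t - C / k" using C by simp
    then have "1 * (y t - C / k) \<le> exp (k * t) * (y t - C / k)" using k t by (intro mult_right_mono) auto
    then have "y t - C / k \<le> y 0 - C / k" using 1 by simp
    moreover have "0 \<le> C / k" using C k by simp
    ultimately show False using 2 by linarith
  qed
qed

lemma gronwall_linear: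
  fixes y :: "real \<Rightarrow> real"
  assumes k: "0 \<le> k" and t: "0 \<le> t" "t \<le> T" and C: "0 \<le> C"
    and d: "\<And>s. s \<in> {0..T} \<Longrightarrow> (y has_real_derivative y' s) (at s within {0..T})"
      "\<And>s. s \<in> {0..T} \<Longrightarrow> y' s \<le> C + k * y s"
  shows "y t \<le> (y 0 + C * t) * exp (k * t)"
proof -
  have "exp (- (k * t)) * y t - exp (- (k * 0)) * y 0 \<le> C * (t - 0)"
  proof (rule increment_le)
    fix s assume s: "s \<in> {0..T}"
    show "((\<lambda>t. exp (- (k * t)) * y t) has_real_derivative
        exp (- (k * s)) * (y' s - k * y s)) (at s within {0..T})"
      by (rule derivative_eq_intros d(1)[OF s] refl)+ (simp add: algebra_simps)
    have "exp (- (k * s)) * (y' s - k * y s) \<le> exp (- (k * s)) * C"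
      using d(2)[OF s] by (intro mult_left_mono) auto
    also have "\<dots> \<le> 1 * C" using k s C by (intro mult_right_mono) auto
    finally show "exp (- (k * s)) * (y' s - k * y s) \<le> C" by simp
  qed (use t in auto)
  then have "exp (- (k * t)) * y t \<le> y 0 + C * t" by simp
  then have "exp (k * t) * (exp (- (k * t)) * y t) \<le> exp (k * t) * (y 0 + C * t)" by (intro mult_left_mono) auto
  moreover have "exp (k * t) * (exp (- (k * t)) * y t) = y t"
    by (simp only: mult.assoc[symmetric] exp_add[symmetric]) simp
  ultimately show ?thesis by (simp only: mult.commute)
qed

lemma summation_by_parts_flux:
  fixes w J :: "nat \<Rightarrow> real"
  shows "(\<Sum>k<Suc n. w (k + 2) * (J (k + 1) - J (k + 2))) =
    w 2 * J 1 + (\<Sum>k<n. (w (k + 3) - w (k + 2)) * J (k + 2)) - w (n + 2) * J (n + 2)"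
proof (induction n)
  case (Suc n)
  then show ?case by (simp add: algebra_simps numeral_eq_Suc)
qed (simp add: algebra_simps numeral_eq_Suc)

lemma weight_growth:
  fixes g :: "nat \<Rightarrow> real"
  assumes "\<And>i. 2 \<le> i \<Longrightarrow> \<bar>g (i + 1) - g i\<bar> \<le> L" "0 \<le> L" "2 \<le> i"
  shows "\<bar>g i\<bar> \<le> (\<bar>g 2\<bar> + L) * real i"
proof -
  have "\<bar>g i\<bar> \<le> \<bar>g 2\<bar> + L * real (i - 2)"
    using assms(3)
  proof (induction i rule: dec_induct)
    case (step n)
    have "real (Suc n - 2) = real (n - 2) + 1" using step by simp
    then have "L * real (Suc n - 2) = L * real (n - 2) + L" by (simp only: distrib_left mult.right_neutral)
    moreover have "\<bar>g (Suc n) - g n\<bar> \<le> L" using assms(1)[of n] step by simp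
    ultimately show ?case using step.IH by linarith
  qed simp
  also have "\<dots> \<le> \<bar>g 2\<bar> * real i + L * real i"
  proof (intro add_mono mult_left_mono)
    show "\<bar>g 2\<bar> \<le> \<bar>g 2\<bar> * real i" using assms(3) mult_left_mono[of 1 "real i" "\<bar>g 2\<bar>"] by simp
  qed (use assms in auto)
  finally show ?thesis by (simp add: algebra_simps)
qed

lemma exponential_increment: 
  assumes z: "0 < z"
  shows "\<bar>exp (- (real (i + 1) * z)) - exp (- (real i * z))\<bar> \<le> 1"
proof -
  have "0 < exp (- (real (i + 1) * z))" "exp (- (real (i + 1) * z)) \<le> 1"
      "0 < exp (- (real i * z))" "exp (- (real i * z)) \<le> 1" using z by auto
  then show ?thesis by linarith
qed

section \<open>Moments of a single system\<close>

text \<open>One system, for a fixed \<open>\<epsilon>\<close>; \<open>m\<close> is its conserved mass. Sums over the cluster sizes \<open>i \<ge> 2\<close> are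
  written as series in \<open>k = i - 2\<close>.\<close>

locale becker_doring =
  fixes \<eta> \<epsilon> \<alpha> \<beta> :: real and a b :: "nat \<Rightarrow> real" and u :: "real \<Rightarrow> real" and c :: "nat \<Rightarrow> real \<Rightarrow> real"
    and m Ka Kb :: real
  assumes eps: "0 < \<epsilon>" and \<alpha>: "0 < \<alpha>" and \<beta>: "0 < \<beta>"
    and a_pos: "\<And>i. 2 \<le> i \<Longrightarrow> 0 < a i" and b_pos: "\<And>i. 3 \<le> i \<Longrightarrow> 0 < b i"
    and sol: "BD_solution \<eta> \<epsilon> \<alpha> \<beta> a b u c"
    and mass: "\<And>t. 0 \<le> t \<Longrightarrow> ((\<lambda>i. \<epsilon>\<^sup>2 * real i * c i t) has_sum (m - u t)) {2..}"
    and Ka: "0 < Ka" and Kb: "0 < Kb"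
    and a_le: "\<And>i. 2 \<le> i \<Longrightarrow> a i \<le> Ka * (1 + \<epsilon> * real i)"
    and b_le: "\<And>i. 3 \<le> i \<Longrightarrow> b i \<le> Kb * (1 + \<epsilon> * real i)"
begin

definition J :: "nat \<Rightarrow> real \<Rightarrow> real" where
  "J i t = BD_flux \<eta> \<epsilon> \<alpha> \<beta> a b (u t) (\<lambda>i. c i t) i"

text \<open>The detachment of dimers belongs to the flux \<open>J 1\<close>. Setting its rate to 0 here lets the transport
  terms run over all sizes \<open>i \<ge> 2\<close>.\<close>

definition detach :: "nat \<Rightarrow> real" where
  "detach i = (if i < 3 then 0 else b i)"

text \<open>The factor \<open>\<epsilon>\<close> makes this the integral of the step density against the weight, up to the variation of
  the weight within a cell.\<close>

definition mom :: "(nat \<Rightarrow> real) \<Rightarrow> real \<Rightarrow> real" where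
  "mom g t = (\<Sum>k. \<epsilon> * g (k + 2) * c (k + 2) t)"

abbreviation mass_at :: "nat \<Rightarrow> real \<Rightarrow> real" where
  "mass_at k t \<equiv> \<epsilon> * (\<epsilon> * real (k + 2)) * c (k + 2) t"

abbreviation weighted_at :: "nat \<Rightarrow> real \<Rightarrow> real" where
  "weighted_at k t \<equiv> \<epsilon> * (1 + \<epsilon> * real (k + 2)) * c (k + 2) t"

abbreviation number :: "real \<Rightarrow> real" where
  "number \<equiv> mom (\<lambda>_. 1)"

lemma J_1: "J 1 t = \<alpha> * (u t)\<^sup>2 - \<epsilon> powr \<eta> * \<beta> * c 2 t"
  by (simp add: J_def BD_flux_def)

lemma J_Suc: "J (k + 2) t = a (k + 2) * u t * c (k + 2) t - b (k + 3) * c (k + 3) t"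
  by (simp add: J_def BD_flux_def numeral_eq_Suc)

lemma u_nonneg: "0 \<le> t \<Longrightarrow> 0 \<le> u t" and u_cont: "continuous_on {0..} u"
  and c_nonneg: "0 \<le> t \<Longrightarrow> 2 \<le> i \<Longrightarrow> 0 \<le> c i t" and c_cont: "2 \<le> i \<Longrightarrow> continuous_on {0..} (c i)"
  using sol by (auto simp: BD_solution_def)

lemma summable_J: "0 \<le> t \<Longrightarrow> summable (\<lambda>k. J (k + 2) t)"
proof -
  assume "0 \<le> t"
  then have "summable (\<lambda>i. J (i + 1) t)" using sol by (auto simp: BD_solution_def Let_def J_def)
  then show ?thesis using summable_iff_shift[of "\<lambda>i. J (i + 1) t" 1] by simp
qed

lemma u_deriv:
  assumes "0 \<le> t"
  shows "(u has_real_derivative - (2 * \<epsilon> * J 1 t) - \<epsilon> * (\<Sum>k. J (k + 2) t)) (at t within {0..})"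
proof -
  have s: "summable (\<lambda>i. J (i + 1) t)" and d: "(u has_real_derivative - \<epsilon> * J 1 t - \<epsilon> * (\<Sum>i. J (i + 1) t)) (at t within {0..})"
    using sol assms by (auto simp: BD_solution_def Let_def J_def)
  have "(\<Sum>i. J (i + 1) t) = J 1 t + (\<Sum>k. J (k + 2) t)"
    using suminf_split_head[OF s] by simp
  then have "- \<epsilon> * J 1 t - \<epsilon> * (\<Sum>i. J (i + 1) t) = - (2 * \<epsilon> * J 1 t) - \<epsilon> * (\<Sum>k. J (k + 2) t)"
    by (simp only:) (simp add: algebra_simps)
  then show ?thesis using d by (simp only:)
qed

lemma c_deriv:
  assumes "0 \<le> t"
  shows "(c (k + 2) has_real_derivative (1 / \<epsilon>) * (J (k + 1) t - J (k + 2) t)) (at t within {0..})"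
proof -
  have "\<forall>i\<ge>2. (c i has_real_derivative (1 / \<epsilon>) * (J (i - 1) t - J i t)) (at t within {0..})"
    using sol assms by (auto simp: BD_solution_def Let_def J_def)
  from this[rule_format, of "k + 2"] show ?thesis by simp
qed

lemma mass_sums: "0 \<le> t \<Longrightarrow> (\<lambda>k. mass_at k t) sums (m - u t)"
proof -
  assume t: "0 \<le> t"
  have "((\<lambda>i. \<epsilon>\<^sup>2 * real i * c i t) \<circ> (\<lambda>k. k + 2) has_sum (m - u t)) UNIV"
  proof (subst has_sum_reindex[symmetric])
    have "x \<in> range (\<lambda>k. k + 2)" if "2 \<le> x" for x :: nat
      by (rule image_eqI[of _ _ "x - 2"]) (use that in auto)
    then have "range (\<lambda>k. k + 2) = {2 :: nat..}" by auto
    then show "((\<lambda>i. \<epsilon>\<^sup>2 * real i * c i t) has_sum (m - u t)) (range (\<lambda>k. k + 2))"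
      using mass[OF t] by simp
  qed (auto simp: inj_on_def)
  then have "((\<lambda>i. \<epsilon>\<^sup>2 * real i * c i t) \<circ> (\<lambda>k. k + 2)) sums (m - u t)" by (rule has_sum_imp_sums)
  then show ?thesis by (simp add: o_def power2_eq_square mult.assoc)
qed

lemma mass_term_nonneg: "0 \<le> t \<Longrightarrow> 0 \<le> mass_at k t"
  using eps c_nonneg[of t "k + 2"] by simp

lemma u_le: "0 \<le> t \<Longrightarrow> u t \<le> m"
  using mass_sums[of t] mass_term_nonneg[of t] suminf_nonneg[of "\<lambda>k. mass_at k t"]
  by (auto simp: sums_iff)

lemma m_nonneg: "0 \<le> m"
  using u_le[of 0] u_nonneg[of 0] by simp

lemma mom_summable:
  assumes "0 \<le> t" "\<And>i. 2 \<le> i \<Longrightarrow> \<bar>g i\<bar> \<le> B * real i"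
  shows "summable (\<lambda>k. \<epsilon> * g (k + 2) * c (k + 2) t)"
proof (rule summable_comparison_test')
  show "summable (\<lambda>k. (B / \<epsilon>) * (mass_at k t))"
    using mass_sums[OF assms(1)] by (intro summable_mult) (auto simp: sums_iff)
  fix k :: nat assume "0 \<le> k"
  have "norm (\<epsilon> * g (k + 2) * c (k + 2) t) = (\<epsilon> * c (k + 2) t) * \<bar>g (k + 2)\<bar>"
    using eps c_nonneg[OF assms(1), of "k + 2"] by (simp add: abs_mult)
  also have "\<dots> \<le> (\<epsilon> * c (k + 2) t) * (B * real (k + 2))"
    using eps c_nonneg[OF assms(1), of "k + 2"] assms(2)[of "k + 2"] by (intro mult_left_mono) auto
  finally show "norm (\<epsilon> * g (k + 2) * c (k + 2) t) \<le> (B / \<epsilon>) * (mass_at k t)"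
    using eps by (simp add: mult_ac)
qed

lemma number_summable: "0 \<le> t \<Longrightarrow> summable (\<lambda>k. \<epsilon> * 1 * c (k + 2) t)"
  by (rule mom_summable[where B=1 and g="\<lambda>_. 1"]) auto

lemma number_nonneg: "0 \<le> t \<Longrightarrow> 0 \<le> number t"
  unfolding mom_def by (intro suminf_nonneg number_summable) (use eps c_nonneg in \<open>simp_all\<close>)

lemma eps_c2_le_number: "0 \<le> t \<Longrightarrow> \<epsilon> * c 2 t \<le> number t"
proof -
  assume t: "0 \<le> t"
  have "(\<Sum>k<1. \<epsilon> * 1 * c (k + 2) t) \<le> number t"
    unfolding mom_def by (intro sum_le_suminf number_summable t) (use eps c_nonneg t in \<open>simp_all\<close>)
  then show ?thesis by (simp add: numeral_2_eq_2)
qed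

lemma weighted_number_sums:
  assumes "0 \<le> t"
  shows "(\<lambda>k. weighted_at k t) sums (number t + (m - u t))"
proof -
  have eq: "\<epsilon> * (1 + x) * y = \<epsilon> * 1 * y + \<epsilon> * x * y" for x y by algebra
  show ?thesis
    unfolding eq mom_def by (intro sums_add summable_sums number_summable mass_sums assms)
qed

lemma J_abs_le:
  assumes t: "0 \<le> t"
  shows "\<epsilon> * \<bar>J (k + 2) t\<bar> \<le> Ka * m * (weighted_at k t) +
    Kb * (weighted_at (Suc k) t)"
proof -
  have c: "0 \<le> c (k + 2) t" "0 \<le> c (k + 3) t" using c_nonneg[OF t] by auto
  have "a (k + 2) * u t * c (k + 2) t \<le> (Ka * (1 + \<epsilon> * real (k + 2))) * m * c (k + 2) t"
    using a_le[of "k + 2"] a_pos[of "k + 2"] u_le[OF t] u_nonneg[OF t] c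
    by (intro mult_right_mono mult_mono) auto
  moreover have "b (k + 3) * c (k + 3) t \<le> (Kb * (1 + \<epsilon> * real (k + 3))) * c (k + 3) t"
    using b_le[of "k + 3"] c by (intro mult_right_mono) auto
  moreover have "0 \<le> a (k + 2) * u t * c (k + 2) t" "0 \<le> b (k + 3) * c (k + 3) t"
    using a_pos[of "k + 2"] b_pos[of "k + 3"] u_nonneg[OF t] c by auto
  ultimately have "\<bar>J (k + 2) t\<bar> \<le> (Ka * (1 + \<epsilon> * real (k + 2))) * m * c (k + 2) t + (Kb * (1 + \<epsilon> * real (k + 3))) * c (k + 3) t"
    unfolding J_Suc by linarith
  then have "\<epsilon> * \<bar>J (k + 2) t\<bar> \<le> \<epsilon> * ((Ka * (1 + \<epsilon> * real (k + 2))) * m * c (k + 2) t + (Kb * (1 + \<epsilon> * real (k + 3))) * c (k + 3) t)"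
    using eps by (intro mult_left_mono) auto
  also have "\<dots> = Ka * m * (weighted_at k t) + Kb * (\<epsilon> * (1 + \<epsilon> * real (k + 3)) * c (k + 3) t)"
    by (simp only: distrib_left mult_ac)
  finally show ?thesis by (simp add: numeral_eq_Suc)
qed

lemma summable_weighted: "0 \<le> t \<Longrightarrow> summable (\<lambda>k. weighted_at k t)"
  using weighted_number_sums by (rule sums_summable)

lemma summable_weighted_Suc: "0 \<le> t \<Longrightarrow> summable (\<lambda>k. weighted_at (Suc k) t)"
  using summable_weighted[of t] summable_iff_shift[of "\<lambda>k. weighted_at k t" 1] by simp

lemma weighted_nonneg: "0 \<le> t \<Longrightarrow> 0 \<le> weighted_at k t"
  using eps c_nonneg[of t "k + 2"] by simp

lemma suminf_weighted_le:
  assumes t: "0 \<le> t"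
  shows "(\<Sum>k. weighted_at k t) \<le> number t + m"
    and "(\<Sum>k. weighted_at (Suc k) t) \<le> number t + m"
proof -
  show 1: "(\<Sum>k. weighted_at k t) \<le> number t + m"
    using sums_unique[OF weighted_number_sums[OF t]] u_nonneg[OF t] by simp
  have "(\<Sum>k. weighted_at (Suc k) t)
      = (\<Sum>k. weighted_at k t) - weighted_at 0 t"
    by (rule suminf_split_head[OF summable_weighted[OF t]])
  also have "\<dots> \<le> number t + m" using 1 weighted_nonneg[OF t, of 0] by linarith
  finally show "(\<Sum>k. weighted_at (Suc k) t) \<le> number t + m" .
qed

lemma summable_abs_J: 
  assumes t: "0 \<le> t"
  shows "summable (\<lambda>k. \<bar>J (k + 2) t\<bar>)"
proof -
  have "summable (\<lambda>k. \<epsilon> * \<bar>J (k + 2) t\<bar>)"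
    by (rule summable_comparison_test'[OF summable_add[OF summable_mult[OF summable_weighted[OF t]]
          summable_mult[OF summable_weighted_Suc[OF t]]], where N=0])
       (use J_abs_le[OF t] eps in auto)
  then show ?thesis using eps by simp
qed

lemma suminf_abs_J_le:
  assumes t: "0 \<le> t"
  shows "\<epsilon> * (\<Sum>k. \<bar>J (k + 2) t\<bar>) \<le> (Ka * m + Kb) * (number t + m)"
proof -
  note s = summable_weighted[OF t] summable_weighted_Suc[OF t]
  have "\<epsilon> * (\<Sum>k. \<bar>J (k + 2) t\<bar>) = (\<Sum>k. \<epsilon> * \<bar>J (k + 2) t\<bar>)"
    by (rule suminf_mult[symmetric, OF summable_abs_J[OF t]])
  also have "\<dots> \<le> (\<Sum>k. Ka * m * (weighted_at k t) +
    Kb * (weighted_at (Suc k) t))"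
    by (intro suminf_le J_abs_le t summable_add summable_mult s summable_abs_J)
  also have "\<dots> = Ka * m * (\<Sum>k. weighted_at k t) +
      Kb * (\<Sum>k. weighted_at (Suc k) t)"
    by (simp only: suminf_add[symmetric] summable_mult suminf_mult s)
  also have "\<dots> \<le> Ka * m * (number t + m) + Kb * (number t + m)"
    using Ka Kb m_nonneg by (intro add_mono mult_left_mono suminf_weighted_le t) auto
  finally show ?thesis by (simp add: distrib_right)
qed

lemma summable_increment_J:
  assumes t: "0 \<le> t" and g: "\<And>i. 2 \<le> i \<Longrightarrow> \<bar>g (i + 1) - g i\<bar> \<le> L"
  shows "summable (\<lambda>k. (g (k + 3) - g (k + 2)) * J (k + 2) t)"
    and "\<epsilon> * \<bar>\<Sum>k. (g (k + 3) - g (k + 2)) * J (k + 2) t\<bar> \<le> L * ((Ka * m + Kb) * (number t + m))"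
proof -
  have L: "0 \<le> L" using g[of 2] by linarith
  have le: "norm ((g (k + 3) - g (k + 2)) * J (k + 2) t) \<le> L * \<bar>J (k + 2) t\<bar>" for k
  proof -
    have "\<bar>g (k + 3) - g (k + 2)\<bar> \<le> L" using g[of "k + 2"] by (simp add: numeral_eq_Suc)
    then show ?thesis by (simp add: abs_mult mult_right_mono)
  qed
  show "summable (\<lambda>k. (g (k + 3) - g (k + 2)) * J (k + 2) t)"
    by (rule summable_comparison_test'[OF summable_mult[OF summable_abs_J[OF t]], where N=0]) (rule le)
  have "\<bar>\<Sum>k. (g (k + 3) - g (k + 2)) * J (k + 2) t\<bar> \<le> (\<Sum>k. L * \<bar>J (k + 2) t\<bar>)"
    using norm_suminf_le[OF le summable_mult[OF summable_abs_J[OF t]]] by simp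
  also have "\<dots> = L * (\<Sum>k. \<bar>J (k + 2) t\<bar>)"
    by (rule suminf_mult[OF summable_abs_J[OF t]])
  finally have "\<epsilon> * \<bar>\<Sum>k. (g (k + 3) - g (k + 2)) * J (k + 2) t\<bar> \<le> \<epsilon> * (L * (\<Sum>k. \<bar>J (k + 2) t\<bar>))"
    using eps by (intro mult_left_mono) auto
  also have "\<dots> = L * (\<epsilon> * (\<Sum>k. \<bar>J (k + 2) t\<bar>))" by simp
  also have "\<dots> \<le> L * ((Ka * m + Kb) * (number t + m))"
    by (rule mult_left_mono[OF suminf_abs_J_le[OF t] L])
  finally show "\<epsilon> * \<bar>\<Sum>k. (g (k + 3) - g (k + 2)) * J (k + 2) t\<bar> \<le> L * ((Ka * m + Kb) * (number t + m))" .
qed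

definition mass_tail :: "nat \<Rightarrow> real \<Rightarrow> real" where
  "mass_tail n t = (m - u t) - (\<Sum>k<n. mass_at k t)"

lemma mass_tail_sums:
  "0 \<le> t \<Longrightarrow> (\<lambda>k. mass_at (k + n) t) sums mass_tail n t"
  unfolding mass_tail_def using mass_sums[of t]
  by (rule sums_split_initial_segment[where f = "\<lambda>k. mass_at k t"])

text \<open>The mass is a continuous function of time and a series of nonnegative continuous terms, so Dini's
  theorem applies. All uniformity in time of the series below comes from here.\<close>

lemma mass_tail_uniform: "uniform_limit {0..T} mass_tail (\<lambda>_. 0) sequentially"
proof -
  have sub: "{0..T} \<subseteq> {0..}" by auto
  have "uniform_limit {0..T} (\<lambda>n t. \<Sum>k<n. mass_at k t) (\<lambda>t. m - u t) sequentially"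
  proof (rule Dini_uniform_limit)
    show "continuous_on {0..T} (\<lambda>t. \<Sum>k<n. mass_at k t)" for n
      by (intro continuous_intros continuous_on_subset[OF c_cont sub]) simp
    show "continuous_on {0..T} (\<lambda>t. m - u t)"
      by (intro continuous_intros continuous_on_subset[OF u_cont sub])
    fix x :: real and n assume "x \<in> {0..T}"
    then show "(\<Sum>k<n. mass_at k x) \<le> (\<Sum>k<Suc n. mass_at k x)"
      using mass_term_nonneg[of x n] by simp
  next
    fix x assume "x \<in> {0..T}"
    then show "(\<lambda>n. \<Sum>k<n. mass_at k x) \<longlonglongrightarrow> m - u x"
      using mass_sums[of x] by (simp add: sums_def)
  qed simp
  then show ?thesis unfolding uniform_limit_iff mass_tail_def by (simp add: dist_real_def abs_minus_commute)
qed

lemma J_tail_le: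
  assumes t: "0 \<le> t"
  shows "(\<Sum>k. \<bar>J (k + n + 2) t\<bar>) \<le> (Ka * m + Kb) * (1 / (2 * \<epsilon>) + 1) / \<epsilon> * mass_tail n t"
proof -
  define e where "e k = mass_at k t" for k
  define D where "D = (1 / (2 * \<epsilon>) + 1) / \<epsilon>"
  have D: "0 \<le> D" using eps by (simp add: D_def)
  have e: "0 \<le> e k" for k unfolding e_def by (rule mass_term_nonneg[OF t])
  have we: "weighted_at k t \<le> (\<epsilon> * D) * e k" for k
  proof -
    have "1 \<le> (1 / (2 * \<epsilon>)) * (\<epsilon> * real (k + 2))" using eps by (simp add: field_simps)
    then have "1 + \<epsilon> * real (k + 2) \<le> (1 / (2 * \<epsilon>) + 1) * (\<epsilon> * real (k + 2))" by (simp add: distrib_right)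
    then have "weighted_at k t \<le> \<epsilon> * ((1 / (2 * \<epsilon>) + 1) * (\<epsilon> * real (k + 2))) * c (k + 2) t"
      using eps c_nonneg[OF t, of "k + 2"] by (intro mult_right_mono mult_left_mono) auto
    also have "\<dots> = (\<epsilon> * D) * e k" using eps by (simp add: D_def e_def)
    finally show ?thesis .
  qed
  have Jb: "\<bar>J (k + 2) t\<bar> \<le> Ka * m * D * e k + Kb * D * e (Suc k)" for k
  proof -
    have "\<epsilon> * \<bar>J (k + 2) t\<bar> \<le> Ka * m * ((\<epsilon> * D) * e k) + Kb * ((\<epsilon> * D) * e (Suc k))"
      by (rule order_trans[OF J_abs_le[OF t]])
         (intro add_mono mult_left_mono we, use Ka Kb m_nonneg in auto)
    also have "\<dots> = \<epsilon> * (Ka * m * D * e k + Kb * D * e (Suc k))" by (simp only: distrib_left mult_ac)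
    finally show ?thesis using eps by simp
  qed
  have es: "(\<lambda>k. e (k + n)) sums mass_tail n t" using mass_tail_sums[OF t, of n] by (simp add: e_def)
  have es1: "summable (\<lambda>k. e (Suc (k + n)))" using sums_summable[OF es] summable_Suc_iff[of "\<lambda>k. e (k + n)"] by simp
  have es2: "(\<Sum>k. e (Suc (k + n))) \<le> mass_tail n t"
    using suminf_split_head[OF sums_summable[OF es]] sums_unique[OF es] e[of n] by simp
  have sJ: "summable (\<lambda>k. \<bar>J (k + n + 2) t\<bar>)"
    using summable_abs_J[OF t] summable_iff_shift[of "\<lambda>k. \<bar>J (k + 2) t\<bar>" n] by simp
  have "(\<Sum>k. \<bar>J (k + n + 2) t\<bar>) \<le> (\<Sum>k. Ka * m * D * e (k + n) + Kb * D * e (Suc (k + n)))"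
    by (intro suminf_le sJ Jb summable_add summable_mult sums_summable[OF es] es1)
  also have "\<dots> = Ka * m * D * (\<Sum>k. e (k + n)) + Kb * D * (\<Sum>k. e (Suc (k + n)))"
    by (simp only: suminf_add[symmetric] summable_mult suminf_mult es1 sums_summable[OF es])
  also have "\<dots> \<le> Ka * m * D * mass_tail n t + Kb * D * mass_tail n t"
    using sums_unique[OF es] es2 Ka Kb m_nonneg D by (intro add_mono mult_left_mono) auto
  also have "\<dots> = (Ka * m + Kb) * (1 / (2 * \<epsilon>) + 1) / \<epsilon> * mass_tail n t" by (simp add: D_def algebra_simps add_divide_distrib)
  finally show ?thesis .
qed

text \<open>Partial sums of a moment leave the boundary term \<open>g n * J n\<close>, which need not vanish for a weight of
  linear growth. If the weight is instead continued linearly beyond \<open>n\<close>, the remainder of the moment is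
  a multiple of the tail of the mass, whose derivative is known from the equation for \<open>u\<close>. The derivatives
  then differ from the claimed one by a tail of the flux series, uniformly small in time.\<close>

lemma mom_deriv:
  assumes T: "0 \<le> T" and t: "t \<in> {0..T}" and g: "\<And>i. 2 \<le> i \<Longrightarrow> \<bar>g (i + 1) - g i\<bar> \<le> L"
  shows "(mom g has_real_derivative g 2 * J 1 t + (\<Sum>k. (g (k + 3) - g (k + 2)) * J (k + 2) t)) (at t within {0..T})"
proof -
  have L: "0 \<le> L" using g[of 2] by linarith
  define B where "B = \<bar>g 2\<bar> + L"
  have gB: "\<bar>g i\<bar> \<le> B * real i" if "2 \<le> i" for i
    unfolding B_def by (rule weight_growth) (use g L that in auto)
  \<comment> \<open>beyond the index \<open>n\<close> the weight is continued linearly, so that the mass balance supplies the remainder\<close>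
  define \<gamma> where "\<gamma> n = g (n + 2) / real (n + 2)" for n
  have \<gamma>: "\<bar>\<gamma> n\<bar> \<le> B" for n
    using gB[of "n + 2"] by (simp add: \<gamma>_def divide_le_eq)
  define F where "F n t = (\<Sum>k<Suc n. \<epsilon> * g (k + 2) * c (k + 2) t) + \<gamma> n * (mass_tail (Suc n) t / \<epsilon>)" for n t
  define F' where "F' n t = g 2 * J 1 t + (\<Sum>k<n. (g (k + 3) - g (k + 2)) * J (k + 2) t) +
      \<gamma> n * ((\<Sum>k. J (k + 2) t) - (\<Sum>k<n. J (k + 2) t))" for n t
  define G where "G t = g 2 * J 1 t + (\<Sum>k. (g (k + 3) - g (k + 2)) * J (k + 2) t)" for t
  have sub: "{0..T} \<subseteq> {0..}" by auto
  have dc: "(c (k + 2) has_real_derivative (1 / \<epsilon>) * (J (k + 1) s - J (k + 2) s)) (at s within {0..T})"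
    if "s \<in> {0..T}" for k s
    by (rule DERIV_subset[OF c_deriv sub]) (use that in simp)
  have du: "(u has_real_derivative - (2 * \<epsilon> * J 1 s) - \<epsilon> * (\<Sum>k. J (k + 2) s)) (at s within {0..T})"
    if "s \<in> {0..T}" for s
    by (rule DERIV_subset[OF u_deriv sub]) (use that in simp)
  have dsum: "((\<lambda>t. \<Sum>k<Suc n. \<epsilon> * w (k + 2) * c (k + 2) t) has_real_derivative
      w 2 * J 1 s + (\<Sum>k<n. (w (k + 3) - w (k + 2)) * J (k + 2) s) - w (n + 2) * J (n + 2) s) (at s within {0..T})"
    if s: "s \<in> {0..T}" for w :: "nat \<Rightarrow> real" and n s
  proof -
    have "((\<lambda>t. \<Sum>k<Suc n. \<epsilon> * w (k + 2) * c (k + 2) t) has_real_derivative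
      (\<Sum>k<Suc n. \<epsilon> * w (k + 2) * ((1 / \<epsilon>) * (J (k + 1) s - J (k + 2) s)))) (at s within {0..T})"
      by (intro DERIV_sum DERIV_cmult dc s)
    also have "(\<lambda>k. \<epsilon> * w (k + 2) * ((1 / \<epsilon>) * (J (k + 1) s - J (k + 2) s))) = (\<lambda>k. w (k + 2) * (J (k + 1) s - J (k + 2) s))"
      using eps by auto
    finally show ?thesis using summation_by_parts_flux[of w "\<lambda>i. J i s" n] by simp
  qed
  have dF: "(F n has_real_derivative F' n s) (at s within {0..T})" if s: "s \<in> {0..T}" for n s
  proof -
    let ?S = "\<Sum>k. J (k + 2) s" and ?P = "\<Sum>k<n. J (k + 2) s"
    have "((\<lambda>t. \<Sum>k<Suc n. mass_at k t) has_real_derivative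
        \<epsilon> * real 2 * J 1 s + (\<Sum>k<n. (\<epsilon> * real (k + 3) - \<epsilon> * real (k + 2)) * J (k + 2) s)
          - \<epsilon> * real (n + 2) * J (n + 2) s) (at s within {0..T})"
      by (rule dsum[OF s])
    also have "(\<Sum>k<n. (\<epsilon> * real (k + 3) - \<epsilon> * real (k + 2)) * J (k + 2) s) = \<epsilon> * ?P"
      by (simp add: sum_distrib_left algebra_simps)
    finally have "((\<lambda>t. (m - u t) - (\<Sum>k<Suc n. mass_at k t)) has_real_derivative
        (0 - (- (2 * \<epsilon> * J 1 s) - \<epsilon> * ?S)) - (\<epsilon> * real 2 * J 1 s + \<epsilon> * ?P - \<epsilon> * real (n + 2) * J (n + 2) s))
        (at s within {0..T})"
      by (intro DERIV_diff DERIV_const du s)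
    also have "(0 - (- (2 * \<epsilon> * J 1 s) - \<epsilon> * ?S)) - (\<epsilon> * real 2 * J 1 s + \<epsilon> * ?P - \<epsilon> * real (n + 2) * J (n + 2) s)
        = \<epsilon> * (?S - ?P + real (n + 2) * J (n + 2) s)"
      by (simp add: algebra_simps)
    finally have "(mass_tail (Suc n) has_real_derivative \<epsilon> * (?S - ?P + real (n + 2) * J (n + 2) s)) (at s within {0..T})"
      unfolding mass_tail_def[abs_def] .
    then have "((\<lambda>t. \<gamma> n * (mass_tail (Suc n) t / \<epsilon>)) has_real_derivative
        \<gamma> n * ((\<epsilon> * (?S - ?P + real (n + 2) * J (n + 2) s)) / \<epsilon>)) (at s within {0..T})"
      by (intro DERIV_cmult DERIV_cdivide)
    also have "\<gamma> n * ((\<epsilon> * (?S - ?P + real (n + 2) * J (n + 2) s)) / \<epsilon>) = \<gamma> n * (?S - ?P) + g (n + 2) * J (n + 2) s"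
    proof -
      have "\<gamma> n * real (n + 2) = g (n + 2)" by (simp add: \<gamma>_def)
      then have "\<gamma> n * ((?S - ?P) + real (n + 2) * J (n + 2) s) = \<gamma> n * (?S - ?P) + g (n + 2) * J (n + 2) s"
        by (simp only: distrib_left mult.assoc[symmetric])
      then show ?thesis using eps by simp
    qed
    finally have "(F n has_real_derivative (g 2 * J 1 s + (\<Sum>k<n. (g (k + 3) - g (k + 2)) * J (k + 2) s) - g (n + 2) * J (n + 2) s)
        + (\<gamma> n * (?S - ?P) + g (n + 2) * J (n + 2) s)) (at s within {0..T})"
      unfolding F_def[abs_def] by (intro DERIV_add dsum s)
    also have "(g 2 * J 1 s + (\<Sum>k<n. (g (k + 3) - g (k + 2)) * J (k + 2) s) - g (n + 2) * J (n + 2) s)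
        + (\<gamma> n * (?S - ?P) + g (n + 2) * J (n + 2) s) = F' n s"
      unfolding F'_def by linarith
    finally show ?thesis .
  qed
  define D where "D = (Ka * m + Kb) * (1 / (2 * \<epsilon>) + 1) / \<epsilon>"
  have D: "0 \<le> D" unfolding D_def using Ka Kb m_nonneg eps by auto
  have F'G: "\<bar>F' n s - G s\<bar> \<le> (L + B) * (D * mass_tail n s)" if s: "s \<in> {0..T}" for n s
  proof -
    have s0: "0 \<le> s" using s by simp
    have sG: "summable (\<lambda>k. (g (k + 3) - g (k + 2)) * J (k + 2) s)" by (rule summable_increment_J(1)[OF s0, of g L]) (rule g)
    have sJ: "summable (\<lambda>k. J (k + 2) s)" by (rule summable_J[OF s0])
    have sJn: "summable (\<lambda>k. \<bar>J (k + n + 2) s\<bar>)"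
      using summable_abs_J[OF s0] summable_iff_shift[of "\<lambda>k. \<bar>J (k + 2) s\<bar>" n] by simp
    have "F' n s - G s = \<gamma> n * (\<Sum>k. J (k + n + 2) s) - (\<Sum>k. (g (k + n + 3) - g (k + n + 2)) * J (k + n + 2) s)"
      unfolding F'_def G_def suminf_split_initial_segment[OF sG, of n] suminf_split_initial_segment[OF sJ, of n]
      by (simp add: add.assoc)
    also have "\<dots> = (\<Sum>k. (\<gamma> n - (g (k + n + 3) - g (k + n + 2))) * J (k + n + 2) s)"
    proof -
      have 1: "summable (\<lambda>k. J (k + n + 2) s)"
        using sJ summable_iff_shift[of "\<lambda>k. J (k + 2) s" n] by simp
      have 2: "summable (\<lambda>k. (g (k + n + 3) - g (k + n + 2)) * J (k + n + 2) s)"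
        using sG summable_iff_shift[of "\<lambda>k. (g (k + 3) - g (k + 2)) * J (k + 2) s" n] by simp
      show ?thesis
        using suminf_diff[OF summable_mult[OF 1, of "\<gamma> n"] 2] suminf_mult[OF 1, of "\<gamma> n"]
        by (simp add: left_diff_distrib)
    qed
    finally have eq: "F' n s - G s = (\<Sum>k. (\<gamma> n - (g (k + n + 3) - g (k + n + 2))) * J (k + n + 2) s)" .
    have le: "norm ((\<gamma> n - (g (k + n + 3) - g (k + n + 2))) * J (k + n + 2) s) \<le> (L + B) * \<bar>J (k + n + 2) s\<bar>" for k
    proof -
      have "\<bar>g (k + n + 3) - g (k + n + 2)\<bar> \<le> L" using g[of "k + n + 2"] by (simp add: numeral_eq_Suc)
      then have "\<bar>\<gamma> n - (g (k + n + 3) - g (k + n + 2))\<bar> \<le> L + B" using \<gamma>[of n] by linarith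
      then show ?thesis by (simp only: real_norm_def abs_mult) (intro mult_right_mono, auto)
    qed
    have "\<bar>F' n s - G s\<bar> \<le> (\<Sum>k. (L + B) * \<bar>J (k + n + 2) s\<bar>)"
      unfolding eq using norm_suminf_le[OF le summable_mult[OF sJn]] by simp
    also have "\<dots> = (L + B) * (\<Sum>k. \<bar>J (k + n + 2) s\<bar>)" by (rule suminf_mult[OF sJn])
    also have "\<dots> \<le> (L + B) * (D * mass_tail n s)"
      unfolding D_def using L by (intro mult_left_mono J_tail_le s0) (simp add: B_def)
    finally show ?thesis .
  qed
  have unif: "\<forall>\<^sub>F n in sequentially. \<forall>x\<in>{0..T}. \<forall>h. norm (F' n x * h - G x * h) \<le> e * norm h" if e: "0 < e" for e
  proof -
    define e' where "e' = e / ((L + B) * D + 1)"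
    have LB: "0 \<le> (L + B) * D" using L D by (simp add: B_def)
    have e': "0 < e'" using e LB by (simp add: e'_def)
    have "\<forall>\<^sub>F n in sequentially. \<forall>x\<in>{0..T}. dist (mass_tail n x) 0 < e'"
      using mass_tail_uniform[of T] e' by (auto simp: uniform_limit_iff)
    then show ?thesis
    proof eventually_elim
      case (elim n)
      show ?case
      proof (intro ballI allI)
        fix x h assume x: "x \<in> {0..T}"
        have "\<bar>F' n x - G x\<bar> \<le> (L + B) * D * mass_tail n x" using F'G[OF x, of n] by (simp add: mult.assoc)
        also have "\<dots> \<le> (L + B) * D * e'" using bspec[OF elim x] LB by (intro mult_left_mono) auto
        also have "\<dots> \<le> e" using e LB by (simp add: e'_def divide_le_eq mult.commute)
        finally have "\<bar>F' n x - G x\<bar> * \<bar>h\<bar> \<le> e * \<bar>h\<bar>" by (intro mult_right_mono) auto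
        then show "norm (F' n x * h - G x * h) \<le> e * norm h"
          by (simp only: real_norm_def abs_mult left_diff_distrib[symmetric])
      qed
    qed
  qed
  have lim: "(\<lambda>n. F n s) \<longlonglongrightarrow> mom g s" if s: "s \<in> {0..T}" for s
  proof -
    have "(\<lambda>n. mass_tail n s) \<longlonglongrightarrow> 0"
      using tendsto_uniform_limitI[OF mass_tail_uniform s] .
    then have "(\<lambda>n. mass_tail (Suc n) s) \<longlonglongrightarrow> 0" by (rule LIMSEQ_Suc)
    then have "(\<lambda>n. mass_tail (Suc n) s / \<epsilon>) \<longlonglongrightarrow> 0"
      by (rule tendsto_divide_zero)
    then have "(\<lambda>n. \<gamma> n * (mass_tail (Suc n) s / \<epsilon>)) \<longlonglongrightarrow> 0"
      using \<gamma> by (intro lim_null_mult_left_bounded[where B=B]) (simp_all add: always_eventually)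
    moreover have "(\<lambda>n. \<Sum>k<Suc n. \<epsilon> * g (k + 2) * c (k + 2) s) \<longlonglongrightarrow> mom g s"
      unfolding mom_def using mom_summable[of s g B] gB s
      by (intro LIMSEQ_Suc summable_LIMSEQ) auto
    ultimately show ?thesis
      unfolding F_def using tendsto_add[of _ "mom g s" _ _ 0] by simp
  qed
  have "\<exists>h. \<forall>x\<in>{0..T}. (\<lambda>n. F n x) \<longlonglongrightarrow> h x \<and> (h has_derivative (\<lambda>y. G x * y)) (at x within {0..T})"
    by (rule has_derivative_sequence[where f'="\<lambda>n x y. F' n x * y" and ?x0.0=0 and l="mom g 0", OF _ _ unif])
       (use dF lim T in \<open>auto simp: has_field_derivative_def\<close>)
  then obtain h where h: "\<And>x. x \<in> {0..T} \<Longrightarrow> (\<lambda>n. F n x) \<longlonglongrightarrow> h x"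
      "\<And>x. x \<in> {0..T} \<Longrightarrow> (h has_real_derivative G x) (at x within {0..T})"
    unfolding has_field_derivative_def by blast
  have "h x = mom g x" if "x \<in> {0..T}" for x
    using h(1)[OF that] lim[OF that] LIMSEQ_unique by blast
  then have "(mom g has_real_derivative G t) (at t within {0..T})"
    by (intro has_field_derivative_transform_within[OF h(2)[OF t] zero_less_one t]) auto
  then show ?thesis by (simp add: G_def)
qed

section \<open>Estimates for a single system\<close>

lemma detach_nonneg: "0 \<le> detach i"
  using b_pos[of i] by (simp add: detach_def not_less less_imp_le)

lemma detach_le: "detach i \<le> Kb * (1 + \<epsilon> * real i)"
  using b_le[of i] Kb eps by (simp add: detach_def)

text \<open>Collecting the contributions of each cluster size, attachment comes with the forward and detachment
  with the backward difference of the weight: the discrete form of \<open>(a u - b) \<phi>'\<close>.\<close>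

lemma flux_transport:
  assumes t: "0 \<le> t" and g: "\<And>i. 2 \<le> i \<Longrightarrow> \<bar>g (i + 1) - g i\<bar> \<le> L"
  shows "(\<lambda>k. ((g (k + 3) - g (k + 2)) * (a (k + 2) * u t) - (g (k + 2) - g (k + 1)) * detach (k + 2)) * c (k + 2) t)
    sums (\<Sum>k. (g (k + 3) - g (k + 2)) * J (k + 2) t)"
proof -
  define A where "A k = (g (k + 3) - g (k + 2)) * (a (k + 2) * u t) * c (k + 2) t" for k
  define B where "B k = (g (k + 2) - g (k + 1)) * detach (k + 2) * c (k + 2) t" for k
  have L: "0 \<le> L" using g[of 2] by linarith
  have gk: "\<bar>g (k + 3) - g (k + 2)\<bar> \<le> L" for k using g[of "k + 2"] by (simp add: numeral_eq_Suc)
  have sS: "summable (\<lambda>k. (g (k + 3) - g (k + 2)) * J (k + 2) t)"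
    by (rule summable_increment_J(1)[OF t, of g L]) (rule g)
  have sA: "summable A"
  proof (rule summable_comparison_test')
    show "summable (\<lambda>k. L * Ka * m / \<epsilon> * (weighted_at k t))"
      by (rule summable_mult[OF summable_weighted[OF t]])
    fix k :: nat
    have "norm (A k) = \<bar>g (k + 3) - g (k + 2)\<bar> * (a (k + 2) * u t * c (k + 2) t)"
      using a_pos[of "k + 2"] u_nonneg[OF t] c_nonneg[OF t, of "k + 2"] by (simp add: A_def abs_mult)
    also have "\<dots> \<le> L * ((Ka * (1 + \<epsilon> * real (k + 2))) * m * c (k + 2) t)"
      using gk[of k] L a_le[of "k + 2"] a_pos[of "k + 2"] u_le[OF t] u_nonneg[OF t] c_nonneg[OF t, of "k + 2"] Ka eps
      by (intro mult_mono mult_nonneg_nonneg) (auto intro: add_nonneg_nonneg)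
    finally show "norm (A k) \<le> L * Ka * m / \<epsilon> * (weighted_at k t)"
      using eps by (simp add: mult_ac)
  qed
  have AB: "(g (k + 3) - g (k + 2)) * J (k + 2) t = A k - B (Suc k)" for k
    unfolding J_Suc A_def B_def detach_def by (simp add: right_diff_distrib mult.assoc numeral_eq_Suc)
  have "summable (\<lambda>k. A k - (g (k + 3) - g (k + 2)) * J (k + 2) t)" by (rule summable_diff[OF sA sS])
  then have sB: "summable (\<lambda>k. B (Suc k))" unfolding AB by simp
  have "B sums ((\<Sum>k. B (Suc k)) + B 0)" by (rule sums_Suc[OF summable_sums[OF sB]])
  moreover have "B 0 = 0" by (simp add: B_def detach_def)
  ultimately have "(\<lambda>k. A k - B k) sums ((\<Sum>k. A k) - (\<Sum>k. B (Suc k)))"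
    using sums_diff[OF summable_sums[OF sA]] by simp
  also have "(\<Sum>k. A k) - (\<Sum>k. B (Suc k)) = (\<Sum>k. (g (k + 3) - g (k + 2)) * J (k + 2) t)"
    unfolding AB by (rule suminf_diff[OF sA sB])
  finally show ?thesis by (simp add: A_def B_def left_diff_distrib)
qed

lemma J_1_le: "0 \<le> t \<Longrightarrow> J 1 t \<le> \<alpha> * m\<^sup>2"
proof -
  assume t: "0 \<le> t"
  have "\<alpha> * (u t)\<^sup>2 \<le> \<alpha> * m\<^sup>2"
    using \<alpha> u_le[OF t] u_nonneg[OF t] by (intro mult_left_mono power_mono) auto
  moreover have "0 \<le> \<epsilon> powr \<eta> * \<beta> * c 2 t" using \<beta> c_nonneg[OF t, of 2] by simp
  ultimately show ?thesis unfolding J_1 by linarith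
qed

lemma J_1_abs_le: "0 \<le> t \<Longrightarrow> \<bar>J 1 t\<bar> \<le> \<alpha> * m\<^sup>2 + \<beta> * (\<epsilon> powr \<eta> * c 2 t)"
proof -
  assume t: "0 \<le> t"
  have "0 \<le> \<alpha> * (u t)\<^sup>2" using \<alpha> by simp
  moreover have "0 \<le> \<beta> * (\<epsilon> powr \<eta> * c 2 t)" using \<beta> c_nonneg[OF t, of 2] by simp
  moreover have "0 \<le> \<alpha> * m\<^sup>2" using \<alpha> by simp
  moreover have "J 1 t = \<alpha> * (u t)\<^sup>2 - \<beta> * (\<epsilon> powr \<eta> * c 2 t)" unfolding J_1 by (simp add: ac_simps)
  ultimately show ?thesis using J_1_le[OF t] by linarith
qed

text \<open>The weight 1 is transported without change, so only nucleation creates clusters, at a rate of at most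
  \<open>\<alpha> m\<^sup>2\<close>.\<close>

lemma number_le:
  assumes "0 \<le> t"
  shows "number t \<le> number 0 + \<alpha> * m\<^sup>2 * t"
proof -
  have "number t - number 0 \<le> \<alpha> * m\<^sup>2 * (t - 0)"
  proof (rule increment_le)
    fix s assume s: "s \<in> {0..t}"
    show "(number has_real_derivative J 1 s) (at s within {0..t})"
      using mom_deriv[OF assms s, of "\<lambda>_. 1" 0] by simp
    show "J 1 s \<le> \<alpha> * m\<^sup>2" using s by (intro J_1_le) simp
  qed (use assms in auto)
  then show ?thesis by simp
qed

lemma mom_Lipschitz:
  assumes T: "0 \<le> T" and st: "s \<in> {0..T}" "t \<in> {0..T}"
    and P: "\<And>t. t \<in> {0..T} \<Longrightarrow> \<bar>J 1 t\<bar> \<le> P" and M: "\<And>t. t \<in> {0..T} \<Longrightarrow> number t \<le> M"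
    and g: "\<And>i. 2 \<le> i \<Longrightarrow> \<bar>g (i + 1) - g i\<bar> \<le> \<epsilon> * L" "\<bar>g 2\<bar> \<le> B"
  shows "\<bar>mom g t - mom g s\<bar> \<le> (B * P + L * ((Ka * m + Kb) * (M + m))) * \<bar>t - s\<bar>"
proof (rule increment_abs_le[OF _ st])
  have eL: "0 \<le> \<epsilon> * L" using g(1)[of 2] by linarith
  then have L: "0 \<le> L" using eps by (simp add: zero_le_mult_iff)
  fix x assume x: "x \<in> {0..T}"
  then have x0: "0 \<le> x" by simp
  show "(mom g has_real_derivative g 2 * J 1 x + (\<Sum>k. (g (k + 3) - g (k + 2)) * J (k + 2) x)) (at x within {0..T})"
    by (rule mom_deriv[OF T x]) (rule g(1))
  have "\<bar>g 2 * J 1 x\<bar> \<le> B * P"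
    unfolding abs_mult using g(2) P[OF x] by (intro mult_mono) auto
  moreover have "\<epsilon> * \<bar>\<Sum>k. (g (k + 3) - g (k + 2)) * J (k + 2) x\<bar> \<le> (\<epsilon> * L) * ((Ka * m + Kb) * (number x + m))"
    by (rule summable_increment_J(2)[OF x0]) (rule g(1))
  then have "\<bar>\<Sum>k. (g (k + 3) - g (k + 2)) * J (k + 2) x\<bar> \<le> L * ((Ka * m + Kb) * (number x + m))"
    using eps by (simp add: mult.assoc)
  moreover have "L * ((Ka * m + Kb) * (number x + m)) \<le> L * ((Ka * m + Kb) * (M + m))"
    using L Ka Kb m_nonneg M[OF x] by (intro mult_left_mono) auto
  ultimately show "\<bar>g 2 * J 1 x + (\<Sum>k. (g (k + 3) - g (k + 2)) * J (k + 2) x)\<bar> \<le> B * P + L * ((Ka * m + Kb) * (M + m))"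
    by linarith
qed simp

text \<open>The dimers enter only through \<open>\<epsilon> * c 2\<close>, hence through the number of clusters. The bound is therefore
  available before anything is known about small clusters; it determines how long \<open>u\<close> stays above \<open>\<rho>\<close>.\<close>

lemma u_Lipschitz:
  assumes T: "0 \<le> T" and st: "s \<in> {0..T}" "t \<in> {0..T}" and eps1: "\<epsilon> \<le> 1" and eta: "0 \<le> \<eta>"
    and M: "\<And>t. t \<in> {0..T} \<Longrightarrow> number t \<le> M"
  shows "\<bar>u t - u s\<bar> \<le> (2 * (\<alpha> * m\<^sup>2 + \<beta> * M) + (Ka * m + Kb) * (M + m)) * \<bar>t - s\<bar>"
proof (rule increment_abs_le[OF _ st])
  fix x assume x: "x \<in> {0..T}"
  then have x0: "0 \<le> x" by simp
  show "(u has_real_derivative - (2 * \<epsilon> * J 1 x) - \<epsilon> * (\<Sum>k. J (k + 2) x)) (at x within {0..T})"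
    by (rule DERIV_subset[OF u_deriv[OF x0]]) auto
  have "\<epsilon> * \<bar>J 1 x\<bar> \<le> \<epsilon> * (\<alpha> * m\<^sup>2 + \<beta> * (\<epsilon> powr \<eta> * c 2 x))"
    using J_1_abs_le[OF x0] eps by (intro mult_left_mono) auto
  also have "\<dots> = \<epsilon> * (\<alpha> * m\<^sup>2) + (\<epsilon> powr \<eta>) * (\<beta> * (\<epsilon> * c 2 x))" by (simp add: distrib_left mult_ac)
  also have "\<dots> \<le> 1 * (\<alpha> * m\<^sup>2) + 1 * (\<beta> * M)"
  proof (intro add_mono mult_mono)
    show "\<epsilon> powr \<eta> \<le> 1" using powr_mono2[of \<eta> \<epsilon> 1] eps eps1 eta by simp
    show "\<epsilon> * c 2 x \<le> M" using eps_c2_le_number[OF x0] M[OF x] by simp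
  qed (use \<alpha> \<beta> eps eps1 c_nonneg[OF x0, of 2] in auto)
  finally have 1: "\<bar>2 * \<epsilon> * J 1 x\<bar> \<le> 2 * (\<alpha> * m\<^sup>2 + \<beta> * M)" using eps by (simp add: abs_mult)
  have "\<bar>\<Sum>k. J (k + 2) x\<bar> \<le> (\<Sum>k. \<bar>J (k + 2) x\<bar>)"
    by (rule summable_rabs[OF summable_abs_J[OF x0]])
  then have "\<epsilon> * \<bar>\<Sum>k. J (k + 2) x\<bar> \<le> \<epsilon> * (\<Sum>k. \<bar>J (k + 2) x\<bar>)" using eps by (intro mult_left_mono) auto
  also have "\<dots> \<le> (Ka * m + Kb) * (number x + m)" by (rule suminf_abs_J_le[OF x0])
  also have "\<dots> \<le> (Ka * m + Kb) * (M + m)"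
    using Ka Kb m_nonneg M[OF x] by (intro mult_left_mono) auto
  finally have 2: "\<bar>\<epsilon> * (\<Sum>k. J (k + 2) x)\<bar> \<le> (Ka * m + Kb) * (M + m)" using eps by (simp add: abs_mult)
  show "\<bar>- (2 * \<epsilon> * J 1 x) - \<epsilon> * (\<Sum>k. J (k + 2) x)\<bar> \<le> 2 * (\<alpha> * m\<^sup>2 + \<beta> * M) + (Ka * m + Kb) * (M + m)"
    using 1 2 by linarith
qed simp

text \<open>While \<open>u\<close> is large enough for \<open>a u - e\<^sup>z b\<close> to dominate \<open>\<kappa> x\<^sup>r\<close> near the origin, small clusters are swept
  to the right. In the moment with weight \<open>e\<^sup>-\<^sup>i\<^sup>z\<close> this acts as a damping of strength \<open>\<epsilon>\<^sup>r\<close>, against a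
  nucleation of order 1. The sizes \<open>\<epsilon> i \<ge> h\<close>, where the drift has no sign, are harmless since there the
  weight is at most \<open>\<epsilon> / (h z)\<close>.\<close>

lemma small_clusters_bound:
  assumes T: "0 \<le> T" and t: "t \<in> {0..T}" and eps1: "\<epsilon> \<le> 1" and z: "0 < z" "z < 1" and h: "0 < h" and \<kappa>: "0 < \<kappa>"
    and r: "0 \<le> r"
    and M: "\<And>t. t \<in> {0..T} \<Longrightarrow> number t \<le> M"
    and coer: "\<And>s i. s \<in> {0..T} \<Longrightarrow> 2 \<le> i \<Longrightarrow> \<epsilon> * real i < h \<Longrightarrow>
      \<kappa> * (\<epsilon> * real i) powr r \<le> a i * u s - exp z * detach i"
  shows "\<epsilon> powr r * c 2 t \<le> exp (2 * z) * (\<epsilon> powr r * (\<Sum>k. exp (- (real (k + 2) * z)) * c (k + 2) 0)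
      + (\<alpha> * m\<^sup>2 + (\<kappa> + 3 * Kb) / (h * z) * (M + m)) / ((1 - exp (- z)) * \<kappa>))"
proof -
  define g where "g i = exp (- (real i * z))" for i :: nat
  define \<theta> where "\<theta> = (1 - exp (- z)) * \<kappa>"
  define K where "K = (\<kappa> + 3 * Kb) / (h * z)"
  define C where "C = \<alpha> * m\<^sup>2 + K * (M + m)"
  have \<theta>: "0 < \<theta>" using z \<kappa> by (simp add: \<theta>_def)
  have K: "0 \<le> K" using h z \<kappa> Kb by (simp add: K_def)
  have M0: "0 \<le> M" using M[OF t] number_nonneg[of t] t by simp
  have C: "0 \<le> C" using \<alpha> K M0 m_nonneg by (simp add: C_def)
  have g1: "g (i + 1) = exp (- z) * g i" for i
    by (simp add: g_def exp_add[symmetric] algebra_simps)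
  have gi: "\<bar>g (i + 1) - g i\<bar> \<le> 1" for i
    unfolding g_def by (rule exponential_increment[OF z(1)])
  have g0: "0 < g i" "g i \<le> 1" for i using z by (auto simp: g_def)
  have er: "0 < \<epsilon> powr r" "\<epsilon> powr r \<le> 1" using powr_mono2[of r \<epsilon> 1] eps eps1 r by auto
  define E where "E = mom g"
  have gs: "summable (\<lambda>k. \<epsilon> * g (k + 2) * c (k + 2) s)" if "0 \<le> s" for s
  proof (rule mom_summable[OF that, where B=1])
    fix i :: nat assume "2 \<le> i"
    then show "\<bar>g i\<bar> \<le> 1 * real i" using g0[of i] by simp
  qed
  have dE: "(E has_real_derivative g 2 * J 1 s + (\<Sum>k. (g (k + 3) - g (k + 2)) * J (k + 2) s)) (at s within {0..T})"
    if "s \<in> {0..T}" for s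
    unfolding E_def by (rule mom_deriv[OF T that]) (rule gi)
  have E'le: "g 2 * J 1 s + (\<Sum>k. (g (k + 3) - g (k + 2)) * J (k + 2) s) \<le> C - (\<theta> * \<epsilon> powr r / \<epsilon>) * E s"
    if s: "s \<in> {0..T}" for s
  proof -
    have s0: "0 \<le> s" using s by simp
    define X where "X k = ((g (k + 3) - g (k + 2)) * (a (k + 2) * u s) - (g (k + 2) - g (k + 1)) * detach (k + 2)) * c (k + 2) s" for k
    have Xs: "X sums (\<Sum>k. (g (k + 3) - g (k + 2)) * J (k + 2) s)"
      unfolding X_def by (rule flux_transport[OF s0]) (rule gi)
    have Xle: "X k \<le> - (\<theta> * \<epsilon> powr r / \<epsilon>) * (\<epsilon> * g (k + 2) * c (k + 2) s) + K * (weighted_at k s)" for k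
    proof -
      define i where "i = k + 2"
      have i: "2 \<le> i" by (simp add: i_def)
      define x where "x = \<epsilon> * real i"
      have x: "0 < x" using eps i by (simp add: x_def)
      define d where "d = 1 - exp (- z)"
      have d: "0 < d" "d \<le> 1" using z by (auto simp: d_def)
      have gp: "g (k + 3) = exp (- z) * g i" using g1[of i] by (simp add: i_def numeral_eq_Suc)
      have gm: "g (k + 1) = exp z * g i" using g1[of "k + 1"] by (simp add: i_def numeral_eq_Suc exp_minus)
      have ci: "0 \<le> c i s" using c_nonneg[OF s0 i] .
      have "exp z * exp (- z) = 1" by (simp add: exp_minus)
      then have "exp z * d = exp z - 1" by (simp add: d_def right_diff_distrib)
      then have "(g i - exp z * g i) * detach i = - (exp z * d) * g i * detach i" by algebra
      moreover have "(exp (- z) * g i - g i) * (a i * u s) = - d * g i * (a i * u s)" by (simp add: d_def algebra_simps)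
      ultimately have Xk: "X k = d * g i * (- (a i * u s - exp z * detach i)) * c i s"
        unfolding X_def gp gm i_def[symmetric] by (simp only:) (simp add: algebra_simps)
      \<comment> \<open>with \<open>d = 1 - e\<^sup>-\<^sup>z\<close>, both differences of the weight are multiples of \<open>d * g i\<close>, up to the factor \<open>e\<^sup>z\<close>
        in front of the detachment rate\<close>
      have main: "d * g i * (- (a i * u s - exp z * detach i)) \<le> - (d * \<kappa> * \<epsilon> powr r) * g i + K * \<epsilon> * (1 + x)"
      proof (cases "x < h")
        case True
        have "\<epsilon> powr r \<le> x powr r" using eps r i by (intro powr_mono2) (auto simp: x_def)
        then have "\<kappa> * \<epsilon> powr r \<le> \<kappa> * x powr r" using \<kappa> by simp
        also have "\<dots> \<le> a i * u s - exp z * detach i" using coer[OF s i] True by (simp add: x_def)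
        finally have "d * g i * (- (a i * u s - exp z * detach i)) \<le> d * g i * (- (\<kappa> * \<epsilon> powr r))"
          using d g0(1)[of i] by (intro mult_left_mono) auto
        moreover have "0 \<le> K * \<epsilon> * (1 + x)" using K eps x by simp
        ultimately show ?thesis by (simp add: mult_ac)
      next
        case False
        have "exp z \<le> 3" using exp_le z(2) order_trans[of "exp z" "exp 1" 3] by simp
        then have "exp z * detach i \<le> 3 * (Kb * (1 + x))"
          using detach_le[of i] detach_nonneg[of i] by (intro mult_mono) (auto simp: x_def)
        moreover have "0 \<le> a i * u s" using a_pos[OF i] u_nonneg[OF s0] by simp
        moreover have "\<kappa> * \<epsilon> powr r \<le> \<kappa> * (1 + x)" using \<kappa> er x by (intro mult_left_mono) auto
        ultimately have up: "- (a i * u s - exp z * detach i) + \<kappa> * \<epsilon> powr r \<le> (\<kappa> + 3 * Kb) * (1 + x)"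
          by (simp add: distrib_right)
        have iz: "0 < real i * z" using i z by simp
        have "real i * z \<le> exp (real i * z)" using exp_ge_add_one_self[of "real i * z"] by linarith
        then have "g i \<le> 1 / (real i * z)" using iz by (simp add: g_def exp_minus inverse_eq_divide frac_le)
        also have "\<dots> \<le> \<epsilon> / (h * z)"
          using False h z eps iz by (simp add: x_def divide_simps mult.commute)
        finally have "g i \<le> \<epsilon> / (h * z)" .
        then have "d * g i \<le> 1 * (\<epsilon> / (h * z))" using d g0(1)[of i] by (intro mult_mono) auto
        then have "d * g i * ((\<kappa> + 3 * Kb) * (1 + x)) \<le> (\<epsilon> / (h * z)) * ((\<kappa> + 3 * Kb) * (1 + x))"
          using \<kappa> Kb x by (intro mult_right_mono) auto
        moreover have "d * g i * (- (a i * u s - exp z * detach i) + \<kappa> * \<epsilon> powr r) \<le> d * g i * ((\<kappa> + 3 * Kb) * (1 + x))"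
          using d g0(1)[of i] up by (intro mult_left_mono) auto
        moreover have "(\<epsilon> / (h * z)) * ((\<kappa> + 3 * Kb) * (1 + x)) = K * \<epsilon> * (1 + x)" by (simp add: K_def)
        ultimately have "d * g i * (- (a i * u s - exp z * detach i) + \<kappa> * \<epsilon> powr r) \<le> K * \<epsilon> * (1 + x)" by linarith
        moreover have "d * g i * (- (a i * u s - exp z * detach i) + \<kappa> * \<epsilon> powr r)
          = d * g i * (- (a i * u s - exp z * detach i)) + (d * \<kappa> * \<epsilon> powr r) * g i"
          by (simp only: distrib_left mult_ac)
        ultimately have "d * g i * (- (a i * u s - exp z * detach i)) + (d * \<kappa> * \<epsilon> powr r) * g i \<le> K * \<epsilon> * (1 + x)"
          by (simp only:)
        moreover have "p + q \<le> w \<Longrightarrow> p \<le> - q + w" for p q w :: real by linarith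
        ultimately show ?thesis by (simp only: mult_minus_left)
      qed
      have "X k \<le> (- (d * \<kappa> * \<epsilon> powr r) * g i + K * \<epsilon> * (1 + x)) * c i s"
        unfolding Xk by (rule mult_right_mono[OF main ci])
      also have "\<dots> = - (\<theta> * \<epsilon> powr r / \<epsilon>) * (\<epsilon> * g i * c i s) + K * (\<epsilon> * (1 + x) * c i s)"
        using eps by (simp add: \<theta>_def d_def) (simp add: algebra_simps)
      finally show ?thesis by (simp add: i_def x_def)
    qed
    have "(\<Sum>k. (g (k + 3) - g (k + 2)) * J (k + 2) s) \<le>
        - (\<theta> * \<epsilon> powr r / \<epsilon>) * E s + K * (number s + (m - u s))"
      unfolding E_def mom_def[of g]
      by (rule sums_le[OF Xle Xs]) (intro sums_add sums_mult summable_sums gs s0 weighted_number_sums)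
    also have "\<dots> \<le> - (\<theta> * \<epsilon> powr r / \<epsilon>) * E s + K * (M + m)"
      using M[OF s] u_nonneg[OF s0] K by (intro add_left_mono mult_left_mono) auto
    finally have 1: "(\<Sum>k. (g (k + 3) - g (k + 2)) * J (k + 2) s) \<le> - (\<theta> * \<epsilon> powr r / \<epsilon>) * E s + K * (M + m)" .
    have "g 2 * J 1 s \<le> g 2 * (\<alpha> * m\<^sup>2)" using g0[of 2] J_1_le[OF s0] by (intro mult_left_mono) auto
    also have "\<dots> \<le> 1 * (\<alpha> * m\<^sup>2)" using g0[of 2] \<alpha> by (intro mult_right_mono) auto
    finally show ?thesis using 1 by (simp add: C_def)
  qed
  have kpos: "0 < \<theta> * \<epsilon> powr r / \<epsilon>" using \<theta> er eps by simp
  have Enn: "0 \<le> E s" if "0 \<le> s" for s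
    unfolding E_def mom_def
  proof (rule suminf_nonneg[OF gs[OF that]])
    fix k show "0 \<le> \<epsilon> * g (k + 2) * c (k + 2) s" using eps g0(1)[of "k + 2"] c_nonneg[OF that, of "k + 2"] by simp
  qed
  have "E t \<le> E 0 + C / (\<theta> * \<epsilon> powr r / \<epsilon>)"
    using gronwall_damped[OF kpos _ _ C Enn dE E'le] t by auto
  then have "(\<epsilon> powr r / \<epsilon>) * E t \<le> (\<epsilon> powr r / \<epsilon>) * (E 0 + C / (\<theta> * \<epsilon> powr r / \<epsilon>))"
    using er eps by (intro mult_left_mono) auto
  also have "\<dots> = (\<epsilon> powr r / \<epsilon>) * E 0 + C / \<theta>" using er eps \<theta> by (simp add: field_simps)
  also have "(\<epsilon> powr r / \<epsilon>) * E 0 = \<epsilon> powr r * (\<Sum>k. g (k + 2) * c (k + 2) 0)"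
  proof -
    have "summable (\<lambda>k. g (k + 2) * c (k + 2) 0)" using gs[of 0] eps by (simp add: mult.assoc)
    then have "E 0 = \<epsilon> * (\<Sum>k. g (k + 2) * c (k + 2) 0)"
      unfolding E_def mom_def mult.assoc by (rule suminf_mult)
    then show ?thesis using eps by simp
  qed
  finally have 2: "(\<epsilon> powr r / \<epsilon>) * E t \<le> \<epsilon> powr r * (\<Sum>k. g (k + 2) * c (k + 2) 0) + C / \<theta>" .
  have t0: "0 \<le> t" using t by simp
  have "(\<Sum>k<1. \<epsilon> * g (k + 2) * c (k + 2) t) \<le> E t"
    unfolding E_def mom_def
    by (intro sum_le_suminf gs t0) (use eps g0(1) c_nonneg[OF t0] in \<open>auto intro!: mult_nonneg_nonneg simp: less_imp_le\<close>)
  then have "\<epsilon> * (g 2 * c 2 t) \<le> E t" by (simp add: numeral_2_eq_2)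
  then have "(\<epsilon> powr r / \<epsilon>) * (\<epsilon> * (g 2 * c 2 t)) \<le> (\<epsilon> powr r / \<epsilon>) * E t"
    using er eps by (intro mult_left_mono) auto
  then have "g 2 * (\<epsilon> powr r * c 2 t) \<le> \<epsilon> powr r * (\<Sum>k. g (k + 2) * c (k + 2) 0) + C / \<theta>"
    using 2 eps by (simp add: mult_ac)
  then have "exp (2 * z) * (g 2 * (\<epsilon> powr r * c 2 t)) \<le> exp (2 * z) * (\<epsilon> powr r * (\<Sum>k. g (k + 2) * c (k + 2) 0) + C / \<theta>)"
    by (intro mult_left_mono) auto
  moreover have "exp (2 * z) * (g 2 * (\<epsilon> powr r * c 2 t)) = \<epsilon> powr r * c 2 t"
  proof -
    have "exp (2 * z) * g 2 = 1" by (simp add: g_def exp_minus)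
    then show ?thesis by (simp only: mult.assoc[symmetric] mult_1_left)
  qed
  ultimately show ?thesis by (simp only: g_def C_def K_def \<theta>_def)
qed

text \<open>Detachment only lowers the moment of a nondecreasing weight, and attachment raises it at a rate that
  grows linearly in the size. For a weight \<open>\<psi>\<close> with \<open>x \<psi>'(x)\<close> of the order of \<open>\<psi>(x)\<close> this closes to a linear
  differential inequality.\<close>

lemma superlinear_moment_bound:
  assumes T: "0 \<le> T" and t: "t \<in> {0..T}"
    and M: "\<And>t. t \<in> {0..T} \<Longrightarrow> number t \<le> M"
    and \<psi>: "\<And>x. 0 \<le> x \<Longrightarrow> 0 \<le> \<psi> x" "\<And>x y. 0 \<le> x \<Longrightarrow> x \<le> y \<Longrightarrow> \<psi> x \<le> \<psi> y" "\<psi> (2 * \<epsilon>) \<le> B"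
    and PQ: "0 \<le> P" "0 \<le> Q"
    and grow: "\<And>x. 2 * \<epsilon> \<le> x \<Longrightarrow> (\<psi> (x + \<epsilon>) - \<psi> x) * (1 + x) \<le> \<epsilon> * (P * \<psi> x + Q)"
    and lin: "\<And>x. 0 \<le> x \<Longrightarrow> \<psi> (x + \<epsilon>) - \<psi> x \<le> L"
  shows "mom (\<lambda>i. \<psi> (\<epsilon> * real i)) t \<le>
    (mom (\<lambda>i. \<psi> (\<epsilon> * real i)) 0 + (B * (\<alpha> * m\<^sup>2) + Ka * m * (Q * M)) * t) * exp (Ka * m * P * t)"
proof -
  define g where "g i = \<psi> (\<epsilon> * real i)" for i :: nat
  have g1: "g (i + 1) = \<psi> (\<epsilon> * real i + \<epsilon>)" for i by (simp add: g_def algebra_simps)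
  have gmono: "g i \<le> g (i + 1)" for i unfolding g_def using eps by (intro \<psi>) auto
  have gi: "\<bar>g (i + 1) - g i\<bar> \<le> L" for i
  proof -
    have "g (i + 1) - g i \<le> L" using lin[of "\<epsilon> * real i"] eps unfolding g1 by (simp add: g_def)
    then show ?thesis using gmono[of i] by linarith
  qed
  have g0: "0 \<le> g i" for i unfolding g_def using eps by (intro \<psi>) auto
  have L: "0 \<le> L" using gi[of 0] by linarith
  have M0: "0 \<le> M" using M[OF t] number_nonneg[of t] t by simp
  have B: "0 \<le> B" using \<psi>(1)[of "2 * \<epsilon>"] \<psi>(3) eps by simp
  have gs: "summable (\<lambda>k. \<epsilon> * g (k + 2) * c (k + 2) s)" if "0 \<le> s" for s
    by (rule mom_summable[OF that, where B="\<bar>g 2\<bar> + L"], rule weight_growth) (use gi L in auto)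
  have "mom g t \<le> (mom g 0 + (B * (\<alpha> * m\<^sup>2) + Ka * m * (Q * M)) * t) * exp ((Ka * m * P) * t)"
  proof (rule gronwall_linear[where T=T])
    show "0 \<le> Ka * m * P" using Ka m_nonneg PQ by simp
    show "0 \<le> B * (\<alpha> * m\<^sup>2) + Ka * m * (Q * M)" using B \<alpha> Ka m_nonneg PQ M0 by simp
    fix s assume s: "s \<in> {0..T}"
    then have s0: "0 \<le> s" by simp
    show "(mom g has_real_derivative g 2 * J 1 s + (\<Sum>k. (g (k + 3) - g (k + 2)) * J (k + 2) s)) (at s within {0..T})"
      by (rule mom_deriv[OF T s]) (rule gi)
    define X where "X k = ((g (k + 3) - g (k + 2)) * (a (k + 2) * u s) - (g (k + 2) - g (k + 1)) * detach (k + 2)) * c (k + 2) s" for k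
    have Xs: "X sums (\<Sum>k. (g (k + 3) - g (k + 2)) * J (k + 2) s)"
      unfolding X_def by (rule flux_transport[OF s0]) (rule gi)
    have Xle: "X k \<le> Ka * m * (P * (\<epsilon> * g (k + 2) * c (k + 2) s) + Q * (\<epsilon> * 1 * c (k + 2) s))" for k
    proof -
      define x where "x = \<epsilon> * real (k + 2)"
      have x: "2 * \<epsilon> \<le> x" using eps by (simp add: x_def)
      have gd: "0 \<le> g (k + 3) - g (k + 2)" using gmono[of "k + 2"] by (simp add: numeral_eq_Suc)
      have gx: "g (k + 3) - g (k + 2) = \<psi> (x + \<epsilon>) - \<psi> x" using g1[of "k + 2"] by (simp add: x_def g_def numeral_eq_Suc)
      have ck: "0 \<le> c (k + 2) s" using c_nonneg[OF s0, of "k + 2"] by simp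
      have "0 \<le> (g (k + 2) - g (k + 1)) * detach (k + 2)" using gmono[of "k + 1"] detach_nonneg by simp
      moreover have "(g (k + 3) - g (k + 2)) * (a (k + 2) * u s) \<le> (g (k + 3) - g (k + 2)) * ((Ka * (1 + x)) * m)"
        using a_le[of "k + 2"] a_pos[of "k + 2"] u_le[OF s0] u_nonneg[OF s0] gd
        by (intro mult_left_mono mult_mono) (auto simp: x_def)
      moreover have "(g (k + 3) - g (k + 2)) * ((Ka * (1 + x)) * m) = Ka * m * ((\<psi> (x + \<epsilon>) - \<psi> x) * (1 + x))"
        unfolding gx by simp
      moreover have "Ka * m * ((\<psi> (x + \<epsilon>) - \<psi> x) * (1 + x)) \<le> Ka * m * (\<epsilon> * (P * \<psi> x + Q))"
        using grow[OF x] Ka m_nonneg by (intro mult_left_mono) auto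
      ultimately have "(g (k + 3) - g (k + 2)) * (a (k + 2) * u s) - (g (k + 2) - g (k + 1)) * detach (k + 2)
          \<le> Ka * m * (\<epsilon> * (P * \<psi> x + Q))" by linarith
      then have "X k \<le> Ka * m * (\<epsilon> * (P * \<psi> x + Q)) * c (k + 2) s"
        unfolding X_def by (intro mult_right_mono ck)
      also have "Ka * m * (\<epsilon> * (P * p + Q)) * y = Ka * m * (P * (\<epsilon> * p * y) + Q * (\<epsilon> * 1 * y))" for p y
        by algebra
      finally show ?thesis by (simp add: g_def x_def)
    qed
    have "(\<Sum>k. (g (k + 3) - g (k + 2)) * J (k + 2) s) \<le> Ka * m * (P * mom g s + Q * number s)"
      unfolding mom_def
      by (rule sums_le[OF Xle Xs]) (intro sums_add sums_mult summable_sums gs s0 number_summable)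
    also have "\<dots> \<le> Ka * m * (P * mom g s + Q * M)"
      using M[OF s] Ka m_nonneg PQ by (intro mult_left_mono add_left_mono) auto
    finally have 1: "(\<Sum>k. (g (k + 3) - g (k + 2)) * J (k + 2) s) \<le> Ka * m * (P * mom g s + Q * M)" .
    have "g 2 * J 1 s \<le> g 2 * (\<alpha> * m\<^sup>2)" using g0[of 2] J_1_le[OF s0] by (intro mult_left_mono) auto
    also have "\<dots> \<le> B * (\<alpha> * m\<^sup>2)" using \<alpha> \<psi>(3) by (intro mult_right_mono) (auto simp: g_def mult.commute)
    finally show "g 2 * J 1 s + (\<Sum>k. (g (k + 3) - g (k + 2)) * J (k + 2) s)
        \<le> B * (\<alpha> * m\<^sup>2) + Ka * m * (Q * M) + (Ka * m * P) * mom g s"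
      using 1 by (simp add: distrib_left mult.assoc)
  qed (use t in auto)
  then show ?thesis by (simp add: g_def[abs_def])
qed

end

section \<open>Superlinear weights and their propagation\<close>

text \<open>Convexity makes the derivative \<open>p\<close> nondecreasing, hence nonnegative; concavity together with \<open>p(0) \<ge> 0\<close>
  makes \<open>p(x) / x\<close> nonincreasing.\<close>

lemma superlinear_weights_derivative:
  assumes "\<Phi> \<in> superlinear_weights"
  shows "\<exists>p. continuous_on {0..} p \<and> (\<forall>x\<ge>0. 0 \<le> p x) \<and> (\<forall>x\<ge>0. \<forall>y\<ge>x. p x \<le> p y) \<and>
    (\<forall>x\<ge>0. \<forall>s\<ge>0. s \<le> x \<longrightarrow> s * p x \<le> x * p s) \<and>
    (\<forall>x\<ge>0. (\<Phi> has_real_derivative p x) (at x within {0..}))"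
proof -
  obtain p where convex: "convex_on {0..} \<Phi>" and p: "\<And>x. 0 \<le> x \<Longrightarrow> (\<Phi> has_real_derivative p x) (at x within {0..})"
      "continuous_on {0..} p" "concave_on {0..} p" "0 \<le> p 0"
    using assms by (auto simp: superlinear_weights_def)
  have mono0: "p x \<le> p y" if xy: "0 < x" "x \<le> y" for x y
  proof (cases "x = y")
    case False
    have "\<Phi> y - \<Phi> x \<ge> p x * (y - x)"
      by (rule convex_on_imp_above_tangent[OF convex]) (use xy p in auto)
    moreover have "\<Phi> x - \<Phi> y \<ge> p y * (x - y)"
      by (rule convex_on_imp_above_tangent[OF convex]) (use xy p in auto)
    ultimately have "p x * (y - x) \<le> p y * (y - x)" by (simp add: algebra_simps)
    then show ?thesis using xy False by simp
  qed simp
  have p0: "p 0 \<le> p y" if "0 \<le> y" for y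
  proof (cases "y = 0")
    case False
    have "(p \<longlongrightarrow> p 0) (at_right 0)"
      using p(2) by (auto simp: continuous_on intro: tendsto_within_subset)
    moreover have "\<forall>\<^sub>F s in at_right 0. p s \<le> p y"
      unfolding eventually_at_right_field using mono0 False that by (intro exI[of _ y]) auto
    ultimately show ?thesis by (rule tendsto_upperbound) simp
  qed simp
  have mono: "p x \<le> p y" if "0 \<le> x" "x \<le> y" for x y
    using mono0[of x y] p0[of y] that by (cases "x = 0") auto
  have nn: "0 \<le> p x" if "0 \<le> x" for x using p0[OF that] p(4) by simp
  have star: "s * p x \<le> x * p s" if "0 \<le> x" "0 \<le> s" "s \<le> x" for x s
  proof (cases "x = 0")
    case False
    then have x: "0 < x" using that by simp
    have "(1 - s / x) * p 0 + (s / x) * p x \<le> p ((1 - s / x) *\<^sub>R 0 + (s / x) *\<^sub>R x)"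
      using that x by (intro concave_onD[OF p(3)]) auto
    moreover have "0 \<le> (1 - s / x) * p 0" using that x p(4) by simp
    ultimately have "(s / x) * p x \<le> p s" using x by simp
    then have "x * ((s / x) * p x) \<le> x * p s" using x by (intro mult_left_mono) auto
    then show ?thesis using x by simp
  qed (use that in auto)
  show ?thesis using p nn mono star by blast
qed

text \<open>A superlinear weight itself is out of reach of the moment equation, which asks for bounded
  increments. It is reached through weights that agree with it up to \<open>R\<close> and grow linearly afterwards. What
  matters is that the constants in the growth condition do not depend on \<open>R\<close>.\<close>

definition linear_truncations :: "(real \<Rightarrow> real) \<Rightarrow> real \<Rightarrow> bool" where
  "linear_truncations \<Phi> Q \<longleftrightarrow> (\<forall>R\<ge>1. \<exists>\<psi> L. (\<forall>x\<ge>0. 0 \<le> \<psi> x \<and> \<psi> x \<le> \<Phi> x) \<and> (\<forall>x\<ge>0. \<forall>y\<ge>x. \<psi> x \<le> \<psi> y) \<and>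
     (\<forall>x\<ge>0. x \<le> R \<longrightarrow> \<psi> x = \<Phi> x) \<and>
     (\<forall>\<epsilon>>0. \<forall>x\<ge>0. \<epsilon> \<le> 1 \<longrightarrow> \<psi> (x + \<epsilon>) - \<psi> x \<le> L) \<and>
     (\<forall>\<epsilon>>0. \<forall>x. 2 * \<epsilon> \<le> x \<longrightarrow> (\<psi> (x + \<epsilon>) - \<psi> x) * (1 + x) \<le> \<epsilon> * (8 * \<psi> x + Q)))"

text \<open>The truncation is the integral of \<open>q(s) = p(min s R)\<close>, where \<open>p\<close> is the derivative of the weight. As
  \<open>q(x) / x\<close> is nonincreasing, \<open>q(x + \<epsilon>) \<le> 2 q(x)\<close> for \<open>\<epsilon> \<le> x\<close>, and integrating \<open>q(s) \<ge> s q(x) / x\<close> gives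
  \<open>x q(x) \<le> 2 \<psi>(x)\<close>. These two bounds yield the factor 8.\<close>

lemma superlinear_truncation:
  assumes "\<Phi> \<in> superlinear_weights"
  shows "\<exists>Q\<ge>0. linear_truncations \<Phi> Q"
proof -
  obtain p where P: "continuous_on {0..} p \<and> (\<forall>x\<ge>0. 0 \<le> p x) \<and> (\<forall>x\<ge>0. \<forall>y\<ge>x. p x \<le> p y) \<and>
    (\<forall>x\<ge>0. \<forall>s\<ge>0. s \<le> x \<longrightarrow> s * p x \<le> x * p s) \<and>
    (\<forall>x\<ge>0. (\<Phi> has_real_derivative p x) (at x within {0..}))"
    using superlinear_weights_derivative[OF assms] by (elim exE) (rule that)
  note P = conjunct1[OF P] conjunct2[OF P]
  note P = P(1) conjunct1[OF P(2)] conjunct2[OF P(2)]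
  note P = P(1,2) conjunct1[OF P(3)] conjunct2[OF P(3)]
  note P = P(1-3) conjunct1[OF P(4)] conjunct2[OF P(4)]
  note pc = P(1) and pn = P(2)[rule_format] and pm = P(3)[rule_format] and pd = P(5)[rule_format]
  have ps: "s * p x \<le> x * p s" if "0 \<le> s" "s \<le> x" for x s
    using P(4)[rule_format, of x s] that by simp
  have \<Phi>0: "\<Phi> 0 = 0" using assms by (simp add: superlinear_weights_def)
  have \<Phi>int: "(p has_integral \<Phi> x) {0..x}" if "0 \<le> x" for x
  proof -
    have "(p has_integral (\<Phi> x - \<Phi> 0)) {0..x}"
    proof (rule fundamental_theorem_of_calculus[OF that])
      fix y assume "y \<in> {0..x}"
      then have "(\<Phi> has_real_derivative p y) (at y within {0..x})"
        by (intro DERIV_subset[OF pd]) auto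
      then show "(\<Phi> has_vector_derivative p y) (at y within {0..x})"
        by (simp add: has_real_derivative_iff_has_vector_derivative)
    qed
    then show ?thesis by (simp add: \<Phi>0)
  qed
  show ?thesis
    unfolding linear_truncations_def
  proof (intro exI[of _ "2 * p 1"] conjI allI impI)
    show "0 \<le> 2 * p 1" using pn[of 1] by simp
    fix R :: real assume R: "1 \<le> R"
    define q where "q s = p (min s R)" for s
    define \<psi> where "\<psi> x = integral {0..x} q" for x
    have qc: "continuous_on {0..} q" unfolding q_def
      by (rule continuous_on_compose2[OF pc]) (use R in \<open>auto intro!: continuous_intros\<close>)
    have qn: "0 \<le> q x" if "0 \<le> x" for x unfolding q_def using that R by (intro pn) auto
    have qm: "q x \<le> q y" if "0 \<le> x" "x \<le> y" for x y unfolding q_def using that R by (intro pm) auto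
    have qR: "q x \<le> p R" if "0 \<le> x" for x unfolding q_def using that R by (intro pm) auto
    have qp: "q x \<le> p x" if "0 \<le> x" for x unfolding q_def using that R by (intro pm) auto
    have qs: "s * q x \<le> x * q s" if "0 \<le> s" "s \<le> x" for x s
    proof (cases "R \<le> s")
      case True
      then have "min x R = R" "min s R = R" using that by auto
      then show ?thesis using that qn[of s] by (simp add: q_def mult_right_mono)
    next
      case False
      then have "s * q x \<le> (min x R) * p s" using that ps[of s "min x R"] by (simp add: q_def)
      also have "\<dots> \<le> x * p s" using that pn[of s] by (intro mult_right_mono) auto
      finally show ?thesis using False by (simp add: q_def min_def)
    qed
    have qi: "q integrable_on {x..y}" if "0 \<le> x" for x y
      by (rule integrable_continuous_real, rule continuous_on_subset[OF qc]) (use that in auto)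
    have incr: "\<psi> y - \<psi> x = integral {x..y} q" if "0 \<le> x" "x \<le> y" for x y
      using Henstock_Kurzweil_Integration.integral_combine[where a=0 and c=x and b=y and f=q] that qi[of 0 y] by (simp add: \<psi>_def)
    have incr_le: "integral {x..y} q \<le> (y - x) * B" if "0 \<le> x" "x \<le> y" "\<And>s. s \<in> {x..y} \<Longrightarrow> q s \<le> B" for x y B
    proof -
      have "integral {x..y} q \<le> integral {x..y} (\<lambda>_. B)"
        using that qi by (intro integral_le) auto
      then show ?thesis using that by simp
    qed
    have mono: "\<psi> x \<le> \<psi> y" if "0 \<le> x" "x \<le> y" for x y
    proof -
      have "0 \<le> integral {x..y} q" using that qn by (intro integral_nonneg qi) auto
      then show ?thesis using incr[OF that] by simp
    qed
    have nonneg: "0 \<le> \<psi> x" if "0 \<le> x" for x using mono[of 0 x] that by (simp add: \<psi>_def)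
    have half: "x * q x \<le> 2 * \<psi> x" if x: "0 < x" for x
    proof -
      have "((\<lambda>s. s * (q x / x)) has_integral ((x\<^sup>2 - 0\<^sup>2) / 2) * (q x / x)) {0..x}"
        using x by (intro has_integral_mult_left ident_has_integral) auto
      moreover have "(q has_integral \<psi> x) {0..x}" unfolding \<psi>_def using qi[of 0 x] by (intro integrable_integral) auto
      moreover have "s * (q x / x) \<le> q s" if "s \<in> {0..x}" for s
        using qs[of s x] that x by (simp add: divide_le_eq mult.commute)
      ultimately have "((x\<^sup>2 - 0\<^sup>2) / 2) * (q x / x) \<le> \<psi> x" by (rule has_integral_le)
      then show ?thesis using x by (simp add: power2_eq_square)
    qed
    show "\<exists>\<psi> L. (\<forall>x\<ge>0. 0 \<le> \<psi> x \<and> \<psi> x \<le> \<Phi> x) \<and> (\<forall>x\<ge>0. \<forall>y\<ge>x. \<psi> x \<le> \<psi> y) \<and>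
     (\<forall>x\<ge>0. x \<le> R \<longrightarrow> \<psi> x = \<Phi> x) \<and>
     (\<forall>\<epsilon>>0. \<forall>x\<ge>0. \<epsilon> \<le> 1 \<longrightarrow> \<psi> (x + \<epsilon>) - \<psi> x \<le> L) \<and>
     (\<forall>\<epsilon>>0. \<forall>x. 2 * \<epsilon> \<le> x \<longrightarrow> (\<psi> (x + \<epsilon>) - \<psi> x) * (1 + x) \<le> \<epsilon> * (8 * \<psi> x + 2 * p 1))"
    proof (intro exI[of _ \<psi>] exI[of _ "p R"] conjI allI impI)
      fix x :: real assume x: "0 \<le> x"
      show "0 \<le> \<psi> x" by (rule nonneg[OF x])
      have "(q has_integral \<psi> x) {0..x}" unfolding \<psi>_def using qi[of 0 x] by (intro integrable_integral) auto
      then show "\<psi> x \<le> \<Phi> x" using \<Phi>int[OF x] by (rule has_integral_le) (use qp in auto)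
      show "\<psi> x \<le> \<psi> y" if "x \<le> y" for y by (rule mono[OF x that])
      show "\<psi> x = \<Phi> x" if "x \<le> R"
      proof -
        have "\<psi> x = integral {0..x} p"
          unfolding \<psi>_def by (rule Henstock_Kurzweil_Integration.integral_cong) (use that in \<open>auto simp: q_def min_def\<close>)
        then show ?thesis using \<Phi>int[OF x] by (simp add: integral_unique)
      qed
      show "\<psi> (x + \<epsilon>) - \<psi> x \<le> p R" if "0 < \<epsilon>" "\<epsilon> \<le> 1" for \<epsilon>
      proof -
        have "\<psi> (x + \<epsilon>) - \<psi> x \<le> ((x + \<epsilon>) - x) * p R"
          unfolding incr[OF x less_imp_le[OF less_add_same_cancel1[THEN iffD2, OF that(1)]]]
          using x that by (intro incr_le qR) auto
        also have "\<dots> \<le> 1 * p R" using that pn[of R] R by (intro mult_right_mono) auto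
        finally show ?thesis by simp
      qed
    next
      fix \<epsilon> x :: real assume e: "0 < \<epsilon>" and x: "2 * \<epsilon> \<le> x"
      have x0: "0 < x" "0 \<le> x" using e x by auto
      have "\<psi> (x + \<epsilon>) - \<psi> x = integral {x..x + \<epsilon>} q" using x0 e by (intro incr) auto
      also have "\<dots> \<le> ((x + \<epsilon>) - x) * q (x + \<epsilon>)" using x0 e by (intro incr_le qm) auto
      finally have 1: "\<psi> (x + \<epsilon>) - \<psi> x \<le> \<epsilon> * q (x + \<epsilon>)" by simp
      have "x * q (x + \<epsilon>) \<le> (x + \<epsilon>) * q x" using x0 e by (intro qs) auto
      also have "\<dots> \<le> (x * 2) * q x" using x e qn[of x] by (intro mult_right_mono) auto
      finally have "x * q (x + \<epsilon>) \<le> x * (2 * q x)" by (simp add: mult.assoc)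
      then have 2: "q (x + \<epsilon>) \<le> 2 * q x" using x0 by simp
      have 3: "q x \<le> p 1 + x * q x"
      proof (cases "x \<le> 1")
        case True
        have "q x \<le> p 1" using qp[of x] pm[of x 1] x0 True by linarith
        then show ?thesis using x0 qn[of x] by (simp add: add_increasing2)
      next
        case False
        then have "1 * q x \<le> x * q x" using qn[of x] by (intro mult_right_mono) auto
        then show ?thesis using pn[of 1] by simp
      qed
      have "(\<psi> (x + \<epsilon>) - \<psi> x) * (1 + x) \<le> (\<epsilon> * (2 * q x)) * (1 + x)"
      proof (rule mult_right_mono)
        have "\<epsilon> * q (x + \<epsilon>) \<le> \<epsilon> * (2 * q x)" using 2 e by (intro mult_left_mono) auto
        then show "\<psi> (x + \<epsilon>) - \<psi> x \<le> \<epsilon> * (2 * q x)" using 1 by linarith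
      qed (use x0 in auto)
      also have "\<dots> = \<epsilon> * (2 * (q x + x * q x))" by (simp add: algebra_simps)
      also have "\<dots> \<le> \<epsilon> * (8 * \<psi> x + 2 * p 1)"
        using e 3 half[OF x0(1)] by (intro mult_left_mono) auto
      finally show "(\<psi> (x + \<epsilon>) - \<psi> x) * (1 + x) \<le> \<epsilon> * (8 * \<psi> x + 2 * p 1)" .
    qed
  qed
qed

lemma superlinear_weights_nonneg: "\<Phi> \<in> superlinear_weights \<Longrightarrow> 0 \<le> x \<Longrightarrow> 0 \<le> \<Phi> x"
  by (simp add: superlinear_weights_def)

lemma superlinear_weights_mono:
  assumes "\<Phi> \<in> superlinear_weights" "0 \<le> x" "x \<le> y"
  shows "\<Phi> x \<le> \<Phi> y"
proof -
  obtain Q where Q: "linear_truncations \<Phi> Q" using superlinear_truncation[OF assms(1)] by blast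
  obtain \<psi> L where \<psi>: "\<forall>x\<ge>0. 0 \<le> \<psi> x \<and> \<psi> x \<le> \<Phi> x" "\<forall>x\<ge>0. \<forall>y\<ge>x. \<psi> x \<le> \<psi> y"
     "\<forall>x\<ge>0. x \<le> max 1 y \<longrightarrow> \<psi> x = \<Phi> x"
     "\<forall>\<epsilon>>0. \<forall>x\<ge>0. \<epsilon> \<le> 1 \<longrightarrow> \<psi> (x + \<epsilon>) - \<psi> x \<le> L"
     "\<forall>\<epsilon>>0. \<forall>x. 2 * \<epsilon> \<le> x \<longrightarrow> (\<psi> (x + \<epsilon>) - \<psi> x) * (1 + x) \<le> \<epsilon> * (8 * \<psi> x + Q)"
    using Q[unfolded linear_truncations_def, rule_format, OF max.cobounded1[of 1 y]] by (elim exE conjE) (rule that)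
  have "\<psi> x \<le> \<psi> y" using \<psi>(2) assms by simp
  moreover have "\<psi> x = \<Phi> x" "\<psi> y = \<Phi> y" using \<psi>(3) assms by auto
  ultimately show ?thesis by simp
qed

lemma superlinear_weights_dominate:
  assumes "\<Phi> \<in> superlinear_weights"
  shows "\<exists>A\<ge>1. \<forall>x\<ge>A. k * x \<le> \<Phi> x"
proof -
  have "filterlim (\<lambda>x. \<Phi> x / x) at_top at_top" using assms by (simp add: superlinear_weights_def)
  then have "\<forall>\<^sub>F x in at_top. k \<le> \<Phi> x / x" by (simp add: filterlim_at_top)
  then obtain A where A: "\<And>x. A \<le> x \<Longrightarrow> k \<le> \<Phi> x / x" by (auto simp: eventually_at_top_linorder)
  have "k * x \<le> \<Phi> x" if "max 1 A \<le> x" for x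
    using A[of x] that by (simp add: le_divide_eq)
  then show ?thesis by (intro exI[of _ "max 1 A"]) auto
qed

context becker_doring
begin

text \<open>The first \<open>N\<close> terms see only sizes up to \<open>\<epsilon> (N + 2)\<close>; truncating there leaves them unchanged, while
  the bound for the truncated weight does not depend on where it is truncated.\<close>

lemma superlinear_moment_propagation:
  assumes \<Phi>: "\<Phi> \<in> superlinear_weights" and Q: "0 \<le> Q" "linear_truncations \<Phi> Q"
    and t: "t \<in> {0..T}" and eps1: "\<epsilon> \<le> 1"
    and M: "\<And>t. t \<in> {0..T} \<Longrightarrow> number t \<le> M"
    and D: "\<And>N. (\<Sum>k<N. \<epsilon> * \<Phi> (\<epsilon> * real (k + 2)) * c (k + 2) 0) \<le> D"
  shows "(\<Sum>k<N. \<epsilon> * \<Phi> (\<epsilon> * real (k + 2)) * c (k + 2) t)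
    \<le> (D + (\<Phi> 2 * (\<alpha> * m\<^sup>2) + Ka * m * (Q * M)) * t) * exp (Ka * m * 8 * t)"
proof -
  define R where "R = max 1 (\<epsilon> * real (N + 2))"
  have "1 \<le> R" by (simp add: R_def)
  obtain \<psi> L where \<psi>: "\<forall>x\<ge>0. 0 \<le> \<psi> x \<and> \<psi> x \<le> \<Phi> x" "\<forall>x\<ge>0. \<forall>y\<ge>x. \<psi> x \<le> \<psi> y"
     "\<forall>x\<ge>0. x \<le> R \<longrightarrow> \<psi> x = \<Phi> x"
     "\<forall>\<epsilon>>0. \<forall>x\<ge>0. \<epsilon> \<le> 1 \<longrightarrow> \<psi> (x + \<epsilon>) - \<psi> x \<le> L"
     "\<forall>\<epsilon>>0. \<forall>x. 2 * \<epsilon> \<le> x \<longrightarrow> (\<psi> (x + \<epsilon>) - \<psi> x) * (1 + x) \<le> \<epsilon> * (8 * \<psi> x + Q)"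
    using Q(2)[unfolded linear_truncations_def, rule_format, OF \<open>1 \<le> R\<close>] by (elim exE conjE) (rule that)
  have T: "0 \<le> T" "0 \<le> t" using t by auto
  define S where "S = mom (\<lambda>i. \<psi> (\<epsilon> * real i))"
  have nn: "0 \<le> \<epsilon> * \<psi> (\<epsilon> * real (k + 2)) * c (k + 2) s" if "0 \<le> s" for k s
    using eps \<psi>(1) c_nonneg[OF that, of "k + 2"] by (intro mult_nonneg_nonneg) auto
  have "0 \<le> L" using \<psi>(4)[rule_format, of \<epsilon> 0] \<psi>(2)[rule_format, of 0 "0 + \<epsilon>"] eps eps1 by simp
  have gi: "\<bar>\<psi> (\<epsilon> * real (i + 1)) - \<psi> (\<epsilon> * real i)\<bar> \<le> L" for i
  proof -
    have "\<psi> (\<epsilon> * real i + \<epsilon>) - \<psi> (\<epsilon> * real i) \<le> L" using \<psi>(4) eps eps1 by simp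
    moreover have "\<psi> (\<epsilon> * real i) \<le> \<psi> (\<epsilon> * real i + \<epsilon>)" using \<psi>(2) eps by simp
    ultimately show ?thesis by (simp add: distrib_left add.commute)
  qed
  have sS: "summable (\<lambda>k. \<epsilon> * \<psi> (\<epsilon> * real (k + 2)) * c (k + 2) s)" if "0 \<le> s" for s
    by (rule mom_summable[OF that, where B="\<bar>\<psi> (\<epsilon> * real 2)\<bar> + L" and g="\<lambda>i. \<psi> (\<epsilon> * real i)"],
        rule weight_growth[where g="\<lambda>i. \<psi> (\<epsilon> * real i)"]) (use gi \<open>0 \<le> L\<close> in auto)
  have S0: "S 0 \<le> D"
    unfolding S_def mom_def
  proof (rule suminf_le_const[OF sS])
    fix n
    have "(\<Sum>k<n. \<epsilon> * \<psi> (\<epsilon> * real (k + 2)) * c (k + 2) 0) \<le> (\<Sum>k<n. \<epsilon> * \<Phi> (\<epsilon> * real (k + 2)) * c (k + 2) 0)"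
    proof (intro sum_mono mult_right_mono mult_left_mono)
      fix k show "0 \<le> c (k + 2) 0" by (rule c_nonneg) auto
      show "\<psi> (\<epsilon> * real (k + 2)) \<le> \<Phi> (\<epsilon> * real (k + 2))" using \<psi>(1) eps by simp
    qed (use eps in auto)
    then show "(\<Sum>k<n. \<epsilon> * \<psi> (\<epsilon> * real (k + 2)) * c (k + 2) 0) \<le> D" using D[of n] by linarith
  qed simp
  have "(\<Sum>k<N. \<epsilon> * \<Phi> (\<epsilon> * real (k + 2)) * c (k + 2) t) = (\<Sum>k<N. \<epsilon> * \<psi> (\<epsilon> * real (k + 2)) * c (k + 2) t)"
  proof (rule sum.cong[OF refl])
    fix k assume "k \<in> {..<N}"
    then have "\<epsilon> * real (k + 2) \<le> \<epsilon> * real (N + 2)" using eps by (intro mult_left_mono) auto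
    then have "\<epsilon> * real (k + 2) \<le> R" by (simp add: R_def)
    then show "\<epsilon> * \<Phi> (\<epsilon> * real (k + 2)) * c (k + 2) t = \<epsilon> * \<psi> (\<epsilon> * real (k + 2)) * c (k + 2) t"
      using \<psi>(3) eps by simp
  qed
  also have "\<dots> \<le> S t"
    unfolding S_def mom_def by (intro sum_le_suminf sS T) (use nn T in auto)
  also have "\<dots> \<le> (S 0 + (\<Phi> 2 * (\<alpha> * m\<^sup>2) + Ka * m * (Q * M)) * t) * exp (Ka * m * 8 * t)"
    unfolding S_def
  proof (rule superlinear_moment_bound[OF T(1) t M])
    have "\<psi> (2 * \<epsilon>) \<le> \<psi> 2" using \<psi>(2) eps eps1 by simp
    moreover have "\<psi> 2 \<le> \<Phi> 2" using \<psi>(1) by simp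
    ultimately show "\<psi> (2 * \<epsilon>) \<le> \<Phi> 2" by linarith
    show "\<psi> (x + \<epsilon>) - \<psi> x \<le> L" if "0 \<le> x" for x using \<psi>(4) eps eps1 that by blast
    show "(\<psi> (x + \<epsilon>) - \<psi> x) * (1 + x) \<le> \<epsilon> * (8 * \<psi> x + Q)" if "2 * \<epsilon> \<le> x" for x using \<psi>(5) eps that by blast
  qed (use \<psi>(1,2) Q in auto)
  also have "\<dots> \<le> (D + (\<Phi> 2 * (\<alpha> * m\<^sup>2) + Ka * m * (Q * M)) * t) * exp (Ka * m * 8 * t)"
    using S0 by (intro mult_right_mono) auto
  finally show ?thesis .
qed

end

section \<open>Bounds that are uniform in the scale\<close>

text \<open>The data and hypotheses of the convergence theorem, before a sequence of scales is chosen.\<close>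

locale becker_doring_family =
  fixes \<eta> :: real
    and \<alpha>\<epsilon> \<beta>\<epsilon> m\<epsilon> :: "real \<Rightarrow> real"
    and a\<epsilon> b\<epsilon> :: "real \<Rightarrow> nat \<Rightarrow> real"
    and u :: "real \<Rightarrow> real \<Rightarrow> real"
    and c :: "real \<Rightarrow> nat \<Rightarrow> real \<Rightarrow> real"
    and \<alpha> \<beta> :: real
    and a b :: "real \<Rightarrow> real"
    and K_a K_b r_a r_b abar bbar \<rho> u_in :: real
    and \<mu>_in :: "real measure"
    and \<Phi> :: "real \<Rightarrow> real"
  assumes eta_nonneg: "\<eta> \<ge> 0"
    and pos_coeffs: "\<forall>\<epsilon>>0. \<alpha>\<epsilon> \<epsilon> > 0 \<and> \<beta>\<epsilon> \<epsilon> > 0 \<and> (\<forall>i\<ge>2. a\<epsilon> \<epsilon> i > 0) \<and> (\<forall>i\<ge>3. b\<epsilon> \<epsilon> i > 0)"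
    and increments: "\<forall>\<epsilon>>0. \<exists>K>0. (\<forall>i\<ge>2. a\<epsilon> \<epsilon> (i + 1) - a\<epsilon> \<epsilon> i \<le> K) \<and>
          (\<forall>i\<ge>3. b\<epsilon> \<epsilon> i - b\<epsilon> \<epsilon> (i + 1) \<le> K)"
    and solution: "\<forall>\<epsilon>>0. BD_solution \<eta> \<epsilon> (\<alpha>\<epsilon> \<epsilon>) (\<beta>\<epsilon> \<epsilon>) (a\<epsilon> \<epsilon>) (b\<epsilon> \<epsilon>) (u \<epsilon>) (c \<epsilon>)"
    and mass_balance: "\<forall>\<epsilon>>0. \<forall>t\<ge>0.
          ((\<lambda>i. \<epsilon>\<^sup>2 * real i * c \<epsilon> i t) has_sum (m\<epsilon> \<epsilon> - u \<epsilon> t)) {2..}"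
    and limits_pos: "\<alpha> > 0" "\<beta> > 0"
    and a_cont: "continuous_on {0..} a" "\<forall>x\<ge>0. a x \<ge> 0" "\<forall>x>0. a x > 0"
    and b_cont: "continuous_on {0..} b" "\<forall>x\<ge>0. b x \<ge> 0" "\<forall>x>0. b x > 0"
    and alpha_lim: "(\<alpha>\<epsilon> \<longlongrightarrow> \<alpha>) (at_right 0)"
    and beta_lim: "(\<beta>\<epsilon> \<longlongrightarrow> \<beta>) (at_right 0)"
    and a_lim: "\<forall>S. compact S \<and> S \<subseteq> {0..} \<longrightarrow>
          uniform_limit S (\<lambda>\<epsilon>. step_fun 2 \<epsilon> (a\<epsilon> \<epsilon>)) a (at_right 0)"
    and b_lim: "\<forall>S. compact S \<and> S \<subseteq> {0..} \<longrightarrow>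
          uniform_limit S (\<lambda>\<epsilon>. step_fun 3 \<epsilon> (b\<epsilon> \<epsilon>)) b (at_right 0)"
    and growth_pos: "K_a > 0" "K_b > 0"
    and a_growth: "\<forall>\<epsilon>>0. \<forall>x\<ge>0. step_fun 2 \<epsilon> (a\<epsilon> \<epsilon>) x \<le> K_a * (1 + x)"
    and b_growth: "\<forall>\<epsilon>>0. \<forall>x\<ge>0. step_fun 3 \<epsilon> (b\<epsilon> \<epsilon>) x \<le> K_b * (1 + x)"
    and exponents: "0 \<le> r_a" "r_a < 1" "r_b \<ge> r_a" "abar > 0" "bbar > 0"
    and a_equiv: "a \<sim>[at_right 0] (\<lambda>x. abar * x powr r_a)"
    and b_equiv: "b \<sim>[at_right 0] (\<lambda>x. bbar * x powr r_b)"
    and a_small: "\<forall>\<delta>>0. \<exists>h>0. \<forall>\<epsilon>>0. \<forall>i\<ge>2. \<epsilon> * real i < h \<longrightarrow>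
          \<bar>step_fun 2 \<epsilon> (a\<epsilon> \<epsilon>) (\<epsilon> * real i) - a (\<epsilon> * real i)\<bar> \<le> \<delta> * (\<epsilon> * real i) powr r_a"
    and b_small: "\<forall>\<delta>>0. \<exists>h>0. \<forall>\<epsilon>>0. \<forall>i\<ge>3. \<epsilon> * real i < h \<longrightarrow>
          \<bar>step_fun 3 \<epsilon> (b\<epsilon> \<epsilon>) (\<epsilon> * real i) - b (\<epsilon> * real i)\<bar> \<le> \<delta> * (\<epsilon> * real i) powr r_b"
    and rho: "((\<lambda>x. b x / a x) \<longlongrightarrow> \<rho>) (at_right 0)"
    and u_in: "u_in > \<rho>" "((\<lambda>\<epsilon>. u \<epsilon> 0) \<longlongrightarrow> u_in) (at_right 0)"
    and mu_in: "\<mu>_in \<in> M_f {0..}"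
      "wstar_tendsto (\<lambda>\<epsilon>. density_measure (step_fun 2 \<epsilon> (\<lambda>i. c \<epsilon> i 0))) \<mu>_in (at_right 0)"
    and weight: "\<Phi> \<in> superlinear_weights"
      "(SUP \<epsilon>\<in>{0<..}. \<integral>\<^sup>+x\<in>{0..}. ennreal (\<Phi> x * step_fun 2 \<epsilon> (\<lambda>i. c \<epsilon> i 0) x) \<partial>lborel) < \<infinity>"
    and exp_moments: "\<forall>z\<in>{0<..<1}.
          (SUP \<epsilon>\<in>{0<..}. \<Sum>\<^sub>\<infinity>i\<in>{2..}. ennreal (\<epsilon> powr r_a * c \<epsilon> i 0 * exp (- (real i * z)))) < \<infinity>"
    and eta: "\<eta> > r_a"
begin

abbreviation sample :: "real \<Rightarrow> (real \<Rightarrow> real) \<Rightarrow> nat \<Rightarrow> real \<Rightarrow> real" where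
  "sample \<epsilon> \<psi> k t \<equiv> \<epsilon> * \<psi> (\<epsilon> * real (k + 2)) * c \<epsilon> (k + 2) t"

text \<open>The integral of \<open>\<psi>\<close> against the atomic measure with mass \<open>\<epsilon> c\<^sub>i\<close> at \<open>\<epsilon> i\<close>. By \<open>integral_sampled\<close> it may
  replace the integral against the step density in every limit.\<close>

definition S :: "real \<Rightarrow> (real \<Rightarrow> real) \<Rightarrow> real \<Rightarrow> real" where
  "S \<epsilon> \<psi> t = (\<Sum>k. sample \<epsilon> \<psi> k t)"

abbreviation number :: "real \<Rightarrow> real \<Rightarrow> real" where
  "number \<epsilon> \<equiv> S \<epsilon> (\<lambda>_. 1)"

abbreviation \<nu> :: "real \<Rightarrow> real \<Rightarrow> real measure" where
  "\<nu> \<epsilon> t \<equiv> density_measure (step_fun 2 \<epsilon> (\<lambda>i. c \<epsilon> i t))"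

lemma system:
  assumes "0 < \<epsilon>"
  shows "becker_doring \<eta> \<epsilon> (\<alpha>\<epsilon> \<epsilon>) (\<beta>\<epsilon> \<epsilon>) (a\<epsilon> \<epsilon>) (b\<epsilon> \<epsilon>) (u \<epsilon>) (c \<epsilon>) (m\<epsilon> \<epsilon>) K_a K_b"
proof
  show "a\<epsilon> \<epsilon> i \<le> K_a * (1 + \<epsilon> * real i)" if "2 \<le> i" for i
    using a_growth[rule_format, of \<epsilon> "\<epsilon> * real i"] step_fun_centre[of \<epsilon> 2 i "a\<epsilon> \<epsilon>"] assms that by simp
  show "b\<epsilon> \<epsilon> i \<le> K_b * (1 + \<epsilon> * real i)" if "3 \<le> i" for i
    using b_growth[rule_format, of \<epsilon> "\<epsilon> * real i"] step_fun_centre[of \<epsilon> 3 i "b\<epsilon> \<epsilon>"] assms that by simp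
qed (use assms pos_coeffs solution mass_balance growth_pos in auto)

lemma S_eq_mom:
  assumes "0 < \<epsilon>"
  shows "S \<epsilon> \<psi> t = becker_doring.mom \<epsilon> (c \<epsilon>) (\<lambda>i. \<psi> (\<epsilon> * real i)) t"
proof -
  interpret B: becker_doring \<eta> \<epsilon> "\<alpha>\<epsilon> \<epsilon>" "\<beta>\<epsilon> \<epsilon>" "a\<epsilon> \<epsilon>" "b\<epsilon> \<epsilon>" "u \<epsilon>" "c \<epsilon>" "m\<epsilon> \<epsilon>" K_a K_b
    by (rule system[OF assms])
  show ?thesis by (simp add: S_def B.mom_def)
qed

lemma c_nonneg: "0 < \<epsilon> \<Longrightarrow> 0 \<le> t \<Longrightarrow> 2 \<le> i \<Longrightarrow> 0 \<le> c \<epsilon> i t"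
  using solution by (auto simp: BD_solution_def)

lemma S_summable:
  assumes e: "0 < \<epsilon>" and t: "0 \<le> t" and b: "\<And>x. 0 \<le> x \<Longrightarrow> \<bar>\<psi> x\<bar> \<le> B * (1 + x)"
  shows "summable (\<lambda>k. sample \<epsilon> \<psi> k t)"
proof -
  interpret B: becker_doring \<eta> \<epsilon> "\<alpha>\<epsilon> \<epsilon>" "\<beta>\<epsilon> \<epsilon>" "a\<epsilon> \<epsilon>" "b\<epsilon> \<epsilon>" "u \<epsilon>" "c \<epsilon>" "m\<epsilon> \<epsilon>" K_a K_b
    by (rule system[OF e])
  have B: "0 \<le> B" using b[of 0] by simp
  show ?thesis
  proof (rule B.mom_summable[OF t, where g="\<lambda>i. \<psi> (\<epsilon> * real i)" and B="B * (1 + \<epsilon>)"])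
    fix i :: nat assume i: "2 \<le> i"
    have "\<bar>\<psi> (\<epsilon> * real i)\<bar> \<le> B * (1 + \<epsilon> * real i)" using e by (intro b) simp
    also have "\<dots> \<le> B * (real i + \<epsilon> * real i)" using B i by (intro mult_left_mono) auto
    finally show "\<bar>\<psi> (\<epsilon> * real i)\<bar> \<le> B * (1 + \<epsilon>) * real i" by (simp add: algebra_simps)
  qed
qed

lemma S_summable_bounded:
  assumes e: "0 < \<epsilon>" and t: "0 \<le> t" and b: "\<And>x. 0 \<le> x \<Longrightarrow> \<bar>\<psi> x\<bar> \<le> B"
  shows "summable (\<lambda>k. sample \<epsilon> \<psi> k t)"
proof (rule S_summable[OF e t, where B=B])
  fix x :: real assume x: "0 \<le> x"
  have "0 \<le> B" using b[of 0] by simp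
  then have "B * 1 \<le> B * (1 + x)" using x by (intro mult_left_mono) auto
  then show "\<bar>\<psi> x\<bar> \<le> B * (1 + x)" using b[OF x] by simp
qed

lemma number_nonneg: "0 < \<epsilon> \<Longrightarrow> 0 \<le> t \<Longrightarrow> 0 \<le> number \<epsilon> t"
  unfolding S_def by (rule suminf_nonneg[OF S_summable_bounded[where B=1]]) (auto simp: c_nonneg)

lemma S_abs_le:
  assumes e: "0 < \<epsilon>" and t: "0 \<le> t" and b: "\<And>x. 0 \<le> x \<Longrightarrow> \<bar>\<psi> x\<bar> \<le> B"
  shows "\<bar>S \<epsilon> \<psi> t\<bar> \<le> B * number \<epsilon> t"
proof -
  have s1: "summable (\<lambda>k. \<epsilon> * 1 * c \<epsilon> (k + 2) t)" by (rule S_summable_bounded[OF e t, where B=1]) simp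
  have "norm (sample \<epsilon> \<psi> k t) \<le> B * (\<epsilon> * 1 * c \<epsilon> (k + 2) t)" for k
  proof -
    have "\<bar>\<psi> (\<epsilon> * real (k + 2))\<bar> * (\<epsilon> * c \<epsilon> (k + 2) t) \<le> B * (\<epsilon> * c \<epsilon> (k + 2) t)"
      using e c_nonneg[OF e t, of "k + 2"] by (intro mult_right_mono b) auto
    then show ?thesis using e c_nonneg[OF e t, of "k + 2"] by (simp add: abs_mult mult_ac)
  qed
  from norm_suminf_le[OF this summable_mult[OF s1]] show ?thesis
    unfolding S_def suminf_mult[OF s1] by simp
qed

lemma S_diff:
  assumes e: "0 < \<epsilon>" and t: "0 \<le> t"
    and b: "\<And>x. 0 \<le> x \<Longrightarrow> \<bar>\<psi> x\<bar> \<le> B * (1 + x)" "\<And>x. 0 \<le> x \<Longrightarrow> \<bar>\<xi> x\<bar> \<le> B' * (1 + x)"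
  shows "S \<epsilon> \<psi> t - S \<epsilon> \<xi> t = S \<epsilon> (\<lambda>x. \<psi> x - \<xi> x) t"
proof -
  have "S \<epsilon> \<psi> t - S \<epsilon> \<xi> t = (\<Sum>k. sample \<epsilon> \<psi> k t - sample \<epsilon> \<xi> k t)"
    unfolding S_def by (rule suminf_diff[OF S_summable[OF e t b(1)] S_summable[OF e t b(2)]])
  then show ?thesis by (simp only: S_def left_diff_distrib right_diff_distrib)
qed

lemma mass_moment: "0 < \<epsilon> \<Longrightarrow> 0 \<le> t \<Longrightarrow> S \<epsilon> (\<lambda>x. x) t = m\<epsilon> \<epsilon> - u \<epsilon> t"
  using sums_unique[OF becker_doring.mass_sums[OF system]] by (simp add: S_def)

lemma integral_sampled:
  assumes e: "0 < \<epsilon>" and t: "0 \<le> t" and \<phi>: "\<phi> \<in> C_c {0..}"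
    and w: "\<And>x y. 0 \<le> x \<Longrightarrow> 0 \<le> y \<Longrightarrow> \<bar>x - y\<bar> \<le> \<epsilon> \<Longrightarrow> \<bar>\<phi> x - \<phi> y\<bar> \<le> w"
  shows "\<bar>(\<integral>x. \<phi> x \<partial>\<nu> \<epsilon> t) - S \<epsilon> \<phi> t\<bar> \<le> w * number \<epsilon> t"
proof -
  obtain B where B: "0 < B" "\<And>x. 0 \<le> x \<Longrightarrow> \<bar>\<phi> x\<bar> \<le> B" using C_c_bounded[OF \<phi>] by blast
  have s1: "summable (\<lambda>k. c \<epsilon> (k + 2) t)"
    using S_summable_bounded[OF e t, where \<psi>="\<lambda>_. 1" and B=1] e by simp
  have m: "(\<lambda>x. \<phi> (max 0 x)) \<in> borel_measurable borel"
    using continuous_on_compose_max[OF C_c_continuous[OF \<phi>]] by (rule borel_measurable_continuous_onI)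
  have "\<bar>(\<integral>x. \<phi> (max 0 x) \<partial>\<nu> \<epsilon> t) - (\<Sum>j. \<epsilon> * \<phi> (max 0 (\<epsilon> * real (j + 2))) * c \<epsilon> (j + 2) t)\<bar>
        \<le> w * (\<Sum>j. \<epsilon> * c \<epsilon> (j + 2) t)"
  proof (rule integral_step_measure_sampled[OF e _ _ s1 m])
    have "\<bar>c \<epsilon> (j + 2) t * \<bar>\<phi> (max 0 (\<epsilon> * real (j + 2)))\<bar>\<bar> \<le> B * c \<epsilon> (j + 2) t" for j
      using B(2)[of "max 0 (\<epsilon> * real (j + 2))"] c_nonneg[OF e t, of "j + 2"]
      by (simp add: abs_mult mult.commute[of B] mult_left_mono)
    then show "summable (\<lambda>j. c \<epsilon> (j + 2) t * \<bar>\<phi> (max 0 (\<epsilon> * real (j + 2)))\<bar>)"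
      by (intro summable_comparison_test'[OF summable_mult[OF s1, of B], where N=0]) simp
    fix i x assume i: "2 \<le> (i :: nat)" "x \<in> cell \<epsilon> i"
    have "0 \<le> x" using cell_subset[of \<epsilon> i] e i by auto
    moreover have "\<bar>x - \<epsilon> * real i\<bar> \<le> \<epsilon>" using i(2) e by (auto simp: cell_def algebra_simps abs_le_iff)
    ultimately show "\<bar>\<phi> (max 0 x) - \<phi> (max 0 (\<epsilon> * real i))\<bar> \<le> w"
      using e w[of x "\<epsilon> * real i"] by simp
  qed (use c_nonneg[OF e t] in auto)
  moreover have "max 0 (\<epsilon> * real (j + 2)) = \<epsilon> * real (j + 2)" for j using e by simp
  ultimately show ?thesis
    unfolding S_def by (subst integral_density_measure_max) (simp only: mult_1_right)
qed

lemma integral_sampled_small: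
  assumes \<phi>: "\<phi> \<in> C_c {0..}" and d: "0 < \<delta>"
  shows "\<exists>d>0. \<forall>\<epsilon>>0. \<forall>t\<ge>0. \<epsilon> \<le> d \<longrightarrow> \<bar>(\<integral>x. \<phi> x \<partial>\<nu> \<epsilon> t) - S \<epsilon> \<phi> t\<bar> \<le> \<delta> * number \<epsilon> t"
proof -
  obtain d where "0 < d" "\<forall>x\<ge>0. \<forall>y\<ge>0. \<bar>x - y\<bar> \<le> d \<longrightarrow> \<bar>\<phi> x - \<phi> y\<bar> \<le> \<delta>"
    using C_c_uniformly_continuous[OF \<phi> d] by blast
  then show ?thesis by (intro exI[of _ d]) (auto intro!: integral_sampled[OF _ _ \<phi>])
qed

lemma initial_weight_bound:
  "\<exists>D. \<forall>\<epsilon>>0. \<forall>N. (\<Sum>k<N. sample \<epsilon> \<Phi> k 0) \<le> D"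
proof -
  define W where "W = (SUP \<epsilon>\<in>{0<..}. \<integral>\<^sup>+x\<in>{0..}. ennreal (\<Phi> x * step_fun 2 \<epsilon> (\<lambda>i. c \<epsilon> i 0) x) \<partial>lborel)"
  have "W < \<infinity>" using weight(2) by (simp add: W_def)
  then obtain w where w: "0 \<le> w" "W = ennreal w" by (cases W) auto
  have "(\<Sum>k<N. sample \<epsilon> \<Phi> k 0) \<le> 2 * w" if e: "0 < \<epsilon>" for \<epsilon> N
  proof -
    have "ennreal (\<Sum>k<N. sample \<epsilon> \<Phi> k 0)
        \<le> 2 * (\<integral>\<^sup>+x\<in>{0..}. ennreal (\<Phi> x * step_fun 2 \<epsilon> (\<lambda>i. c \<epsilon> i 0) x) \<partial>lborel)"
      by (rule sampled_sum_le_nn_integral[OF e])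
         (use c_nonneg[OF e] superlinear_weights_mono[OF weight(1)] superlinear_weights_nonneg[OF weight(1)] in auto)
    also have "\<dots> \<le> 2 * W"
      unfolding W_def using e by (intro mult_left_mono SUP_upper) auto
    also have "\<dots> = ennreal (2 * w)" using w by (simp add: ennreal_mult)
    finally show ?thesis using w by (simp add: ennreal_le_iff)
  qed
  then show ?thesis by blast
qed

lemma initial_exp_bound:
  assumes z: "0 < z" "z < 1"
  shows "\<exists>G. \<forall>\<epsilon>>0. \<epsilon> powr r_a * (\<Sum>k. exp (- (real (k + 2) * z)) * c \<epsilon> (k + 2) 0) \<le> G"
proof -
  define F where "F \<epsilon> i = ennreal (\<epsilon> powr r_a * c \<epsilon> i 0 * exp (- (real i * z)))" for \<epsilon> and i :: nat
  define W where "W = (SUP \<epsilon>\<in>{0<..}. \<Sum>\<^sub>\<infinity>i\<in>{2..}. F \<epsilon> i)"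
  have "W < \<infinity>" using exp_moments[rule_format, of z] z by (simp add: W_def F_def)
  then obtain w where w: "0 \<le> w" "W = ennreal w" by (cases W) auto
  have "\<epsilon> powr r_a * (\<Sum>k. exp (- (real (k + 2) * z)) * c \<epsilon> (k + 2) 0) \<le> w" if e: "0 < \<epsilon>" for \<epsilon>
  proof -
    define f where "f k = \<epsilon> powr r_a * (exp (- (real (k + 2) * z)) * c \<epsilon> (k + 2) 0)" for k
    have f0: "0 \<le> f k" for k unfolding f_def using c_nonneg[OF e, of 0 "k + 2"] by simp
    have part: "(\<Sum>k<N. f k) \<le> w" for N
    proof -
      have "ennreal (\<Sum>k<N. f k) = (\<Sum>k<N. ennreal (f k))" using f0 by (simp add: sum_ennreal)
      also have "\<dots> = (\<Sum>k<N. F \<epsilon> (k + 2))" by (simp add: f_def F_def mult_ac)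
      also have "\<dots> = (\<Sum>i\<in>(\<lambda>k. k + 2) ` {..<N}. F \<epsilon> i)" by (subst sum.reindex) (auto simp: inj_on_def)
      also have "\<dots> = (\<Sum>\<^sub>\<infinity>i\<in>(\<lambda>k. k + 2) ` {..<N}. F \<epsilon> i)" by simp
      also have "\<dots> \<le> (\<Sum>\<^sub>\<infinity>i\<in>{2..}. F \<epsilon> i)"
        by (rule infsum_mono_neutral) (auto intro: nonneg_summable_on_complete)
      also have "\<dots> \<le> W" unfolding W_def using e by (intro SUP_upper) auto
      finally show ?thesis using w by simp
    qed
    have sf: "summable f" by (rule summableI_nonneg_bounded[OF f0 part])
    have "(\<Sum>k. f k) \<le> w" by (rule suminf_le_const[OF sf part])
    moreover have "summable (\<lambda>k. exp (- (real (k + 2) * z)) * c \<epsilon> (k + 2) 0)"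
      using sf e unfolding f_def by simp
    from suminf_mult[OF this, of "\<epsilon> powr r_a"]
    have "(\<Sum>k. f k) = \<epsilon> powr r_a * (\<Sum>k. exp (- (real (k + 2) * z)) * c \<epsilon> (k + 2) 0)"
      unfolding f_def .
    ultimately show ?thesis by simp
  qed
  then show ?thesis by blast
qed

text \<open>Near the origin the number of clusters is controlled by the weak-* convergence, tested with a bump, and
  elsewhere by the superlinear weight. Passing from integrals to sampled sums costs at most half the
  number itself, which is absorbed.\<close>

lemma initial_number_bound: "\<exists>C. \<forall>\<^sub>F \<epsilon> in at_right 0. number \<epsilon> 0 \<le> C \<and> m\<epsilon> \<epsilon> \<le> C"
proof -
  obtain D where D: "\<And>\<epsilon> N. 0 < \<epsilon> \<Longrightarrow> (\<Sum>k<N. sample \<epsilon> \<Phi> k 0) \<le> D"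
    using initial_weight_bound by blast
  obtain A where A: "1 \<le> A" "\<And>x. A \<le> x \<Longrightarrow> x \<le> \<Phi> x"
    using superlinear_weights_dominate[OF weight(1), of 1] by auto
  define \<phi> where "\<phi> x = max 0 (min 1 (A + 1 - x))" for x :: real
  have \<phi>: "\<phi> \<in> C_c {0..}"
    by (rule C_c_intro[where X="A + 1"]) (auto simp: \<phi>_def intro!: continuous_intros)
  have \<phi>1: "\<bar>\<phi> x\<bar> \<le> 1" for x by (auto simp: \<phi>_def)
  have \<Phi>n: "0 \<le> \<Phi> x" if "0 \<le> x" for x using superlinear_weights_nonneg[OF weight(1) that] .
  have one: "1 \<le> \<phi> x + \<Phi> x" if "0 \<le> x" for x
    using A(1) A(2)[of x] \<Phi>n[OF that] by (cases "x \<le> A") (auto simp: \<phi>_def)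
  have idle: "x \<le> A * 1 + \<Phi> x" if "0 \<le> x" for x
    using A(1) A(2)[of x] \<Phi>n[OF that] by (cases "x \<le> A") auto
  have dom: "S \<epsilon> \<psi> 0 \<le> k * S \<epsilon> \<xi> 0 + D"
    if e: "0 < \<epsilon>" and k: "\<And>x. 0 \<le> x \<Longrightarrow> \<psi> x \<le> k * \<xi> x + \<Phi> x" and kn: "0 \<le> k" "\<And>x. 0 \<le> x \<Longrightarrow> 0 \<le> \<xi> x"
      and b: "\<And>x. 0 \<le> x \<Longrightarrow> \<bar>\<psi> x\<bar> \<le> 1 * (1 + x)" "\<And>x. 0 \<le> x \<Longrightarrow> \<bar>\<xi> x\<bar> \<le> 1 * (1 + x)" for \<epsilon> k \<psi> \<xi>
    unfolding S_def
  proof (rule suminf_le_const[OF S_summable[OF e order_refl b(1)]])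
    fix N
    have "(\<Sum>i<N. sample \<epsilon> \<psi> i 0)
       \<le> (\<Sum>i<N. \<epsilon> * (k * \<xi> (\<epsilon> * real (i + 2)) + \<Phi> (\<epsilon> * real (i + 2))) * c \<epsilon> (i + 2) 0)"
    proof (intro sum_mono mult_right_mono mult_left_mono)
      fix i show "0 \<le> c \<epsilon> (i + 2) 0" by (rule c_nonneg[OF e]) auto
      show "\<psi> (\<epsilon> * real (i + 2)) \<le> k * \<xi> (\<epsilon> * real (i + 2)) + \<Phi> (\<epsilon> * real (i + 2))" by (rule k) (use e in simp)
    qed (use e in auto)
    also have "\<dots> = k * (\<Sum>i<N. sample \<epsilon> \<xi> i 0) + (\<Sum>i<N. sample \<epsilon> \<Phi> i 0)"
      unfolding sum_distrib_left sum.distrib[symmetric] by (intro sum.cong refl) algebra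
    also have "\<dots> \<le> k * (\<Sum>i. sample \<epsilon> \<xi> i 0) + D"
    proof (intro add_mono mult_left_mono D[OF e] kn sum_le_suminf S_summable[OF e order_refl b(2)])
      fix n show "0 \<le> sample \<epsilon> \<xi> n 0"
        using e c_nonneg[OF e, of 0 "n + 2"] by (intro mult_nonneg_nonneg kn) auto
    qed auto
    finally show "(\<Sum>i<N. sample \<epsilon> \<psi> i 0)
       \<le> k * (\<Sum>k. sample \<epsilon> \<xi> k 0) + D" .
  qed
  obtain d where d: "0 < d" "\<And>\<epsilon> t. 0 < \<epsilon> \<Longrightarrow> 0 \<le> t \<Longrightarrow> \<epsilon> \<le> d \<Longrightarrow>
      \<bar>(\<integral>x. \<phi> x \<partial>\<nu> \<epsilon> t) - S \<epsilon> \<phi> t\<bar> \<le> 1/2 * number \<epsilon> t"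
    using integral_sampled_small[OF \<phi>, of "1/2"] by auto
  define I where "I = (\<integral>x. \<phi> x \<partial>\<mu>_in) + 1"
  have "((\<lambda>\<epsilon>. \<integral>x. \<phi> x \<partial>\<nu> \<epsilon> 0) \<longlongrightarrow> (\<integral>x. \<phi> x \<partial>\<mu>_in)) (at_right 0)"
    using mu_in(2) \<phi> by (simp add: wstar_tendsto_def)
  then have ev1: "\<forall>\<^sub>F \<epsilon> in at_right 0. (\<integral>x. \<phi> x \<partial>\<nu> \<epsilon> 0) < I"
    by (rule order_tendstoD) (simp add: I_def)
  have ev2: "\<forall>\<^sub>F \<epsilon> in at_right 0. u \<epsilon> 0 < u_in + 1"
    by (rule order_tendstoD[OF u_in(2)]) simp
  have ev3: "\<forall>\<^sub>F \<epsilon> in at_right 0. \<epsilon> \<in> {0<..<d}"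
    using d(1) by (rule eventually_at_right_real)
  define C where "C = 2 * (I + D)"
  have "\<forall>\<^sub>F \<epsilon> in at_right 0. number \<epsilon> 0 \<le> C \<and> m\<epsilon> \<epsilon> \<le> (u_in + 1) + (A * C + D)"
    using ev1 ev2 ev3
  proof eventually_elim
    case (elim \<epsilon>)
    then have e: "0 < \<epsilon>" "\<epsilon> \<le> d" by auto
    have "number \<epsilon> 0 \<le> 1 * S \<epsilon> \<phi> 0 + D"
    proof (rule dom[OF e(1)])
      fix x :: real assume x: "0 \<le> x"
      show "\<bar>\<phi> x\<bar> \<le> 1 * (1 + x)" using \<phi>1[of x] x by simp
    qed (use one in \<open>auto simp: \<phi>_def\<close>)
    moreover have "S \<epsilon> \<phi> 0 \<le> I + 1/2 * number \<epsilon> 0" using d(2)[OF e(1) order_refl e(2)] elim(1) by linarith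
    ultimately have n: "number \<epsilon> 0 \<le> C" by (simp add: C_def)
    have "S \<epsilon> (\<lambda>x. x) 0 \<le> A * number \<epsilon> 0 + D"
      by (rule dom[OF e(1)]) (use idle A in auto)
    also have "\<dots> \<le> A * C + D" using n A by (intro add_right_mono mult_left_mono) auto
    finally have "m\<epsilon> \<epsilon> \<le> (u_in + 1) + (A * C + D)"
      using mass_moment[OF e(1) order_refl] elim(2) by linarith
    then show ?case using n by simp
  qed
  then have "\<forall>\<^sub>F \<epsilon> in at_right 0. number \<epsilon> 0 \<le> max C ((u_in + 1) + (A * C + D)) \<and> m\<epsilon> \<epsilon> \<le> max C ((u_in + 1) + (A * C + D))"
    by (rule eventually_mono) auto
  then show ?thesis by blast
qed

lemma rho_nonneg: "0 \<le> \<rho>"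
proof (rule tendsto_lowerbound[OF rho])
  show "\<forall>\<^sub>F x in at_right 0. 0 \<le> b x / a x"
    unfolding eventually_at_right_field using a_cont(2) b_cont(2) by (intro exI[of _ 1]) auto
qed simp

text \<open>Near the origin \<open>b \<le> (\<rho> + \<tau>) a\<close>, and \<open>z\<close> is chosen so that \<open>e\<^sup>z (\<rho> + \<tau>) \<le> \<rho> + \<delta>\<close>. For \<open>v \<ge> \<rho> + 2 \<delta>\<close> this leaves
  \<open>\<delta> a\<close>, which is at least \<open>\<delta> abar x\<^sup>r / 2\<close>; half of it pays for replacing the discrete rates by \<open>a\<close> and \<open>b\<close>.\<close>

lemma coercivity:
  assumes \<delta>: "0 < \<delta>"
  shows "\<exists>z \<kappa> h. 0 < z \<and> z < 1 \<and> 0 < \<kappa> \<and> 0 < h \<and>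
    (\<forall>\<epsilon>>0. \<forall>i\<ge>2. \<forall>v\<ge>\<rho> + 2 * \<delta>. \<epsilon> * real i < h \<longrightarrow>
      \<kappa> * (\<epsilon> * real i) powr r_a \<le> a\<epsilon> \<epsilon> i * v - exp z * (if i < 3 then 0 else b\<epsilon> \<epsilon> i))"
proof -
  define \<tau> where "\<tau> = \<delta> / 2"
  define z where "z = min (1/2) (ln ((\<rho> + \<delta>) / (\<rho> + \<tau>)))"
  have \<rho>: "0 \<le> \<rho>" by (rule rho_nonneg)
  have q: "1 < (\<rho> + \<delta>) / (\<rho> + \<tau>)" using \<rho> \<delta> by (simp add: \<tau>_def less_divide_eq)
  have z: "0 < z" "z < 1" using q by (auto simp: z_def ln_gt_zero)
  have "exp z \<le> exp (ln ((\<rho> + \<delta>) / (\<rho> + \<tau>)))" by (simp add: z_def)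
  also have "\<dots> = (\<rho> + \<delta>) / (\<rho> + \<tau>)" using q by simp
  finally have ez: "exp z * (\<rho> + \<tau>) \<le> \<rho> + \<delta>" using \<rho> \<delta> by (simp add: \<tau>_def le_divide_eq)
  have ez3: "exp z \<le> 3" using exp_le z(2) order_trans[of "exp z" "exp 1" 3] by simp
  have ev1: "\<forall>\<^sub>F x in at_right 0. b x / a x < \<rho> + \<tau>"
    by (rule order_tendstoD[OF rho]) (use \<delta> in \<open>simp add: \<tau>_def\<close>)
  have ev2: "\<forall>\<^sub>F x in at_right 0. 1/2 < (if a x = 0 \<and> abar * x powr r_a = 0 then 1 else a x / (abar * x powr r_a))"
    using order_tendstoD(1)[OF a_equiv[unfolded asymp_equiv_def], of "1/2"] by simp
  obtain h3 where h3: "0 < h3" "\<forall>x>0. x < h3 \<longrightarrow> b x / a x < \<rho> + \<tau>"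
    using ev1 unfolding eventually_at_right_field by blast
  obtain h4 where h4: "0 < h4" "\<forall>x>0. x < h4 \<longrightarrow> 1/2 < (if a x = 0 \<and> abar * x powr r_a = 0 then 1 else a x / (abar * x powr r_a))"
    using ev2 unfolding eventually_at_right_field by blast
  define \<theta> where "\<theta> = \<delta> * abar / (4 * (\<rho> + 2 * \<delta> + 3))"
  have den: "0 < \<rho> + 2 * \<delta> + 3" using \<rho> \<delta> by simp
  have \<theta>: "0 < \<theta>" using den \<delta> exponents by (simp add: \<theta>_def)
  obtain h1 where h1: "0 < h1" "\<forall>\<epsilon>>0. \<forall>i\<ge>2. \<epsilon> * real i < h1 \<longrightarrow>
      \<bar>step_fun 2 \<epsilon> (a\<epsilon> \<epsilon>) (\<epsilon> * real i) - a (\<epsilon> * real i)\<bar> \<le> \<theta> * (\<epsilon> * real i) powr r_a"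
    using a_small[rule_format, OF \<theta>] by (elim exE conjE) (rule that)
  obtain h2 where h2: "0 < h2" "\<forall>\<epsilon>>0. \<forall>i\<ge>3. \<epsilon> * real i < h2 \<longrightarrow>
      \<bar>step_fun 3 \<epsilon> (b\<epsilon> \<epsilon>) (\<epsilon> * real i) - b (\<epsilon> * real i)\<bar> \<le> \<theta> * (\<epsilon> * real i) powr r_b"
    using b_small[rule_format, OF \<theta>] by (elim exE conjE) (rule that)
  define h where "h = min 1 (min (min h3 h4) (min h1 h2))"
  have "0 < h" using h3(1) h4(1) h1(1) h2(1) by (simp add: h_def)
  moreover have "0 < \<delta> * abar / 4" using \<delta> exponents by simp
  moreover have "\<delta> * abar / 4 * (\<epsilon> * real i) powr r_a \<le> a\<epsilon> \<epsilon> i * v - exp z * (if i < 3 then 0 else b\<epsilon> \<epsilon> i)"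
    if e: "0 < \<epsilon>" and i: "2 \<le> i" and v: "\<rho> + 2 * \<delta> \<le> v" and xh: "\<epsilon> * real i < h" for \<epsilon> i v
  proof -
    define x where "x = \<epsilon> * real i"
    have x: "0 < x" "x < 1" "x < h3" "x < h4" "x < h1" "x < h2" using e i xh by (auto simp: x_def h_def)
    define y where "y = x powr r_a"
    have y: "0 < y" using x by (simp add: y_def)
    have ax: "0 < a x" using a_cont(3) x by simp
    have h0x: "b x / a x < \<rho> + \<tau>"
      "1/2 < (if a x = 0 \<and> abar * x powr r_a = 0 then 1 else a x / (abar * x powr r_a))"
      using h3(2) h4(2) x by simp_all
    have "1/2 < a x / (abar * y)" using h0x(2) ax by (simp add: y_def)
    then have a1: "abar * y / 2 \<le> a x" using y exponents by (simp add: less_divide_eq)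
    have a2: "a x - \<theta> * y \<le> a\<epsilon> \<epsilon> i"
      using h1(2)[rule_format, OF e i] x step_fun_centre[of \<epsilon> 2 i "a\<epsilon> \<epsilon>"] e i by (simp add: x_def y_def abs_le_iff)
    have b1: "b x \<le> (\<rho> + \<tau>) * a x" using h0x(1) ax by (simp add: divide_less_eq)
    have b2: "(if i < 3 then 0 else b\<epsilon> \<epsilon> i) \<le> b x + \<theta> * y"
    proof (cases "i < 3")
      case True
      have "0 \<le> b x" using b_cont(2) x by simp
      then show ?thesis using True \<theta> y by simp
    next
      case False
      then have "b\<epsilon> \<epsilon> i \<le> b x + \<theta> * x powr r_b"
        using h2(2)[rule_format, OF e, of i] x step_fun_centre[of \<epsilon> 3 i "b\<epsilon> \<epsilon>"] e by (simp add: x_def abs_le_iff)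
      also have "\<dots> \<le> b x + \<theta> * y"
        unfolding y_def using x exponents \<theta> by (intro add_left_mono mult_left_mono powr_mono') auto
      finally show ?thesis using False by simp
    qed
    have "exp z * (if i < 3 then 0 else b\<epsilon> \<epsilon> i) \<le> exp z * (b x + \<theta> * y)"
      using b2 by (intro mult_left_mono) auto
    also have "\<dots> = exp z * b x + exp z * (\<theta> * y)" by (simp add: distrib_left)
    also have "\<dots> \<le> exp z * ((\<rho> + \<tau>) * a x) + 3 * (\<theta> * y)"
      using b1 ez3 \<theta> y by (intro add_mono mult_left_mono mult_right_mono) auto
    also have "exp z * ((\<rho> + \<tau>) * a x) \<le> (\<rho> + \<delta>) * a x"
      using mult_right_mono[OF ez, of "a x"] ax by (simp add: mult.assoc)
    finally have B: "exp z * (if i < 3 then 0 else b\<epsilon> \<epsilon> i) \<le> (\<rho> + \<delta>) * a x + 3 * (\<theta> * y)" by simp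
    have "(a x - \<theta> * y) * (\<rho> + 2 * \<delta>) \<le> a\<epsilon> \<epsilon> i * (\<rho> + 2 * \<delta>)"
      using a2 \<rho> \<delta> by (intro mult_right_mono) auto
    also have "\<dots> \<le> a\<epsilon> \<epsilon> i * v" using v pos_coeffs e i by (intro mult_left_mono) (auto simp: less_imp_le)
    finally have A: "(a x - \<theta> * y) * (\<rho> + 2 * \<delta>) \<le> a\<epsilon> \<epsilon> i * v" .
    have "\<theta> * (\<rho> + 2 * \<delta> + 3) = \<delta> * abar / 4"
      unfolding \<theta>_def using den by (simp del: distrib_left_numeral)
    then have "\<theta> * (\<rho> + 2 * \<delta> + 3) * y = \<delta> * abar / 4 * y" by (simp only:)
    moreover have "\<delta> * (abar * y / 2) \<le> \<delta> * a x" using a1 \<delta> by (intro mult_left_mono) auto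
    moreover have "(a x - \<theta> * y) * (\<rho> + 2 * \<delta>) - ((\<rho> + \<delta>) * a x + 3 * (\<theta> * y)) = \<delta> * a x - \<theta> * (\<rho> + 2 * \<delta> + 3) * y"
      by algebra
    moreover have "\<delta> * (abar * y / 2) = 2 * (\<delta> * abar / 4 * y)" by simp
    ultimately show ?thesis using A B unfolding x_def[symmetric] y_def[symmetric] by linarith
  qed
  ultimately show ?thesis using z by blast
qed

text \<open>A single constant \<open>C\<close> serves for all quantities, which keeps the later statements short.\<close>

definition bounds :: "real \<Rightarrow> real \<Rightarrow> real \<Rightarrow> real \<Rightarrow> bool" where
  "bounds T \<delta> C \<epsilon> \<longleftrightarrow> 0 < \<epsilon> \<and> \<epsilon> \<le> 1 \<and> m\<epsilon> \<epsilon> \<le> C \<and> \<alpha>\<epsilon> \<epsilon> \<le> C \<and> \<beta>\<epsilon> \<epsilon> \<le> C \<and>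
    (\<forall>t\<in>{0..T}. \<rho> + \<delta> \<le> u \<epsilon> t \<and> number \<epsilon> t \<le> C \<and> \<epsilon> powr r_a * c \<epsilon> 2 t \<le> C \<and>
      (\<forall>N. (\<Sum>k<N. sample \<epsilon> \<Phi> k t) \<le> C)) \<and>
    (\<forall>s\<in>{0..T}. \<forall>t\<in>{0..T}. \<bar>u \<epsilon> t - u \<epsilon> s\<bar> \<le> C * \<bar>t - s\<bar>)"

text \<open>The bounds on number, mass and the Lipschitz constant of \<open>u\<close> hold up to time 1 whatever \<open>u\<close> does. They
  fix a time \<open>T\<close> up to which \<open>u\<close> cannot fall from \<open>u_in > \<rho>\<close> to \<open>\<rho>\<close>, and only on \<open>[0, T]\<close> is the drift at the
  origin positive and the small clusters controlled.\<close>

lemma uniform_bounds: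
  "\<exists>T \<delta> C. 0 < T \<and> 0 < \<delta> \<and> 0 < C \<and> (\<forall>\<^sub>F \<epsilon> in at_right 0. bounds T \<delta> C \<epsilon>)"
proof -
  obtain C1 where "\<forall>\<^sub>F \<epsilon> in at_right 0. number \<epsilon> 0 \<le> C1 \<and> m\<epsilon> \<epsilon> \<le> C1" using initial_number_bound by blast
  define C0 where "C0 = max 1 C1"
  have ev0: "\<forall>\<^sub>F \<epsilon> in at_right 0. number \<epsilon> 0 \<le> C0 \<and> m\<epsilon> \<epsilon> \<le> C0"
    using \<open>\<forall>\<^sub>F \<epsilon> in at_right 0. number \<epsilon> 0 \<le> C1 \<and> m\<epsilon> \<epsilon> \<le> C1\<close> by (rule eventually_mono) (auto simp: C0_def)
  have C0: "1 \<le> C0" by (simp add: C0_def)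
  define \<delta> where "\<delta> = (u_in - \<rho>) / 4"
  have \<delta>: "0 < \<delta>" using u_in(1) by (simp add: \<delta>_def)
  define M where "M = C0 + (\<alpha> + 1) * C0\<^sup>2"
  have M: "0 \<le> M" using C0 limits_pos by (simp add: M_def)
  define L where "L = 2 * ((\<alpha> + 1) * C0\<^sup>2 + (\<beta> + 1) * M) + (K_a * C0 + K_b) * (M + C0)"
  have L: "0 < L"
  proof -
    have "0 < (K_a * C0 + K_b) * (M + C0)" using C0 M growth_pos by (intro mult_pos_pos add_pos_pos add_nonneg_pos) auto
    moreover have "0 \<le> (\<alpha> + 1) * C0\<^sup>2" "0 \<le> (\<beta> + 1) * M" using M limits_pos by simp_all
    ultimately show ?thesis unfolding L_def by (intro add_nonneg_pos) simp_all
  qed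
  define T where "T = min 1 (\<delta> / L)"
  have "L * T \<le> L * (\<delta> / L)" using L by (intro mult_left_mono) (auto simp: T_def)
  then have T: "0 < T" "T \<le> 1" "L * T \<le> \<delta>"
    using \<delta> L by (simp_all add: T_def)
  obtain z \<kappa> h where z: "0 < z" "z < 1" and \<kappa>: "0 < \<kappa>" and h: "0 < h" and
    coer: "\<forall>\<epsilon>>0. \<forall>i\<ge>2. \<forall>v\<ge>\<rho> + 2 * \<delta>. \<epsilon> * real i < h \<longrightarrow>
      \<kappa> * (\<epsilon> * real i) powr r_a \<le> a\<epsilon> \<epsilon> i * v - exp z * (if i < 3 then 0 else b\<epsilon> \<epsilon> i)"
    using coercivity[OF \<delta>] by (elim exE conjE) (rule that)
  obtain G where G: "\<And>\<epsilon>. 0 < \<epsilon> \<Longrightarrow> \<epsilon> powr r_a * (\<Sum>k. exp (- (real (k + 2) * z)) * c \<epsilon> (k + 2) 0) \<le> G"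
    using initial_exp_bound[OF z] by blast
  define E where "E = exp (2 * z) * (G + ((\<alpha> + 1) * C0\<^sup>2 + (\<kappa> + 3 * K_b) / (h * z) * (M + C0)) / ((1 - exp (- z)) * \<kappa>))"
  obtain D where D: "\<And>\<epsilon> N. 0 < \<epsilon> \<Longrightarrow> (\<Sum>k<N. sample \<epsilon> \<Phi> k 0) \<le> D"
    using initial_weight_bound by blast
  have D0: "0 \<le> D" using D[of 1 0] by simp
  obtain Q where Q: "0 \<le> Q" "linear_truncations \<Phi> Q" using superlinear_truncation[OF weight(1)] by blast
  have \<Phi>2: "0 \<le> \<Phi> 2" by (rule superlinear_weights_nonneg[OF weight(1)]) simp
  define P where "P = (D + (\<Phi> 2 * ((\<alpha> + 1) * C0\<^sup>2) + K_a * C0 * (Q * M)) * 1) * exp (K_a * C0 * 8 * 1)"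
  have P: "0 \<le> P" unfolding P_def using D0 \<Phi>2 Q C0 M growth_pos limits_pos by simp
  define C where "C = C0 + M + L + \<bar>E\<bar> + P + (\<alpha> + 1) + (\<beta> + 1)"
  have C: "0 < C" unfolding C_def using C0 M L P limits_pos by linarith
  have "\<forall>\<^sub>F \<epsilon> in at_right 0. \<alpha>\<epsilon> \<epsilon> < \<alpha> + 1" by (rule order_tendstoD[OF alpha_lim]) simp
  moreover have "\<forall>\<^sub>F \<epsilon> in at_right 0. \<beta>\<epsilon> \<epsilon> < \<beta> + 1" by (rule order_tendstoD[OF beta_lim]) simp
  moreover have "\<forall>\<^sub>F \<epsilon> in at_right 0. u_in - \<delta> < u \<epsilon> 0" by (rule order_tendstoD[OF u_in(2)]) (use \<delta> in simp)
  moreover have "\<forall>\<^sub>F \<epsilon> in at_right (0 :: real). \<epsilon> \<in> {0<..<1}" by (rule eventually_at_right_real) simp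
  ultimately have "\<forall>\<^sub>F \<epsilon> in at_right 0. bounds T \<delta> C \<epsilon>"
    using ev0
  proof eventually_elim
    case (elim \<epsilon>)
    then have e: "0 < \<epsilon>" "\<epsilon> \<le> 1" by auto
    interpret B: becker_doring \<eta> \<epsilon> "\<alpha>\<epsilon> \<epsilon>" "\<beta>\<epsilon> \<epsilon>" "a\<epsilon> \<epsilon>" "b\<epsilon> \<epsilon>" "u \<epsilon>" "c \<epsilon>" "m\<epsilon> \<epsilon>" K_a K_b
      by (rule system[OF e(1)])
    have num: "B.number t = number \<epsilon> t" for t by (simp add: S_eq_mom[OF e(1)])
    have mC: "m\<epsilon> \<epsilon> \<le> C0" "0 \<le> m\<epsilon> \<epsilon>" using elim B.m_nonneg by auto
    have al: "\<alpha>\<epsilon> \<epsilon> * (m\<epsilon> \<epsilon>)\<^sup>2 \<le> (\<alpha> + 1) * C0\<^sup>2"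
      using elim mC B.\<alpha> by (intro mult_mono power_mono) auto
    have al0: "0 \<le> (\<alpha> + 1) * C0\<^sup>2" using limits_pos by simp
    have n1: "B.number t \<le> M" if "t \<in> {0..T}" for t
    proof -
      have "B.number t \<le> B.number 0 + \<alpha>\<epsilon> \<epsilon> * (m\<epsilon> \<epsilon>)\<^sup>2 * t" using that by (intro B.number_le) simp
      also have "\<dots> \<le> C0 + (\<alpha> + 1) * C0\<^sup>2 * 1"
        using elim al0 that T by (intro add_mono mult_mono[OF al]) (auto simp: num)
      finally show ?thesis by (simp add: M_def)
    qed
    have lip: "\<bar>u \<epsilon> t - u \<epsilon> s\<bar> \<le> L * \<bar>t - s\<bar>" if "s \<in> {0..T}" "t \<in> {0..T}" for s t
    proof -
      have "\<bar>u \<epsilon> t - u \<epsilon> s\<bar> \<le> (2 * (\<alpha>\<epsilon> \<epsilon> * (m\<epsilon> \<epsilon>)\<^sup>2 + \<beta>\<epsilon> \<epsilon> * M) + (K_a * m\<epsilon> \<epsilon> + K_b) * (M + m\<epsilon> \<epsilon>)) * \<bar>t - s\<bar>"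
        by (rule B.u_Lipschitz[OF less_imp_le[OF T(1)] that e(2) eta_nonneg n1])
      also have "\<dots> \<le> L * \<bar>t - s\<bar>"
        unfolding L_def using elim al mC M growth_pos C0 limits_pos B.\<beta>
        by (intro mult_right_mono add_mono mult_mono mult_left_mono) auto
      finally show ?thesis .
    qed
    have ul: "\<rho> + 2 * \<delta> \<le> u \<epsilon> t" if t: "t \<in> {0..T}" for t
    proof -
      have "\<bar>u \<epsilon> t - u \<epsilon> 0\<bar> \<le> L * \<bar>t - 0\<bar>" using t T by (intro lip) auto
      also have "\<dots> \<le> L * T" using t L by (intro mult_left_mono) auto
      finally have "u \<epsilon> 0 - \<delta> \<le> u \<epsilon> t" using T(3) by linarith
      moreover have "\<rho> + 4 * \<delta> = u_in" unfolding \<delta>_def by (simp add: field_simps)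
      ultimately show ?thesis using elim by linarith
    qed
    have c2: "\<epsilon> powr r_a * c \<epsilon> 2 t \<le> E" if t: "t \<in> {0..T}" for t
    proof -
      have "\<epsilon> powr r_a * c \<epsilon> 2 t \<le> exp (2 * z) * (\<epsilon> powr r_a * (\<Sum>k. exp (- (real (k + 2) * z)) * c \<epsilon> (k + 2) 0)
         + (\<alpha>\<epsilon> \<epsilon> * (m\<epsilon> \<epsilon>)\<^sup>2 + (\<kappa> + 3 * K_b) / (h * z) * (M + m\<epsilon> \<epsilon>)) / ((1 - exp (- z)) * \<kappa>))"
      proof (rule B.small_clusters_bound[OF less_imp_le[OF T(1)] t e(2) z h \<kappa> exponents(1) n1])
        fix s i assume "s \<in> {0..T}" "2 \<le> (i :: nat)" "\<epsilon> * real i < h"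
        then show "\<kappa> * (\<epsilon> * real i) powr r_a \<le> a\<epsilon> \<epsilon> i * u \<epsilon> s - exp z * B.detach i"
          using coer[rule_format, OF e(1), of i "u \<epsilon> s"] ul[of s] by (simp add: B.detach_def)
      qed
      also have "\<dots> \<le> E"
        unfolding E_def using G[OF e(1)] al mC z h \<kappa> growth_pos
        by (intro mult_left_mono add_mono divide_right_mono) auto
      finally show ?thesis .
    qed
    have ph: "(\<Sum>k<N. sample \<epsilon> \<Phi> k t) \<le> P" if t: "t \<in> {0..T}" for t N
    proof -
      have "(\<Sum>k<N. sample \<epsilon> \<Phi> k t)
        \<le> (D + (\<Phi> 2 * (\<alpha>\<epsilon> \<epsilon> * (m\<epsilon> \<epsilon>)\<^sup>2) + K_a * m\<epsilon> \<epsilon> * (Q * M)) * t) * exp (K_a * m\<epsilon> \<epsilon> * 8 * t)"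
        by (rule B.superlinear_moment_propagation[OF weight(1) Q t e(2) n1 D[OF e(1)]])
      also have "\<dots> \<le> P"
        unfolding P_def
      proof (rule mult_mono)
        have q: "\<Phi> 2 * (\<alpha>\<epsilon> \<epsilon> * (m\<epsilon> \<epsilon>)\<^sup>2) + K_a * m\<epsilon> \<epsilon> * (Q * M) \<le> \<Phi> 2 * ((\<alpha> + 1) * C0\<^sup>2) + K_a * C0 * (Q * M)"
          using al mC \<Phi>2 growth_pos Q M by (intro add_mono mult_left_mono mult_right_mono) auto
        have q0: "0 \<le> \<Phi> 2 * ((\<alpha> + 1) * C0\<^sup>2) + K_a * C0 * (Q * M)"
          using \<Phi>2 al0 growth_pos C0 Q M by simp
        show "D + (\<Phi> 2 * (\<alpha>\<epsilon> \<epsilon> * (m\<epsilon> \<epsilon>)\<^sup>2) + K_a * m\<epsilon> \<epsilon> * (Q * M)) * t \<le> D + (\<Phi> 2 * ((\<alpha> + 1) * C0\<^sup>2) + K_a * C0 * (Q * M)) * 1"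
          using q q0 t T by (intro add_left_mono mult_mono) auto
        show "0 \<le> D + (\<Phi> 2 * ((\<alpha> + 1) * C0\<^sup>2) + K_a * C0 * (Q * M)) * 1" using q0 D0 by simp
        have "K_a * m\<epsilon> \<epsilon> * 8 * t \<le> K_a * C0 * 8 * 1"
          using mC growth_pos C0 t T by (intro mult_mono) auto
        then show "exp (K_a * m\<epsilon> \<epsilon> * 8 * t) \<le> exp (K_a * C0 * 8 * 1)" by simp
      qed simp
      finally show ?thesis .
    qed
    have big: "C0 \<le> C" "M \<le> C" "L \<le> C" "E \<le> C" "P \<le> C" "\<alpha> + 1 \<le> C" "\<beta> + 1 \<le> C"
      unfolding C_def using C0 M L P limits_pos by linarith+
    show ?case
      unfolding bounds_def
    proof (intro conjI ballI allI)
      fix s t assume st: "s \<in> {0..T}" "t \<in> {0..T}"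
      show "\<bar>u \<epsilon> t - u \<epsilon> s\<bar> \<le> C * \<bar>t - s\<bar>"
        using lip[OF st] mult_right_mono[OF big(3), of "\<bar>t - s\<bar>"] by linarith
    next
      fix t assume t: "t \<in> {0..T}"
      show "\<rho> + \<delta> \<le> u \<epsilon> t" using ul[OF t] \<delta> by linarith
      show "number \<epsilon> t \<le> C" using n1[OF t] big(2) num by simp
      show "\<epsilon> powr r_a * c \<epsilon> 2 t \<le> C" using c2[OF t] big(4) by linarith
      show "(\<Sum>k<N. sample \<epsilon> \<Phi> k t) \<le> C" for N using ph[OF t, of N] big(5) by linarith
    qed (use e elim big in auto)
  qed
  then show ?thesis using T(1) \<delta> C by blast
qed

end

section \<open>Equicontinuity in time and extraction of a subsequence\<close>

text \<open>The approximation is the infimal convolution of \<open>\<phi>\<close> with \<open>k \<bar>x\<bar>\<close>. Any two points further apart than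
  \<open>r\<close> do not matter once \<open>k r\<close> reaches a bound for the oscillation of \<open>\<phi>\<close>.\<close>

lemma Lipschitz_approximation:
  assumes \<phi>: "\<phi> \<in> C_c {0..}" and d: "0 < \<delta>"
  shows "\<exists>\<psi> k B. 0 \<le> k \<and> 0 \<le> B \<and> (\<forall>x\<ge>0. \<bar>\<psi> x\<bar> \<le> B) \<and> (\<forall>x\<ge>0. \<bar>\<psi> x - \<phi> x\<bar> \<le> \<delta>) \<and>
    (\<forall>x\<ge>0. \<forall>y\<ge>0. \<bar>\<psi> x - \<psi> y\<bar> \<le> k * \<bar>x - y\<bar>)"
proof -
  obtain B where B: "0 < B" "\<forall>x\<ge>0. \<bar>\<phi> x\<bar> \<le> B" using C_c_bounded[OF \<phi>] by (elim exE conjE) (rule that)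
  obtain r where r: "0 < r" "\<forall>x\<ge>0. \<forall>y\<ge>0. \<bar>x - y\<bar> \<le> r \<longrightarrow> \<bar>\<phi> x - \<phi> y\<bar> \<le> \<delta>"
    using C_c_uniformly_continuous[OF \<phi> d] by (elim exE conjE) (rule that)
  define k where "k = 2 * B / r"
  have k: "0 < k" using B r by (simp add: k_def)
  define \<psi> where "\<psi> x = (INF y\<in>{0..}. \<phi> y + k * \<bar>x - y\<bar>)" for x
  have bdd: "bdd_below ((\<lambda>y. \<phi> y + k * \<bar>x - y\<bar>) ` {0..})" for x
  proof (rule bdd_belowI2)
    fix y :: real assume "y \<in> {0..}"
    then have "- B \<le> \<phi> y" using B(2) by (auto simp: abs_le_iff)
    moreover have "0 \<le> k * \<bar>x - y\<bar>" using k by simp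
    ultimately show "- B \<le> \<phi> y + k * \<bar>x - y\<bar>" by linarith
  qed
  have up: "\<psi> x \<le> \<phi> x" if x: "0 \<le> x" for x
  proof -
    have "\<psi> x \<le> \<phi> x + k * \<bar>x - x\<bar>" unfolding \<psi>_def by (rule cINF_lower[OF bdd]) (use x in simp)
    then show ?thesis by simp
  qed
  have low: "\<phi> x - \<delta> \<le> \<psi> x" if x: "0 \<le> x" for x
    unfolding \<psi>_def
  proof (rule cINF_greatest)
    fix y :: real assume y: "y \<in> {0..}"
    show "\<phi> x - \<delta> \<le> \<phi> y + k * \<bar>x - y\<bar>"
    proof (cases "\<bar>x - y\<bar> \<le> r")
      case True
      then have "\<bar>\<phi> x - \<phi> y\<bar> \<le> \<delta>" using r(2) x y by simp
      moreover have "0 \<le> k * \<bar>x - y\<bar>" using k by simp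
      ultimately show ?thesis by linarith
    next
      case False
      then have "k * r \<le> k * \<bar>x - y\<bar>" using k by (intro mult_left_mono) auto
      then have "2 * B \<le> k * \<bar>x - y\<bar>" using r by (simp add: k_def)
      moreover have "\<bar>\<phi> x\<bar> \<le> B" "\<bar>\<phi> y\<bar> \<le> B" using B(2) x y by auto
      ultimately show ?thesis using d by linarith
    qed
  qed simp
  have lip: "\<psi> x - \<psi> y \<le> k * \<bar>x - y\<bar>" for x y
  proof -
    have "\<psi> x - k * \<bar>x - y\<bar> \<le> \<psi> y"
      unfolding \<psi>_def[of y]
    proof (rule cINF_greatest)
      fix w :: real assume w: "w \<in> {0..}"
      have "\<psi> x \<le> \<phi> w + k * \<bar>x - w\<bar>" unfolding \<psi>_def by (rule cINF_lower[OF bdd w])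
      moreover have "k * \<bar>x - w\<bar> \<le> k * (\<bar>x - y\<bar> + \<bar>y - w\<bar>)" using k by (intro mult_left_mono) auto
      ultimately show "\<psi> x - k * \<bar>x - y\<bar> \<le> \<phi> w + k * \<bar>y - w\<bar>" by (simp add: distrib_left)
    qed simp
    then show ?thesis by simp
  qed
  show ?thesis
  proof (rule exI[of _ \<psi>], rule exI[of _ k], rule exI[of _ "B + \<delta>"], intro conjI allI impI)
    fix x :: real assume x: "0 \<le> x"
    show c: "\<bar>\<psi> x - \<phi> x\<bar> \<le> \<delta>" using up[OF x] low[OF x] d by linarith
    show "\<bar>\<psi> x\<bar> \<le> B + \<delta>" using c B(2)[rule_format, OF x] by linarith
  next
    fix x y :: real
    show "\<bar>\<psi> x - \<psi> y\<bar> \<le> k * \<bar>x - y\<bar>"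
      using lip[of x y] lip[of y x] by (simp add: abs_le_iff abs_minus_commute)
  qed (use k B d in auto)
qed

context becker_doring_family
begin

lemma integral_continuous:
  assumes e: "0 < \<epsilon>" and \<phi>: "\<phi> \<in> C_c {0..}"
  shows "continuous_on {0..} (\<lambda>t. \<integral>x. \<phi> x \<partial>\<nu> \<epsilon> t)"
proof -
  obtain X where X: "0 < X" "\<forall>x\<ge>X. \<phi> x = 0" using C_c_support[OF \<phi>] by (elim exE conjE) (rule that)
  obtain B where B: "0 < B" "\<forall>x\<ge>0. \<bar>\<phi> x\<bar> \<le> B" using C_c_bounded[OF \<phi>] by (elim exE conjE) (rule that)
  obtain N where N: "X / \<epsilon> < real N" using reals_Archimedean2 by blast
  define q where "q j = (LINT x:cell \<epsilon> (j + 2)|lborel. \<phi> (max 0 x))" for j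
  have m: "(\<lambda>x. \<phi> (max 0 x)) \<in> borel_measurable borel"
    using continuous_on_compose_max[OF C_c_continuous[OF \<phi>]] by (rule borel_measurable_continuous_onI)
  have far: "\<phi> (max 0 x) = 0" if "N \<le> j" "x \<in> cell \<epsilon> (j + 2)" for j x
  proof -
    have "X < \<epsilon> * real N" using N e by (simp add: divide_less_eq mult.commute)
    also have "\<dots> \<le> (real (j + 2) - 1/2) * \<epsilon>" using that(1) e by (simp add: mult.commute)
    also have "\<dots> \<le> x" using that(2) by (simp add: cell_def)
    finally show ?thesis using X by simp
  qed
  have q0: "q j = 0" if "N \<le> j" for j
    unfolding q_def set_lebesgue_integral_def using far[OF that]
    by (intro integral_eq_zero_AE AE_I2) (auto simp: indicator_def)
  have qa0: "(LINT x:cell \<epsilon> (j + 2)|lborel. \<bar>\<phi> (max 0 x)\<bar>) = 0" if "N \<le> j" for j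
    unfolding set_lebesgue_integral_def using far[OF that]
    by (intro integral_eq_zero_AE AE_I2) (auto simp: indicator_def)
  have eq: "(\<integral>x. \<phi> x \<partial>\<nu> \<epsilon> t) = (\<Sum>j<N. c \<epsilon> (j + 2) t * q j)" if t: "0 \<le> t" for t
  proof -
    have "(\<lambda>j. c \<epsilon> (j + 2) t * (LINT x:cell \<epsilon> (j + 2)|lborel. \<phi> (max 0 x))) sums (\<integral>x. \<phi> (max 0 x) \<partial>\<nu> \<epsilon> t)"
    proof (rule sums_step_measure[OF e _ _ m])
      show "set_integrable lborel (cell \<epsilon> (j + 2)) (\<lambda>x. \<phi> (max 0 x))" for j
        by (rule bounded_integrable_cell[OF e m, where B=B]) (use B in auto)
      show "summable (\<lambda>j. c \<epsilon> (j + 2) t * (LINT x:cell \<epsilon> (j + 2)|lborel. \<bar>\<phi> (max 0 x)\<bar>))"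
        by (rule summable_finite[of "{..<N}"]) (simp_all only: finite_lessThan lessThan_iff not_less qa0 mult_zero_right)
    qed (use c_nonneg[OF e t] in auto)
    then have 1: "(\<lambda>j. c \<epsilon> (j + 2) t * q j) sums (\<integral>x. \<phi> (max 0 x) \<partial>\<nu> \<epsilon> t)" by (simp add: q_def)
    have 2: "(\<lambda>j. c \<epsilon> (j + 2) t * q j) sums (\<Sum>j<N. c \<epsilon> (j + 2) t * q j)"
      by (rule sums_finite) (auto simp: q0)
    show ?thesis using sums_unique2[OF 1 2] by (subst integral_density_measure_max) simp
  qed
  have "continuous_on {0..} (\<lambda>t. \<Sum>j<N. c \<epsilon> (j + 2) t * q j)"
    by (intro continuous_intros becker_doring.c_cont[OF system[OF e]]) simp
  then show ?thesis by (rule continuous_on_eq) (simp add: eq)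
qed

text \<open>Here \<open>\<eta> > r_a\<close> enters: the loss of dimers back to monomers is weaker, by the factor \<open>\<epsilon>\<close> to the power
  \<open>\<eta> - r_a\<close>, than what the bound on small clusters allows for.\<close>

lemma nucleation_bound:
  assumes b: "bounds T \<delta> C \<epsilon>" and t: "t \<in> {0..T}"
  shows "\<epsilon> powr \<eta> * c \<epsilon> 2 t \<le> \<epsilon> powr (\<eta> - r_a) * C"
    and "\<bar>becker_doring.J \<eta> \<epsilon> (\<alpha>\<epsilon> \<epsilon>) (\<beta>\<epsilon> \<epsilon>) (a\<epsilon> \<epsilon>) (b\<epsilon> \<epsilon>) (u \<epsilon>) (c \<epsilon>) 1 t\<bar> \<le> C * C\<^sup>2 + C * C"
proof -
  have e: "0 < \<epsilon>" "\<epsilon> \<le> 1" using b by (auto simp: bounds_def)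
  interpret B: becker_doring \<eta> \<epsilon> "\<alpha>\<epsilon> \<epsilon>" "\<beta>\<epsilon> \<epsilon>" "a\<epsilon> \<epsilon>" "b\<epsilon> \<epsilon>" "u \<epsilon>" "c \<epsilon>" "m\<epsilon> \<epsilon>" K_a K_b
    by (rule system[OF e(1)])
  have t0: "0 \<le> t" using t by simp
  have c2: "\<epsilon> powr r_a * c \<epsilon> 2 t \<le> C" using b t unfolding bounds_def by blast
  have mC: "m\<epsilon> \<epsilon> \<le> C" "\<alpha>\<epsilon> \<epsilon> \<le> C" "\<beta>\<epsilon> \<epsilon> \<le> C" using b unfolding bounds_def by blast+
  have C: "0 \<le> C" using mC(1) B.m_nonneg by simp
  have "\<epsilon> powr \<eta> = \<epsilon> powr (\<eta> - r_a) * \<epsilon> powr r_a" by (simp add: powr_add[symmetric])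
  then have "\<epsilon> powr \<eta> * c \<epsilon> 2 t = \<epsilon> powr (\<eta> - r_a) * (\<epsilon> powr r_a * c \<epsilon> 2 t)" by simp
  also have "\<dots> \<le> \<epsilon> powr (\<eta> - r_a) * C" using c2 by (intro mult_left_mono) auto
  finally show 1: "\<epsilon> powr \<eta> * c \<epsilon> 2 t \<le> \<epsilon> powr (\<eta> - r_a) * C" .
  have "\<epsilon> powr (\<eta> - r_a) \<le> 1" using powr_mono2[of "\<eta> - r_a" \<epsilon> 1] e eta by simp
  then have "\<epsilon> powr (\<eta> - r_a) * C \<le> 1 * C" using C by (intro mult_right_mono) auto
  then have "\<epsilon> powr \<eta> * c \<epsilon> 2 t \<le> C" using 1 by linarith
  then have "\<beta>\<epsilon> \<epsilon> * (\<epsilon> powr \<eta> * c \<epsilon> 2 t) \<le> C * C"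
    using mC B.\<beta> C c_nonneg[OF e(1) t0, of 2] by (intro mult_mono) auto
  moreover have "\<alpha>\<epsilon> \<epsilon> * (m\<epsilon> \<epsilon>)\<^sup>2 \<le> C * C\<^sup>2"
    using mC B.\<alpha> B.m_nonneg C by (intro mult_mono power_mono) auto
  ultimately show "\<bar>B.J 1 t\<bar> \<le> C * C\<^sup>2 + C * C" using B.J_1_abs_le[OF t0] by linarith
qed

lemma S_Lipschitz:
  assumes b: "bounds T \<delta> C \<epsilon>" and st: "s \<in> {0..T}" "t \<in> {0..T}"
    and \<psi>: "\<And>x. 0 \<le> x \<Longrightarrow> \<bar>\<psi> x\<bar> \<le> B" "\<And>x y. 0 \<le> x \<Longrightarrow> 0 \<le> y \<Longrightarrow> \<bar>\<psi> x - \<psi> y\<bar> \<le> k * \<bar>x - y\<bar>" and k: "0 \<le> k"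
  shows "\<bar>S \<epsilon> \<psi> t - S \<epsilon> \<psi> s\<bar> \<le> (B * (C * C\<^sup>2 + C * C) + k * ((K_a * C + K_b) * (C + C))) * \<bar>t - s\<bar>"
proof -
  have e: "0 < \<epsilon>" "\<epsilon> \<le> 1" and mC: "m\<epsilon> \<epsilon> \<le> C" using b by (auto simp: bounds_def)
  interpret B: becker_doring \<eta> \<epsilon> "\<alpha>\<epsilon> \<epsilon>" "\<beta>\<epsilon> \<epsilon>" "a\<epsilon> \<epsilon>" "b\<epsilon> \<epsilon>" "u \<epsilon>" "c \<epsilon>" "m\<epsilon> \<epsilon>" K_a K_b
    by (rule system[OF e(1)])
  have T: "0 \<le> T" using st by auto
  have n: "B.number t \<le> C" if "t \<in> {0..T}" for t
  proof -
    have "number \<epsilon> t \<le> C" using b that unfolding bounds_def by blast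
    then show ?thesis by (simp add: S_eq_mom[OF e(1)])
  qed
  have C: "0 \<le> C" using mC B.m_nonneg by simp
  have "\<bar>B.mom (\<lambda>i. \<psi> (\<epsilon> * real i)) t - B.mom (\<lambda>i. \<psi> (\<epsilon> * real i)) s\<bar>
      \<le> (B * (C * C\<^sup>2 + C * C) + k * ((K_a * m\<epsilon> \<epsilon> + K_b) * (C + m\<epsilon> \<epsilon>))) * \<bar>t - s\<bar>"
  proof (rule B.mom_Lipschitz[OF T st _ n])
    show "\<bar>B.J 1 t\<bar> \<le> C * C\<^sup>2 + C * C" if "t \<in> {0..T}" for t by (rule nucleation_bound(2)[OF b that])
    show "\<bar>\<psi> (\<epsilon> * real (i + 1)) - \<psi> (\<epsilon> * real i)\<bar> \<le> \<epsilon> * k" if "2 \<le> i" for i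
    proof -
      have "\<bar>\<psi> (\<epsilon> * real (i + 1)) - \<psi> (\<epsilon> * real i)\<bar> \<le> k * \<bar>\<epsilon> * real (i + 1) - \<epsilon> * real i\<bar>"
        using e by (intro \<psi>(2)) auto
      also have "\<bar>\<epsilon> * real (i + 1) - \<epsilon> * real i\<bar> = \<epsilon>" using e by (simp add: distrib_left)
      finally show ?thesis by (simp add: mult.commute)
    qed
    show "\<bar>\<psi> (\<epsilon> * real 2)\<bar> \<le> B" using e by (intro \<psi>(1)) simp
  qed
  also have "\<dots> \<le> (B * (C * C\<^sup>2 + C * C) + k * ((K_a * C + K_b) * (C + C))) * \<bar>t - s\<bar>"
    using mC growth_pos k C B.m_nonneg
    by (intro mult_right_mono add_left_mono mult_left_mono mult_mono add_mono) auto
  finally show ?thesis by (simp add: S_eq_mom[OF e(1)])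
qed

text \<open>Replacing the integral by a sampled sum, and \<open>\<phi>\<close> by a Lipschitz function, costs four errors of size
  \<open>\<theta> / 8\<close> for two times; the sampled sums of a Lipschitz function are Lipschitz in time.\<close>

lemma equicontinuity:
  assumes C: "0 < C" and \<phi>: "\<phi> \<in> C_c {0..}" and d: "0 < \<theta>"
  shows "\<exists>d>0. \<exists>h>0. \<forall>\<epsilon>. bounds T \<delta> C \<epsilon> \<and> \<epsilon> \<le> d \<longrightarrow> (\<forall>s\<in>{0..T}. \<forall>t\<in>{0..T}. \<bar>s - t\<bar> < h \<longrightarrow>
    \<bar>(\<integral>x. \<phi> x \<partial>\<nu> \<epsilon> s) - (\<integral>x. \<phi> x \<partial>\<nu> \<epsilon> t)\<bar> < \<theta>)"
proof -
  define \<tau> where "\<tau> = \<theta> / (8 * C)"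
  have \<tau>: "0 < \<tau>" "\<tau> * C = \<theta> / 8" using d C by (auto simp: \<tau>_def)
  obtain \<psi> k B where \<psi>: "0 \<le> k" "0 \<le> B" "\<forall>x\<ge>0. \<bar>\<psi> x\<bar> \<le> B" "\<forall>x\<ge>0. \<bar>\<psi> x - \<phi> x\<bar> \<le> \<tau>"
    "\<forall>x\<ge>0. \<forall>y\<ge>0. \<bar>\<psi> x - \<psi> y\<bar> \<le> k * \<bar>x - y\<bar>"
    using Lipschitz_approximation[OF \<phi> \<tau>(1)] by (elim exE conjE) (rule that)
  obtain B' where B': "0 < B'" "\<forall>x\<ge>0. \<bar>\<phi> x\<bar> \<le> B'" using C_c_bounded[OF \<phi>] by (elim exE conjE) (rule that)
  obtain r where r: "0 < r" "\<forall>\<epsilon>>0. \<forall>t\<ge>0. \<epsilon> \<le> r \<longrightarrow> \<bar>(\<integral>x. \<phi> x \<partial>\<nu> \<epsilon> t) - S \<epsilon> \<phi> t\<bar> \<le> \<tau> * number \<epsilon> t"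
    using integral_sampled_small[OF \<phi> \<tau>(1)] by (elim exE conjE) (rule that)
  define K where "K = B * (C * C\<^sup>2 + C * C) + k * ((K_a * C + K_b) * (C + C))"
  have K: "0 \<le> K" unfolding K_def using \<psi>(1,2) C growth_pos
    by (intro add_nonneg_nonneg mult_nonneg_nonneg) auto
  define h where "h = \<theta> / (4 * (K + 1))"
  have h: "0 < h" using d K by (simp add: h_def)
  have Kh: "K * h \<le> \<theta> / 4"
  proof -
    have "K * h \<le> (K + 1) * h" using h by (intro mult_right_mono) auto
    also have "\<dots> = \<theta> / 4" unfolding h_def using K by (simp del: distrib_left_numeral)
    finally show ?thesis .
  qed
  show ?thesis
  proof (rule exI[of _ r], rule conjI[OF r(1)], rule exI[of _ h], rule conjI[OF h], intro allI impI ballI)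
    fix \<epsilon> s t assume be: "bounds T \<delta> C \<epsilon> \<and> \<epsilon> \<le> r" and s: "s \<in> {0..T}" and t: "t \<in> {0..T}" and st: "\<bar>s - t\<bar> < h"
    then have b: "bounds T \<delta> C \<epsilon>" and er: "\<epsilon> \<le> r" by auto
    have e: "0 < \<epsilon>" using b by (auto simp: bounds_def)
    have near: "\<bar>(\<integral>x. \<phi> x \<partial>\<nu> \<epsilon> t) - S \<epsilon> \<psi> t\<bar> \<le> \<theta> / 4" if t: "t \<in> {0..T}" for t
    proof -
      have t0: "0 \<le> t" using t by simp
      have n: "number \<epsilon> t \<le> C" using b t unfolding bounds_def by blast
      have nC: "\<tau> * number \<epsilon> t \<le> \<theta> / 8" using mult_left_mono[OF n, of \<tau>] \<tau> by simp
      have bd: "\<bar>\<psi> x\<bar> \<le> B * (1 + x)" "\<bar>\<phi> x\<bar> \<le> B' * (1 + x)" if x: "0 \<le> x" for x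
      proof -
        have "B * 1 \<le> B * (1 + x)" "B' * 1 \<le> B' * (1 + x)" using \<psi>(2) B' x by (intro mult_left_mono; simp)+
        then show "\<bar>\<psi> x\<bar> \<le> B * (1 + x)" "\<bar>\<phi> x\<bar> \<le> B' * (1 + x)"
          using \<psi>(3)[rule_format, OF x] B'(2)[rule_format, OF x] by linarith+
      qed
      have "\<bar>S \<epsilon> \<psi> t - S \<epsilon> \<phi> t\<bar> \<le> \<tau> * number \<epsilon> t"
      proof -
        have "S \<epsilon> \<psi> t - S \<epsilon> \<phi> t = S \<epsilon> (\<lambda>x. \<psi> x - \<phi> x) t" by (rule S_diff[OF e t0]) (use bd in auto)
        then show ?thesis using S_abs_le[OF e t0, of "\<lambda>x. \<psi> x - \<phi> x" \<tau>] \<psi>(4) by simp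
      qed
      moreover have "\<bar>(\<integral>x. \<phi> x \<partial>\<nu> \<epsilon> t) - S \<epsilon> \<phi> t\<bar> \<le> \<tau> * number \<epsilon> t" using r(2) e t0 er by blast
      ultimately show ?thesis using nC by linarith
    qed
    have "\<bar>S \<epsilon> \<psi> s - S \<epsilon> \<psi> t\<bar> \<le> K * \<bar>s - t\<bar>"
      unfolding K_def by (rule S_Lipschitz[OF b t s]) (use \<psi> in auto)
    also have "\<dots> \<le> K * h" using st K by (intro mult_left_mono) auto
    finally have "\<bar>S \<epsilon> \<psi> s - S \<epsilon> \<psi> t\<bar> \<le> \<theta> / 4" using Kh by linarith
    then show "\<bar>(\<integral>x. \<phi> x \<partial>\<nu> \<epsilon> s) - (\<integral>x. \<phi> x \<partial>\<nu> \<epsilon> t)\<bar> < \<theta>"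
      using near[OF s] near[OF t] d by linarith
  qed
qed

lemma density_moments:
  assumes b: "bounds T \<delta> C \<epsilon>" and t: "t \<in> {0..T}"
  shows "finite_measure (\<nu> \<epsilon> t)" "measure (\<nu> \<epsilon> t) {0..} \<le> C" "integrable (\<nu> \<epsilon> t) (\<lambda>x. x)" "(\<integral>x. x \<partial>\<nu> \<epsilon> t) \<le> 2 * C"
proof -
  have e: "0 < \<epsilon>" "\<epsilon> \<le> 1" and mC: "m\<epsilon> \<epsilon> \<le> C" using b by (auto simp: bounds_def)
  interpret B: becker_doring \<eta> \<epsilon> "\<alpha>\<epsilon> \<epsilon>" "\<beta>\<epsilon> \<epsilon>" "a\<epsilon> \<epsilon>" "b\<epsilon> \<epsilon>" "u \<epsilon>" "c \<epsilon>" "m\<epsilon> \<epsilon>" K_a K_b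
    by (rule system[OF e(1)])
  have t0: "0 \<le> t" using t by simp
  have n: "number \<epsilon> t \<le> C" using b t unfolding bounds_def by blast
  have s1: "summable (\<lambda>k. c \<epsilon> (k + 2) t)"
    using S_summable_bounded[OF e(1) t0, where \<psi>="\<lambda>_. 1" and B=1] e by simp
  have cn: "0 \<le> c \<epsilon> i t" if "2 \<le> i" for i using c_nonneg[OF e(1) t0 that] .
  show "finite_measure (\<nu> \<epsilon> t)" by (rule finite_measure_step[OF e(1) _ cn s1]) simp
  have "measure (\<nu> \<epsilon> t) {0..} = (\<Sum>j. \<epsilon> * c \<epsilon> (j + 2) t)" by (rule measure_step[OF e(1) _ cn s1]) simp
  then show "measure (\<nu> \<epsilon> t) {0..} \<le> C" using n by (simp add: S_def)
  have sx: "summable (\<lambda>k. c \<epsilon> (k + 2) t * \<bar>\<epsilon> * real (k + 2)\<bar>)"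
  proof -
    have "summable (\<lambda>k. \<epsilon> * (\<epsilon> * real (k + 2)) * c \<epsilon> (k + 2) t)"
      by (rule S_summable[OF e(1) t0, where \<psi>="\<lambda>x. x" and B=1]) auto
    then have "summable (\<lambda>k. (1 / \<epsilon>) * (\<epsilon> * (\<epsilon> * real (k + 2)) * c \<epsilon> (k + 2) t))" by (rule summable_mult)
    then show ?thesis using e by (simp add: mult_ac)
  qed
  have w: "\<bar>x - \<epsilon> * real i\<bar> \<le> \<epsilon>" if "x \<in> cell \<epsilon> i" for x i
    using that e by (auto simp: cell_def algebra_simps abs_le_iff)
  show "integrable (\<nu> \<epsilon> t) (\<lambda>x. x)"
    by (rule integrable_step_measure_sampled[OF e(1) _ cn s1 _ sx w]) auto
  have "\<bar>(\<integral>x. x \<partial>\<nu> \<epsilon> t) - (\<Sum>j. \<epsilon> * (\<epsilon> * real (j + 2)) * c \<epsilon> (j + 2) t)\<bar> \<le> \<epsilon> * (\<Sum>j. \<epsilon> * c \<epsilon> (j + 2) t)"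
    by (rule integral_step_measure_sampled[OF e(1) _ cn s1 _ sx w]) auto
  then have "\<bar>(\<integral>x. x \<partial>\<nu> \<epsilon> t) - S \<epsilon> (\<lambda>x. x) t\<bar> \<le> \<epsilon> * number \<epsilon> t" by (simp add: S_def)
  moreover have "\<epsilon> * number \<epsilon> t \<le> 1 * C" using n e number_nonneg[OF e(1) t0] by (intro mult_mono) auto
  moreover have "S \<epsilon> (\<lambda>x. x) t \<le> C" using mass_moment[OF e(1) t0] B.u_nonneg[OF t0] mC by simp
  ultimately show "(\<integral>x. x \<partial>\<nu> \<epsilon> t) \<le> 2 * C" by linarith
qed

lemma compactness:
  assumes e: "\<And>n. 0 < e n" "e \<longlonglongrightarrow> 0"
  shows "\<exists>T \<delta> C \<sigma> \<mu>. 0 < T \<and> 0 < \<delta> \<and> 0 < C \<and> strict_mono (\<sigma> :: nat \<Rightarrow> nat) \<and> (\<forall>n. bounds T \<delta> C (e (\<sigma> n))) \<and>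
    (\<forall>t\<in>{0..T}. measure (\<mu> t) {0..} \<le> 2 * C) \<and> C_wstar_tendsto T (\<lambda>n t. \<nu> (e (\<sigma> n)) t) \<mu>"
proof -
  obtain T \<delta> C where T: "0 < T" "0 < \<delta>" "0 < C" and ev: "\<forall>\<^sub>F \<epsilon> in at_right 0. bounds T \<delta> C \<epsilon>"
    using uniform_bounds by (elim exE conjE) (rule that)
  have er: "filterlim e (at_right 0) sequentially"
    unfolding filterlim_at using e less_imp_neq[OF e(1), symmetric] by (auto intro!: always_eventually)
  have "\<forall>\<^sub>F n in sequentially. bounds T \<delta> C (e n)" using ev er by (auto simp: filterlim_iff)
  then obtain n0 where n0: "\<And>n. n0 \<le> n \<Longrightarrow> bounds T \<delta> C (e n)" by (auto simp: eventually_sequentially)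
  define E where "E n = e (n0 + n)" for n
  have bE: "bounds T \<delta> C (E n)" for n unfolding E_def by (rule n0) simp
  have E0: "0 < E n" for n unfolding E_def by (rule e)
  have El: "E \<longlonglongrightarrow> 0" unfolding E_def using LIMSEQ_ignore_initial_segment[OF e(2), of n0] by (simp add: add.commute)
  have "\<exists>r \<mu>. strict_mono (r :: nat \<Rightarrow> nat) \<and> (\<forall>t\<in>{0..T}. measure (\<mu> t) {0..} \<le> 2 * C) \<and>
    C_wstar_tendsto T (\<lambda>n t. \<nu> (E (r n)) t) \<mu>"
  proof (rule compactness_of_densities[where f="\<lambda>n t. step_fun 2 (E n) (\<lambda>i. c (E n) i t)"])
    fix n t assume t: "0 \<le> t" "t \<le> T"
    then have tT: "t \<in> {0..T}" by simp
    show "step_fun 2 (E n) (\<lambda>i. c (E n) i t) \<in> borel_measurable borel" by (rule borel_measurable_step_fun[OF E0]) simp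
    show "0 \<le> step_fun 2 (E n) (\<lambda>i. c (E n) i t) x" for x
      by (rule step_fun_nonneg[OF E0]) (use c_nonneg[OF E0 t(1)] in auto)
    show "finite_measure (\<nu> (E n) t)" "integrable (\<nu> (E n) t) (\<lambda>x. x)" "(\<integral>x. x \<partial>\<nu> (E n) t) \<le> 2 * C"
      by (rule density_moments[OF bE tT])+
    show "measure (\<nu> (E n) t) {0..} \<le> 2 * C" using density_moments(2)[OF bE tT, of n] T by linarith
  next
    fix n \<phi> assume "\<phi> \<in> C_c {0..}"
    then show "continuous_on {0..T} (\<lambda>t. \<integral>x. \<phi> x \<partial>\<nu> (E n) t)"
      by (rule continuous_on_subset[OF integral_continuous[OF E0]]) auto
  next
    fix \<phi> and \<theta> :: real assume \<phi>: "\<phi> \<in> C_c {0..}" and \<theta>: "0 < \<theta>"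
    obtain d h where dh: "0 < d" "0 < h" "\<forall>\<epsilon>. bounds T \<delta> C \<epsilon> \<and> \<epsilon> \<le> d \<longrightarrow> (\<forall>s\<in>{0..T}. \<forall>t\<in>{0..T}. \<bar>s - t\<bar> < h \<longrightarrow>
        \<bar>(\<integral>x. \<phi> x \<partial>\<nu> \<epsilon> s) - (\<integral>x. \<phi> x \<partial>\<nu> \<epsilon> t)\<bar> < \<theta>)"
      using equicontinuity[OF T(3) \<phi> \<theta>, of T \<delta>] by (elim exE conjE) (rule that)
    have "\<forall>\<^sub>F n in sequentially. E n < d" by (rule order_tendstoD(2)[OF El dh(1)])
    then have "\<forall>\<^sub>F n in sequentially. \<forall>s\<in>{0..T}. \<forall>t\<in>{0..T}. \<bar>s - t\<bar> < h \<longrightarrow>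
        \<bar>(\<integral>x. \<phi> x \<partial>\<nu> (E n) s) - (\<integral>x. \<phi> x \<partial>\<nu> (E n) t)\<bar> < \<theta>"
    proof eventually_elim
      case (elim n)
      then show ?case using dh(3)[rule_format, of "E n"] bE[of n] by auto
    qed
    then show "\<exists>h>0. \<forall>\<^sub>F n in sequentially. \<forall>s\<in>{0..T}. \<forall>t\<in>{0..T}. \<bar>s - t\<bar> < h \<longrightarrow>
        \<bar>(\<integral>x. \<phi> x \<partial>\<nu> (E n) s) - (\<integral>x. \<phi> x \<partial>\<nu> (E n) t)\<bar> < \<theta>"
      using dh(2) by blast
  qed (use T in auto)
  then obtain r \<mu> where r: "strict_mono (r :: nat \<Rightarrow> nat)" "\<forall>t\<in>{0..T}. measure (\<mu> t) {0..} \<le> 2 * C"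
    "C_wstar_tendsto T (\<lambda>n t. \<nu> (E (r n)) t) \<mu>" by (elim exE conjE) (rule that)
  have sm: "strict_mono (\<lambda>n. n0 + r n)" using r(1) by (auto simp: strict_mono_def)
  show ?thesis
    by (rule exI[of _ T], rule exI[of _ \<delta>], rule exI[of _ C], rule exI[of _ "\<lambda>n. n0 + r n"], rule exI[of _ \<mu>])
       (use T r sm bE in \<open>auto simp: E_def\<close>)
qed

end

section \<open>First moments and test functions\<close>

text \<open>Continuous, compactly supported minorants of the identity on the half-line, increasing with \<open>X\<close>.\<close>

definition cutoff :: "real \<Rightarrow> real \<Rightarrow> real" where
  "cutoff X x = x * max 0 (min 1 (X + 1 - x))"

lemma cutoff_C_c: "cutoff X \<in> C_c {0..}"
  unfolding cutoff_def[abs_def] by (rule C_c_intro[where X="X + 1"]) (auto intro!: continuous_intros)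

lemma cutoff_bounds: "0 \<le> x \<Longrightarrow> 0 \<le> cutoff X x" "0 \<le> x \<Longrightarrow> cutoff X x \<le> x" "x \<le> X \<Longrightarrow> cutoff X x = x"
proof -
  show "0 \<le> x \<Longrightarrow> 0 \<le> cutoff X x" by (simp add: cutoff_def)
  assume x: "0 \<le> x"
  have "x * max 0 (min 1 (X + 1 - x)) \<le> x * 1" using x by (intro mult_left_mono) auto
  then show "cutoff X x \<le> x" by (simp add: cutoff_def)
next
  assume "x \<le> X"
  then have "max 0 (min 1 (X + 1 - x)) = 1" by simp
  then show "cutoff X x = x" by (simp add: cutoff_def)
qed

lemma cutoff_mono: "0 \<le> x \<Longrightarrow> X \<le> Y \<Longrightarrow> cutoff X x \<le> cutoff Y x"
  unfolding cutoff_def by (intro mult_left_mono) auto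

text \<open>Weak-* convergence does not see mass escaping to infinity. If the tails of the first moments are
  uniformly small, the limits in \<open>n\<close> and in the cutoff may be exchanged; monotone convergence then makes the
  identity integrable.\<close>

lemma first_moment_limit:
  fixes L :: "nat \<Rightarrow> real" and s :: "nat \<Rightarrow> real \<Rightarrow> real"
  assumes M: "M \<in> M_f {0..}"
    and s: "\<And>X. (\<lambda>n. s n X) \<longlonglongrightarrow> (\<integral>x. cutoff X x \<partial>M)"
    and tail: "\<And>\<theta>. 0 < \<theta> \<Longrightarrow> \<exists>X0. \<forall>X\<ge>X0. \<forall>n. \<bar>L n - s n X\<bar> \<le> \<theta>"
    and B: "\<And>n. \<bar>L n\<bar> \<le> B"
  shows "integrable M (\<lambda>x. x)" "L \<longlonglongrightarrow> (\<integral>x. x \<partial>M)"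
proof -
  have sp: "space M = {0..}" by (rule M_f_D[OF M])
  have ci: "integrable M (cutoff X)" for X
  proof -
    obtain b where b: "0 < b" "\<forall>x\<ge>0. \<bar>cutoff X x\<bar> \<le> b" using C_c_bounded[OF cutoff_C_c[of X]] by (elim exE conjE) (rule that)
    show ?thesis by (rule integrable_M_f[OF M C_c_continuous[OF cutoff_C_c], where B=b]) (use b in auto)
  qed
  obtain X1 where X1: "\<forall>X\<ge>X1. \<forall>n. \<bar>L n - s n X\<bar> \<le> 1" using tail[OF zero_less_one] by (elim exE) (rule that)
  have le: "(\<integral>x. cutoff X x \<partial>M) \<le> (\<integral>x. cutoff Y x \<partial>M)" if "X \<le> Y" for X Y
    by (rule integral_mono[OF ci ci]) (use cutoff_mono that sp in auto)
  have bd: "(\<integral>x. cutoff X x \<partial>M) \<le> B + 1" for X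
  proof -
    have "(\<integral>x. cutoff (max X X1) x \<partial>M) \<le> B + 1"
    proof (rule LIMSEQ_le_const2[OF s], intro exI[of _ 0] allI impI)
      fix n
      have "\<bar>L n - s n (max X X1)\<bar> \<le> 1" using X1 by simp
      then show "s n (max X X1) \<le> B + 1" using B[of n] by linarith
    qed
    moreover have "(\<integral>x. cutoff X x \<partial>M) \<le> (\<integral>x. cutoff (max X X1) x \<partial>M)" by (rule le) simp
    ultimately show ?thesis by linarith
  qed
  have inc: "incseq (\<lambda>j. \<integral>x. cutoff (real j) x \<partial>M)" unfolding incseq_def using le by simp
  obtain l where l: "(\<lambda>j. \<integral>x. cutoff (real j) x \<partial>M) \<longlonglongrightarrow> l"
    using incseq_convergent[OF inc, of "B + 1"] bd by blast
  have mono: "AE x in M. mono (\<lambda>j. cutoff (real j) x)"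
    using cutoff_mono sp by (intro AE_I2) (auto simp: mono_def)
  have lim: "AE x in M. (\<lambda>j. cutoff (real j) x) \<longlonglongrightarrow> x"
  proof (intro AE_I2)
    fix x :: real
    obtain j0 :: nat where "x \<le> real j0" using real_arch_simple by blast
    then have "\<forall>\<^sub>F j in sequentially. cutoff (real j) x = x"
      unfolding eventually_sequentially by (intro exI[of _ j0] allI impI cutoff_bounds(3)) linarith
    then show "(\<lambda>j. cutoff (real j) x) \<longlonglongrightarrow> x" by (rule tendsto_eventually)
  qed
  have idm: "(\<lambda>x :: real. x) \<in> borel_measurable M"
    by (rule borel_measurable_M_f[OF M]) (intro continuous_intros)
  show int: "integrable M (\<lambda>x. x)"
    by (rule integrable_monotone_convergence[OF ci mono lim l idm])
  have eq: "(\<integral>x. x \<partial>M) = l"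
    by (rule integral_monotone_convergence[OF ci mono lim l idm])
  show "L \<longlonglongrightarrow> (\<integral>x. x \<partial>M)"
  proof (rule LIMSEQ_I)
    fix \<theta> :: real assume "0 < \<theta>"
    then have \<theta>: "0 < \<theta> / 3" by simp
    obtain X0 where X0: "\<forall>X\<ge>X0. \<forall>n. \<bar>L n - s n X\<bar> \<le> \<theta> / 3" using tail[OF \<theta>] by (elim exE) (rule that)
    obtain j1 where j1: "\<forall>j\<ge>j1. norm ((\<integral>x. cutoff (real j) x \<partial>M) - l) < \<theta> / 3" using LIMSEQ_D[OF l \<theta>] by (elim exE) (rule that)
    obtain j2 :: nat where j2: "X0 \<le> real j2" using real_arch_simple by blast
    define j where "j = max j1 j2"
    have "X0 \<le> real j" "j1 \<le> j" using j2 by (auto simp: j_def)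
    obtain n1 where n1: "\<forall>n\<ge>n1. norm (s n (real j) - (\<integral>x. cutoff (real j) x \<partial>M)) < \<theta> / 3"
      using LIMSEQ_D[OF s[of "real j"] \<theta>] by (elim exE) (rule that)
    show "\<exists>no. \<forall>n\<ge>no. norm (L n - (\<integral>x. x \<partial>M)) < \<theta>"
    proof (intro exI[of _ n1] allI impI)
      fix n assume n: "n1 \<le> n"
      have "\<bar>L n - s n (real j)\<bar> \<le> \<theta> / 3" using X0 \<open>X0 \<le> real j\<close> by blast
      moreover have "\<bar>s n (real j) - (\<integral>x. cutoff (real j) x \<partial>M)\<bar> < \<theta> / 3" using n1 n by simp
      moreover have "\<bar>(\<integral>x. cutoff (real j) x \<partial>M) - l\<bar> < \<theta> / 3" using j1 \<open>j1 \<le> j\<close> by simp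
      ultimately show "norm (L n - (\<integral>x. x \<partial>M)) < \<theta>" unfolding eq real_norm_def by linarith
    qed
  qed
qed

lemma C1_c_time_derivative:
  assumes "C1_c T \<phi> \<phi>t \<phi>x" "t \<in> {0..<T}" "0 \<le> x"
  shows "((\<lambda>s. \<phi> s x) has_real_derivative \<phi>t t x) (at t within {0..<T})"
proof -
  have d: "((\<lambda>(s, y). \<phi> s y) has_derivative (\<lambda>(h, k). \<phi>t t x * h + \<phi>x t x * k)) (at (t, x) within {0..<T} \<times> {0..})"
    using assms by (auto simp: C1_c_def)
  have g: "((\<lambda>s. (s, x)) has_derivative (\<lambda>h. (h, 0))) (at t within {0..<T})"
    by (auto intro!: derivative_eq_intros)
  have "((\<lambda>s. (\<lambda>(s, y). \<phi> s y) (s, x)) has_derivative (\<lambda>h. (\<lambda>(h, k). \<phi>t t x * h + \<phi>x t x * k) (h, 0))) (at t within {0..<T})"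
    by (rule has_derivative_in_compose[OF g has_derivative_subset[OF d]]) (use assms in auto)
  then show ?thesis by (simp add: has_field_derivative_def)
qed

lemma C1_c_space_derivative:
  assumes "C1_c T \<phi> \<phi>t \<phi>x" "t \<in> {0..<T}" "0 \<le> x"
  shows "((\<lambda>y. \<phi> t y) has_real_derivative \<phi>x t x) (at x within {0..})"
proof -
  have d: "((\<lambda>(s, y). \<phi> s y) has_derivative (\<lambda>(h, k). \<phi>t t x * h + \<phi>x t x * k)) (at (t, x) within {0..<T} \<times> {0..})"
    using assms by (auto simp: C1_c_def)
  have g: "((\<lambda>y. (t, y)) has_derivative (\<lambda>k. (0, k))) (at x within {0..})"
    by (auto intro!: derivative_eq_intros)
  have "((\<lambda>y. (\<lambda>(s, y). \<phi> s y) (t, y)) has_derivative (\<lambda>k. (\<lambda>(h, k). \<phi>t t x * h + \<phi>x t x * k) (0, k))) (at x within {0..})"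
    by (rule has_derivative_in_compose[OF g has_derivative_subset[OF d]]) (use assms in auto)
  then show ?thesis by (simp add: has_field_derivative_def)
qed

lemma derivative_zero_of_locally_zero:
  fixes f :: "real \<Rightarrow> real"
  assumes "(f has_real_derivative D) (at x within S)" "x \<in> S" "0 < d" "\<And>y. y \<in> S \<Longrightarrow> dist y x < d \<Longrightarrow> f y = 0"
    and nt: "at x within S \<noteq> bot"
  shows "D = 0"
proof -
  have "((\<lambda>_. 0) has_real_derivative D) (at x within S)"
    by (rule has_field_derivative_transform_within[OF assms(1,3,2)]) (use assms(4) in auto)
  then have "((\<lambda>y. 0) \<longlongrightarrow> D) (at x within S)" by (simp add: has_field_derivative_iff)
  then show ?thesis using tendsto_unique[OF nt _ tendsto_const] by blast
qed

text \<open>The margin between the support and \<open>T1\<close>, \<open>X\<close> makes the derivatives vanish there as well, also where they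
  are one-sided.\<close>

lemma C1_c_support:
  assumes c1: "C1_c T \<phi> \<phi>t \<phi>x" and T: "0 < T"
  shows "\<exists>T1 X P. 0 < T1 \<and> T1 < T \<and> 0 < X \<and> 0 \<le> P \<and>
    (\<forall>t\<in>{0..<T}. \<forall>x\<ge>0. T1 \<le> t \<or> X \<le> x \<longrightarrow> \<phi> t x = 0 \<and> \<phi>t t x = 0 \<and> \<phi>x t x = 0) \<and>
    (\<forall>t\<in>{0..T1}. \<forall>x\<ge>0. \<bar>\<phi> t x\<bar> \<le> P \<and> \<bar>\<phi>t t x\<bar> \<le> P \<and> \<bar>\<phi>x t x\<bar> \<le> P)"
proof -
  obtain K where K: "compact K" "K \<subseteq> {0..<T} \<times> {0..}" "\<forall>(t, x)\<in>{0..<T} \<times> {0..} - K. \<phi> t x = 0"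
    using c1 by (auto simp: C1_c_def)
  obtain Tk Xk where TX: "0 \<le> Tk" "Tk < T" "0 \<le> Xk" "\<And>t x. (t, x) \<in> K \<Longrightarrow> t \<le> Tk \<and> x \<le> Xk"
  proof (cases "K = {}")
    case True
    then show ?thesis using that[of 0 0] T by auto
  next
    case False
    have c1: "compact (fst ` K)" "compact (snd ` K)" by (auto intro!: compact_continuous_image continuous_intros K)
    obtain p where p: "p \<in> fst ` K" "\<And>q. q \<in> fst ` K \<Longrightarrow> q \<le> p"
      using compact_attains_sup[OF c1(1)] False by auto
    obtain r where r: "r \<in> snd ` K" "\<And>q. q \<in> snd ` K \<Longrightarrow> q \<le> r"
      using compact_attains_sup[OF c1(2)] False by auto
    have "0 \<le> p" "p < T" "0 \<le> r" using p(1) r(1) K(2) by auto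
    then show ?thesis
    proof (rule that)
      fix t x assume "(t, x) \<in> K"
      then have "t \<in> fst ` K" "x \<in> snd ` K" by force+
      then show "t \<le> p \<and> x \<le> r" using p(2) r(2) by simp
    qed
  qed
  have z: "\<phi> t x = 0" if "t \<in> {0..<T}" "0 \<le> x" "Tk < t \<or> Xk < x" for t x
  proof -
    have "(t, x) \<notin> K" using TX(4)[of t x] that by auto
    then show ?thesis using K(3) that by auto
  qed
  have nt: "at t within {0..<T} \<noteq> bot" if "t \<in> {0..<T}" for t
  proof
    assume "at t within {0..<T} = bot"
    moreover have "at_right t = at t within {t<..<T}"
      using that by (intro at_within_nhd[of t "{..<T}"]) auto
    moreover have "at t within {t<..<T} \<le> at t within {0..<T}" using that by (intro at_le) auto
    ultimately have "at_right t \<le> bot" by simp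
    then show False by (simp add: bot.extremum_unique)
  qed
  have nx: "at x within {0..} \<noteq> bot" if "0 \<le> x" for x :: real
  proof
    assume "at x within {0..} = bot"
    moreover have "at_right x \<le> at x within {0..}" using that by (intro at_le) auto
    ultimately show False by (simp add: bot.extremum_unique)
  qed
  have zt: "\<phi>t t x = 0 \<and> \<phi>x t x = 0" if t: "t \<in> {0..<T}" and x: "0 \<le> x" and far: "Tk < t \<or> Xk < x" for t x
  proof
    show "\<phi>t t x = 0"
    proof (rule derivative_zero_of_locally_zero[OF C1_c_time_derivative[OF c1 t x] t _ _ nt[OF t]])
      define d where "d = (if Tk < t then t - Tk else 1)"
      show "0 < d" by (simp add: d_def)
      fix s assume "s \<in> {0..<T}" "dist s t < d"
      then show "\<phi> s x = 0" using far x by (intro z) (auto simp: d_def dist_real_def split: if_splits)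
    qed
    show "\<phi>x t x = 0"
    proof (rule derivative_zero_of_locally_zero[OF C1_c_space_derivative[OF c1 t x] _ _ _ nx[OF x]])
      define d where "d = (if Xk < x then x - Xk else 1)"
      show "0 < d" by (simp add: d_def)
      fix y assume "y \<in> {0..}" "dist y x < d"
      then show "\<phi> t y = 0" using far t by (intro z) (auto simp: d_def dist_real_def split: if_splits)
    qed (use x in simp)
  qed
  define T1 where "T1 = (Tk + T) / 2"
  define X where "X = Xk + 1"
  have T1: "0 < T1" "T1 < T" "Tk < T1" using TX T by (auto simp: T1_def)
  have X: "0 < X" "Xk < X" using TX by (auto simp: X_def)
  define Q where "Q = {0..T1} \<times> {0..X}"
  have Q: "compact Q" "Q \<subseteq> {0..<T} \<times> {0..}" unfolding Q_def using T1 by (auto intro: compact_Times)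
  have cont: "continuous_on ({0..<T} \<times> {0..}) (\<lambda>(t, x). \<phi> t x)"
    unfolding continuous_on_eq_continuous_within
  proof
    fix p :: "real \<times> real" assume "p \<in> {0..<T} \<times> {0..}"
    then have "((\<lambda>(s, y). \<phi> s y) has_derivative (\<lambda>(h, k). \<phi>t (fst p) (snd p) * h + \<phi>x (fst p) (snd p) * k)) (at p within {0..<T} \<times> {0..})"
      using c1 by (auto simp: C1_c_def)
    then show "continuous (at p within {0..<T} \<times> {0..}) (\<lambda>(t, x). \<phi> t x)" by (rule has_derivative_continuous)
  qed
  have bnd: "\<exists>B. \<forall>t\<in>{0..T1}. \<forall>x\<in>{0..X}. \<bar>f t x\<bar> \<le> B" if "continuous_on ({0..<T} \<times> {0..}) (\<lambda>(t, x). f t x)" for f :: "real \<Rightarrow> real \<Rightarrow> real"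
  proof -
    have "compact ((\<lambda>(t, x). f t x) ` Q)"
      by (intro compact_continuous_image Q continuous_on_subset[OF that])
    then obtain B where "\<forall>y\<in>(\<lambda>(t, x). f t x) ` Q. norm y \<le> B" using compact_imp_bounded bounded_iff by metis
    then show ?thesis unfolding Q_def by (intro exI[of _ B]) auto
  qed
  obtain B1 where B1: "\<forall>t\<in>{0..T1}. \<forall>x\<in>{0..X}. \<bar>\<phi> t x\<bar> \<le> B1" using bnd[OF cont] by (elim exE) (rule that)
  obtain B2 where B2: "\<forall>t\<in>{0..T1}. \<forall>x\<in>{0..X}. \<bar>\<phi>t t x\<bar> \<le> B2"
    using bnd[of \<phi>t] c1 unfolding C1_c_def by blast
  obtain B3 where B3: "\<forall>t\<in>{0..T1}. \<forall>x\<in>{0..X}. \<bar>\<phi>x t x\<bar> \<le> B3"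
    using bnd[of \<phi>x] c1 unfolding C1_c_def by blast
  define P where "P = max 0 (max B1 (max B2 B3))"
  have PP: "0 \<le> P" "B1 \<le> P" "B2 \<le> P" "B3 \<le> P" by (auto simp: P_def)
  have Pb: "\<bar>\<phi> t x\<bar> \<le> P \<and> \<bar>\<phi>t t x\<bar> \<le> P \<and> \<bar>\<phi>x t x\<bar> \<le> P" if t: "t \<in> {0..T1}" and x: "0 \<le> x" for t x
  proof (cases "x \<le> X")
    case True
    then have "x \<in> {0..X}" using x by simp
    then have "\<bar>\<phi> t x\<bar> \<le> B1" "\<bar>\<phi>t t x\<bar> \<le> B2" "\<bar>\<phi>x t x\<bar> \<le> B3" using B1 B2 B3 t by blast+
    then show ?thesis using PP by linarith
  next
    case False
    then have "t \<in> {0..<T}" "Xk < x" using t T1 X by auto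
    then show ?thesis using z[of t x] zt[of t x] x PP by simp
  qed
  have zz: "\<phi> t x = 0 \<and> \<phi>t t x = 0 \<and> \<phi>x t x = 0" if "t \<in> {0..<T}" "0 \<le> x" "T1 \<le> t \<or> X \<le> x" for t x
  proof -
    have "Tk < t \<or> Xk < x" using that T1 X by linarith
    then show ?thesis using z[OF that(1,2)] zt[OF that(1,2)] by blast
  qed
  show ?thesis
    by (rule exI[of _ T1], rule exI[of _ X], rule exI[of _ P]) (use T1 X PP zz Pb in auto)
qed

lemma C1_c_slices:
  assumes "C1_c T \<phi> \<phi>t \<phi>x" "t \<in> {0..<T}"
  shows "continuous_on {0..} (\<phi> t)" "continuous_on {0..} (\<phi>t t)" "continuous_on {0..} (\<phi>x t)"
proof -
  have s: "continuous_on {0..} (f t)" if "continuous_on ({0..<T} \<times> {0..}) (\<lambda>(t, x). f t x)" for f :: "real \<Rightarrow> real \<Rightarrow> real"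
  proof -
    have "continuous_on {0..} (\<lambda>x. (\<lambda>(t, x). f t x) (t, x))"
      by (rule continuous_on_compose2[OF that]) (use assms(2) in \<open>auto intro!: continuous_intros\<close>)
    then show ?thesis by simp
  qed
  show "continuous_on {0..} (\<phi>t t)" "continuous_on {0..} (\<phi>x t)" using assms(1) s unfolding C1_c_def by blast+
  show "continuous_on {0..} (\<phi> t)"
    unfolding continuous_on_eq_continuous_within
    using C1_c_space_derivative[OF assms] DERIV_continuous by fastforce
qed

section \<open>Passage to the limit\<close>

locale becker_doring_limit = becker_doring_family +
  fixes E :: "nat \<Rightarrow> real" and T \<delta> C :: real and \<mu> :: "real \<Rightarrow> real measure"
  assumes T: "0 < T" and \<delta>: "0 < \<delta>" and C: "0 < C"
    and bE: "\<And>n. bounds T \<delta> C (E n)" and El: "E \<longlonglongrightarrow> 0"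
    and conv: "C_wstar_tendsto T (\<lambda>n t. \<nu> (E n) t) \<mu>"
begin

lemma E0: "0 < E n" and E1: "E n \<le> 1" and mC: "m\<epsilon> (E n) \<le> C"
  using bE[of n] by (auto simp: bounds_def)

lemma numC: "t \<in> {0..T} \<Longrightarrow> number (E n) t \<le> C"
  using bE[of n] unfolding bounds_def by blast

lemma E_at_right: "filterlim E (at_right 0) sequentially"
  unfolding filterlim_at using El E0 less_imp_neq[OF E0, symmetric] by (auto intro!: always_eventually)

lemma \<mu>_M_f: "t \<in> {0..T} \<Longrightarrow> \<mu> t \<in> M_f {0..}"
  using conv by (auto simp: C_wstar_tendsto_def C_wstar_def)

lemma S_limit:
  assumes \<phi>: "\<phi> \<in> C_c {0..}" and t: "t \<in> {0..T}"
  shows "(\<lambda>n. S (E n) \<phi> t) \<longlonglongrightarrow> (\<integral>x. \<phi> x \<partial>\<mu> t)"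
proof -
  have t0: "0 \<le> t" using t by simp
  have "uniform_limit {0..T} (\<lambda>n t. \<integral>x. \<phi> x \<partial>\<nu> (E n) t) (\<lambda>t. \<integral>x. \<phi> x \<partial>\<mu> t) sequentially"
    using conv \<phi> unfolding C_wstar_tendsto_def by blast
  then have 1: "(\<lambda>n. \<integral>x. \<phi> x \<partial>\<nu> (E n) t) \<longlonglongrightarrow> (\<integral>x. \<phi> x \<partial>\<mu> t)" using t by (rule tendsto_uniform_limitI)
  have 2: "(\<lambda>n. S (E n) \<phi> t - (\<integral>x. \<phi> x \<partial>\<nu> (E n) t)) \<longlonglongrightarrow> 0"
  proof (rule LIMSEQ_I)
    fix \<theta> :: real assume \<theta>: "0 < \<theta>"
    then have \<theta>': "0 < \<theta> / (2 * C)" using C by simp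
    obtain d where d: "0 < d" "\<forall>\<epsilon>>0. \<forall>t\<ge>0. \<epsilon> \<le> d \<longrightarrow> \<bar>(\<integral>x. \<phi> x \<partial>\<nu> \<epsilon> t) - S \<epsilon> \<phi> t\<bar> \<le> \<theta> / (2 * C) * number \<epsilon> t"
      using integral_sampled_small[OF \<phi> \<theta>'] by (elim exE conjE) (rule that)
    obtain n0 where n0: "\<forall>n\<ge>n0. norm (E n - 0) < d" using LIMSEQ_D[OF El d(1)] by (elim exE) (rule that)
    show "\<exists>no. \<forall>n\<ge>no. norm (S (E n) \<phi> t - (\<integral>x. \<phi> x \<partial>\<nu> (E n) t) - 0) < \<theta>"
    proof (intro exI[of _ n0] allI impI)
      fix n assume "n0 \<le> n"
      then have "norm (E n - 0) < d" using n0 by blast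
      then have "E n \<le> d" using E0[of n] by simp
      then have "\<bar>(\<integral>x. \<phi> x \<partial>\<nu> (E n) t) - S (E n) \<phi> t\<bar> \<le> \<theta> / (2 * C) * number (E n) t"
        using d(2)[rule_format, OF E0 t0] by blast
      also have "\<dots> \<le> \<theta> / (2 * C) * C" using \<theta>' numC[OF t, of n] by (intro mult_left_mono) auto
      also have "\<dots> < \<theta>" using C \<theta> by simp
      finally show "norm (S (E n) \<phi> t - (\<integral>x. \<phi> x \<partial>\<nu> (E n) t) - 0) < \<theta>" by simp
    qed
  qed
  from tendsto_add[OF 2 1] show ?thesis by simp
qed

lemma initial_measure:
  assumes \<phi>: "\<phi> \<in> C_c {0..}"
  shows "(\<integral>x. \<phi> x \<partial>\<mu> 0) = (\<integral>x. \<phi> x \<partial>\<mu>_in)"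
proof -
  have t: "(0 :: real) \<in> {0..T}" using T by simp
  have "((\<lambda>\<epsilon>. \<integral>x. \<phi> x \<partial>\<nu> \<epsilon> 0) \<longlongrightarrow> (\<integral>x. \<phi> x \<partial>\<mu>_in)) (at_right 0)"
    using mu_in(2) \<phi> unfolding wstar_tendsto_def by blast
  then have 1: "(\<lambda>n. \<integral>x. \<phi> x \<partial>\<nu> (E n) 0) \<longlonglongrightarrow> (\<integral>x. \<phi> x \<partial>\<mu>_in)" by (rule filterlim_compose[OF _ E_at_right])
  have "uniform_limit {0..T} (\<lambda>n t. \<integral>x. \<phi> x \<partial>\<nu> (E n) t) (\<lambda>t. \<integral>x. \<phi> x \<partial>\<mu> t) sequentially"
    using conv \<phi> unfolding C_wstar_tendsto_def by blast
  then have "(\<lambda>n. \<integral>x. \<phi> x \<partial>\<nu> (E n) 0) \<longlonglongrightarrow> (\<integral>x. \<phi> x \<partial>\<mu> 0)" using t by (rule tendsto_uniform_limitI)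
  then show ?thesis using 1 LIMSEQ_unique by blast
qed

text \<open>Beyond \<open>A\<close> the weight exceeds \<open>k x\<close> with \<open>k = C / \<theta>\<close>, so its moment, at most \<open>C\<close>, leaves at most \<open>\<theta>\<close> for the mass.\<close>

lemma moment_tail:
  assumes t: "t \<in> {0..T}" and \<theta>: "0 < \<theta>"
  shows "\<exists>X0. \<forall>X\<ge>X0. \<forall>n. \<bar>S (E n) (\<lambda>x. x) t - S (E n) (cutoff X) t\<bar> \<le> \<theta>"
proof -
  have t0: "0 \<le> t" using t by simp
  define k where "k = C / \<theta>"
  have k: "0 < k" using C \<theta> by (simp add: k_def)
  obtain A where A: "1 \<le> A" "\<forall>x\<ge>A. k * x \<le> \<Phi> x"
    using superlinear_weights_dominate[OF weight(1), of k] by (elim exE conjE) (rule that)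
  have "\<bar>S (E n) (\<lambda>x. x) t - S (E n) (cutoff X) t\<bar> \<le> \<theta>" if X: "A \<le> X" for X n
  proof -
    note e = E0[of n]
    have cb: "0 \<le> x - cutoff X x" "x - cutoff X x \<le> x" "x - cutoff X x \<le> \<Phi> x / k" "\<bar>cutoff X x\<bar> \<le> 1 * (1 + x)" if x: "0 \<le> x" for x
    proof -
      show 1: "0 \<le> x - cutoff X x" "x - cutoff X x \<le> x" using cutoff_bounds(1,2)[OF x, of X] cutoff_bounds(3)[of x X] by simp_all
      show "\<bar>cutoff X x\<bar> \<le> 1 * (1 + x)" using cutoff_bounds(1,2)[OF x, of X] by simp
      show "x - cutoff X x \<le> \<Phi> x / k"
      proof (cases "x \<le> X")
        case True
        then show ?thesis using cutoff_bounds(3)[of x X] superlinear_weights_nonneg[OF weight(1) x] k by simp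
      next
        case False
        then have "k * x \<le> \<Phi> x" using A(2) X by simp
        then have "x \<le> \<Phi> x / k" using k by (simp add: le_divide_eq mult.commute)
        then show ?thesis using 1 by linarith
      qed
    qed
    have idb: "\<bar>x\<bar> \<le> 1 * (1 + x)" if "0 \<le> x" for x :: real using that by simp
    have sm: "summable (\<lambda>j. E n * (E n * real (j + 2) - cutoff X (E n * real (j + 2))) * c (E n) (j + 2) t)"
    proof (rule S_summable[OF e t0, where B=1 and \<psi>="\<lambda>x. x - cutoff X x"])
      fix x :: real assume x: "0 \<le> x"
      show "\<bar>x - cutoff X x\<bar> \<le> 1 * (1 + x)" using cb(1,2)[OF x] x by simp
    qed
    have eq: "S (E n) (\<lambda>x. x) t - S (E n) (cutoff X) t = S (E n) (\<lambda>x. x - cutoff X x) t"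
      by (rule S_diff[OF e t0, where B=1 and B'=1]) (use idb cb(4) in auto)
    have nonneg: "0 \<le> E n * (E n * real (j + 2) - cutoff X (E n * real (j + 2))) * c (E n) (j + 2) t" for j
      using e c_nonneg[OF e t0, of "j + 2"] cb(1)[of "E n * real (j + 2)"] by (intro mult_nonneg_nonneg) auto
    have "S (E n) (\<lambda>x. x - cutoff X x) t \<le> \<theta>"
      unfolding S_def
    proof (rule suminf_le_const[OF sm])
      fix N
      have "(\<Sum>j<N. E n * (E n * real (j + 2) - cutoff X (E n * real (j + 2))) * c (E n) (j + 2) t)
        \<le> (\<Sum>j<N. E n * (\<Phi> (E n * real (j + 2)) / k) * c (E n) (j + 2) t)"
        using e c_nonneg[OF e t0] cb(3) by (intro sum_mono mult_right_mono mult_left_mono) auto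
      also have "\<dots> = (\<Sum>j<N. sample (E n) \<Phi> j t) / k"
        by (simp add: sum_divide_distrib)
      also have "\<dots> \<le> C / k"
        using bE[of n] t k unfolding bounds_def by (intro divide_right_mono) auto
      finally show "(\<Sum>j<N. E n * (E n * real (j + 2) - cutoff X (E n * real (j + 2))) * c (E n) (j + 2) t) \<le> \<theta>"
        using C \<theta> by (simp add: k_def)
    qed
    moreover have "0 \<le> S (E n) (\<lambda>x. x - cutoff X x) t"
      unfolding S_def by (rule suminf_nonneg[OF sm nonneg])
    ultimately show ?thesis unfolding eq by simp
  qed
  then show ?thesis by blast
qed

lemma first_moment_bounded: "t \<in> {0..T} \<Longrightarrow> \<bar>S (E n) (\<lambda>x. x) t\<bar> \<le> C"
proof -
  assume t: "t \<in> {0..T}"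
  then have t0: "0 \<le> t" by simp
  have "0 \<le> u (E n) t" "u (E n) t \<le> m\<epsilon> (E n)"
    using becker_doring.u_nonneg[OF system[OF E0] t0] becker_doring.u_le[OF system[OF E0] t0] by auto
  then show ?thesis unfolding mass_moment[OF E0 t0] using mC[of n] by simp
qed

lemma first_moment:
  assumes t: "t \<in> {0..T}"
  shows "integrable (\<mu> t) (\<lambda>x. x)" "(\<lambda>n. S (E n) (\<lambda>x. x) t) \<longlonglongrightarrow> (\<integral>x. x \<partial>\<mu> t)"
  using first_moment_limit[of "\<mu> t" "\<lambda>n X. S (E n) (cutoff X) t" "\<lambda>n. S (E n) (\<lambda>x. x) t" C]
    \<mu>_M_f[OF t] S_limit[OF cutoff_C_c t] moment_tail[OF t] first_moment_bounded[OF t] by blast+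

lemma total_mass: "(\<lambda>n. m\<epsilon> (E n)) \<longlonglongrightarrow> u_in + (\<integral>x. x \<partial>\<mu>_in)"
proof -
  have t: "(0 :: real) \<in> {0..T}" using T by simp
  have s: "(\<lambda>n. S (E n) (cutoff X) 0) \<longlonglongrightarrow> (\<integral>x. cutoff X x \<partial>\<mu>_in)" for X
    using S_limit[OF cutoff_C_c t, of X] unfolding initial_measure[OF cutoff_C_c] .
  have 1: "(\<lambda>n. S (E n) (\<lambda>x. x) 0) \<longlonglongrightarrow> (\<integral>x. x \<partial>\<mu>_in)"
    by (rule first_moment_limit(2)[OF mu_in(1) s moment_tail[OF t] first_moment_bounded[OF t]])
  have 2: "(\<lambda>n. u (E n) 0) \<longlonglongrightarrow> u_in" by (rule filterlim_compose[OF u_in(2) E_at_right])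
  have "u (E n) 0 + S (E n) (\<lambda>x. x) 0 = m\<epsilon> (E n)" for n using mass_moment[OF E0, of 0 n] by simp
  then show ?thesis using tendsto_add[OF 2 1] by simp
qed

text \<open>The mass balance leaves no other choice for the limit of the monomer concentration.\<close>

definition u0 :: "real \<Rightarrow> real" where
  "u0 t = u_in + (\<integral>x. x \<partial>\<mu>_in) - (\<integral>x. x \<partial>\<mu> t)"

lemma u_limit:
  assumes t: "t \<in> {0..T}"
  shows "(\<lambda>n. u (E n) t) \<longlonglongrightarrow> u0 t"
proof -
  have "m\<epsilon> (E n) - S (E n) (\<lambda>x. x) t = u (E n) t" for n using mass_moment[OF E0, of t n] t by simp
  then show ?thesis
    using tendsto_diff[OF total_mass first_moment(2)[OF t]] by (simp add: u0_def)
qed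

lemma u0_initial: "u0 0 = u_in"
proof -
  have "(\<lambda>n. u (E n) 0) \<longlonglongrightarrow> u_in" by (rule filterlim_compose[OF u_in(2) E_at_right])
  then show ?thesis using u_limit[of 0] T LIMSEQ_unique by auto
qed

lemma u0_lower: "t \<in> {0..T} \<Longrightarrow> \<rho> + \<delta> \<le> u0 t"
proof (rule LIMSEQ_le_const[OF u_limit])
  assume t: "t \<in> {0..T}"
  show "\<exists>N. \<forall>n\<ge>N. \<rho> + \<delta> \<le> u (E n) t" using bE t unfolding bounds_def by blast
qed

lemma u_bounded: "t \<in> {0..T} \<Longrightarrow> u (E n) t \<le> C"
  using becker_doring.u_le[OF system[OF E0], of t n] mC[of n] by (simp add: order_trans)

lemma u0_continuous: "continuous_on {0..T} u0"
proof -
  have "\<bar>u0 t - u0 s\<bar> \<le> C * \<bar>t - s\<bar>" if "s \<in> {0..T}" "t \<in> {0..T}" for s t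
  proof (rule LIMSEQ_le_const2)
    show "(\<lambda>n. \<bar>u (E n) t - u (E n) s\<bar>) \<longlonglongrightarrow> \<bar>u0 t - u0 s\<bar>"
      by (intro tendsto_rabs tendsto_diff u_limit that)
    show "\<exists>N. \<forall>n\<ge>N. \<bar>u (E n) t - u (E n) s\<bar> \<le> C * \<bar>t - s\<bar>"
      using bE that unfolding bounds_def by blast
  qed
  then have "C-lipschitz_on {0..T} u0"
    using C by (intro lipschitz_onI) (auto simp: dist_real_def abs_minus_commute)
  then show ?thesis by (rule lipschitz_on_continuous_on)
qed

text \<open>This limit of the flux into the smallest size is the nucleation rate: dimers contribute nothing.\<close>

lemma nucleation_limit:
  assumes t: "t \<in> {0..T}"
  shows "(\<lambda>n. becker_doring.J \<eta> (E n) (\<alpha>\<epsilon> (E n)) (\<beta>\<epsilon> (E n)) (a\<epsilon> (E n)) (b\<epsilon> (E n)) (u (E n)) (c (E n)) 1 t)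
    \<longlonglongrightarrow> \<alpha> * (u0 t)\<^sup>2"
proof -
  have t0: "0 \<le> t" using t by simp
  have J: "becker_doring.J \<eta> (E n) (\<alpha>\<epsilon> (E n)) (\<beta>\<epsilon> (E n)) (a\<epsilon> (E n)) (b\<epsilon> (E n)) (u (E n)) (c (E n)) 1 t
     = \<alpha>\<epsilon> (E n) * (u (E n) t)\<^sup>2 - \<beta>\<epsilon> (E n) * ((E n) powr \<eta> * c (E n) 2 t)" for n
    unfolding becker_doring.J_1[OF system[OF E0]] by simp
  have al: "(\<lambda>n. \<alpha>\<epsilon> (E n)) \<longlonglongrightarrow> \<alpha>" by (rule filterlim_compose[OF alpha_lim E_at_right])
  have be: "(\<lambda>n. \<beta>\<epsilon> (E n)) \<longlonglongrightarrow> \<beta>" by (rule filterlim_compose[OF beta_lim E_at_right])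
  have "(\<lambda>n. E n powr (\<eta> - r_a)) \<longlonglongrightarrow> 0"
    by (rule tendsto_zero_powrI[OF El tendsto_const]) (use eta E0 in \<open>auto intro!: always_eventually less_imp_le\<close>)
  then have 1: "(\<lambda>n. E n powr (\<eta> - r_a) * C) \<longlonglongrightarrow> 0" by (rule tendsto_mult_left_zero)
  have c2: "(\<lambda>n. (E n) powr \<eta> * c (E n) 2 t) \<longlonglongrightarrow> 0"
  proof (rule tendsto_sandwich[OF _ _ tendsto_const 1])
    show "\<forall>\<^sub>F n in sequentially. 0 \<le> E n powr \<eta> * c (E n) 2 t"
      using c_nonneg[OF E0 t0] by (intro always_eventually allI) simp
    show "\<forall>\<^sub>F n in sequentially. E n powr \<eta> * c (E n) 2 t \<le> E n powr (\<eta> - r_a) * C"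
      using nucleation_bound(1)[OF bE t] by (intro always_eventually allI)
  qed
  have "(\<lambda>n. \<alpha>\<epsilon> (E n) * (u (E n) t)\<^sup>2 - \<beta>\<epsilon> (E n) * ((E n) powr \<eta> * c (E n) 2 t)) \<longlonglongrightarrow> \<alpha> * (u0 t)\<^sup>2 - \<beta> * 0"
    by (intro tendsto_diff tendsto_mult tendsto_power al be c2 u_limit t)
  then show ?thesis unfolding J by simp
qed

text \<open>The rate \<open>b\<close> is not approximated at the size 2, where \<open>detach\<close> vanishes instead; as \<open>r_a < 1\<close>, this single
  size carries no mass in the limit.\<close>

lemma eps_c2_limit:
  assumes t: "t \<in> {0..T}"
  shows "(\<lambda>n. E n * c (E n) 2 t) \<longlonglongrightarrow> 0"
proof -
  have t0: "0 \<le> t" using t by simp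
  have "(\<lambda>n. E n powr (1 - r_a)) \<longlonglongrightarrow> 0"
    by (rule tendsto_zero_powrI[OF El tendsto_const]) (use exponents E0 in \<open>auto intro!: always_eventually less_imp_le\<close>)
  then have 1: "(\<lambda>n. E n powr (1 - r_a) * C) \<longlonglongrightarrow> 0" by (rule tendsto_mult_left_zero)
  show ?thesis
  proof (rule tendsto_sandwich[OF _ _ tendsto_const 1])
    show "\<forall>\<^sub>F n in sequentially. 0 \<le> E n * c (E n) 2 t"
      using c_nonneg[OF E0 t0] E0 by (intro always_eventually allI) (simp add: less_imp_le)
    show "\<forall>\<^sub>F n in sequentially. E n * c (E n) 2 t \<le> E n powr (1 - r_a) * C"
    proof (intro always_eventually allI)
      fix n
      have "E n powr (1 - r_a) * E n powr r_a = E n" using E0[of n] by (simp add: powr_add[symmetric])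
      then have "E n * c (E n) 2 t = E n powr (1 - r_a) * (E n powr r_a * c (E n) 2 t)"
        by (simp only: mult.assoc[symmetric])
      also have "\<dots> \<le> E n powr (1 - r_a) * C"
        using bE[of n] t unfolding bounds_def by (intro mult_left_mono) auto
      finally show "E n * c (E n) 2 t \<le> E n powr (1 - r_a) * C" .
    qed
  qed
qed

end

text \<open>A test function together with a box containing its support. All integrations in time stop at \<open>T1 < T\<close>,
  because \<open>\<phi> t\<close> carries no information at \<open>t = T\<close>.\<close>

locale becker_doring_test = becker_doring_limit +
  fixes \<phi> \<phi>t \<phi>x :: "real \<Rightarrow> real \<Rightarrow> real" and T1 X P :: real
  assumes c1: "C1_c T \<phi> \<phi>t \<phi>x" and T1: "0 < T1" "T1 < T" and X: "0 < X" and P: "0 \<le> P"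
    and zero: "\<And>t x. t \<in> {0..<T} \<Longrightarrow> 0 \<le> x \<Longrightarrow> T1 \<le> t \<or> X \<le> x \<Longrightarrow> \<phi> t x = 0 \<and> \<phi>t t x = 0 \<and> \<phi>x t x = 0"
    and bound: "\<And>t x. t \<in> {0..T1} \<Longrightarrow> 0 \<le> x \<Longrightarrow> \<bar>\<phi> t x\<bar> \<le> P \<and> \<bar>\<phi>t t x\<bar> \<le> P \<and> \<bar>\<phi>x t x\<bar> \<le> P"
begin

abbreviation Jn :: "nat \<Rightarrow> nat \<Rightarrow> real \<Rightarrow> real" where
  "Jn n \<equiv> becker_doring.J \<eta> (E n) (\<alpha>\<epsilon> (E n)) (\<beta>\<epsilon> (E n)) (a\<epsilon> (E n)) (b\<epsilon> (E n)) (u (E n)) (c (E n))"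

text \<open>The three parts of the time derivative \<open>D\<close> of \<open>\<Sum> \<epsilon> \<phi>(t, \<epsilon> i) c\<^sub>i\<close> come from the explicit time dependence of \<open>\<phi>\<close>,
  from nucleation at the size 2, and from the transport \<open>Q\<close>.\<close>

definition Q :: "nat \<Rightarrow> real \<Rightarrow> real" where
  "Q n t = (\<Sum>k. (\<phi> t (E n * real (k + 3)) - \<phi> t (E n * real (k + 2))) * Jn n (k + 2) t)"

definition D :: "nat \<Rightarrow> real \<Rightarrow> real" where
  "D n t = S (E n) (\<phi>t t) t + \<phi> t (E n * real 2) * Jn n 1 t + Q n t"

lemma T1_sub: "t \<in> {0..T1} \<Longrightarrow> t \<in> {0..<T}" "t \<in> {0..T1} \<Longrightarrow> t \<in> {0..T}" "t \<in> {0..T1} \<Longrightarrow> 0 \<le> t"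
  using T1 by auto

lemma slices:
  assumes t: "t \<in> {0..T1}"
  shows "\<phi> t \<in> C_c {0..}" "\<phi>t t \<in> C_c {0..}" "\<phi>x t \<in> C_c {0..}"
    "(\<lambda>x. \<phi>x t x * a x) \<in> C_c {0..}" "(\<lambda>x. \<phi>x t x * b x) \<in> C_c {0..}"
  using C1_c_slices[OF c1 T1_sub(1)[OF t]] zero[OF T1_sub(1)[OF t]] X a_cont(1) b_cont(1)
  by (auto intro!: C_c_intro[where X=X] continuous_on_mult)

lemma space_increment:
  assumes t: "t \<in> {0..T1}" and xy: "0 \<le> x" "x \<le> y"
  shows "\<exists>\<xi>\<in>{x..y}. \<phi> t y - \<phi> t x = \<phi>x t \<xi> * (y - x)"
proof (rule mvt_very_simple[OF xy(2)])
  fix z assume "x \<le> z" "z \<le> y"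
  then have "((\<lambda>y. \<phi> t y) has_real_derivative \<phi>x t z) (at z within {x..y})"
    using xy by (intro DERIV_subset[OF C1_c_space_derivative[OF c1 T1_sub(1)[OF t]]]) auto
  then show "(\<phi> t has_derivative (*) (\<phi>x t z)) (at z within {x..y})" by (simp add: has_field_derivative_def)
qed

lemma increment_bound:
  assumes t: "t \<in> {0..T1}"
  shows "\<bar>\<phi> t (E n * real (i + 1)) - \<phi> t (E n * real i)\<bar> \<le> E n * P"
proof -
  note e = E0[of n]
  obtain \<xi> where \<xi>: "\<xi> \<in> {E n * real i..E n * real (i + 1)}"
    "\<phi> t (E n * real (i + 1)) - \<phi> t (E n * real i) = \<phi>x t \<xi> * (E n * real (i + 1) - E n * real i)"
    using space_increment[OF t, of "E n * real i" "E n * real (i + 1)"] e by auto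
  have "0 \<le> E n * real i" using e by simp
  then have "0 \<le> \<xi>" using \<xi>(1) by simp
  then have "\<bar>\<phi>x t \<xi>\<bar> \<le> P" using bound[OF t] by blast
  then have "\<bar>\<phi>x t \<xi>\<bar> * E n \<le> P * E n" using e by (intro mult_right_mono) auto
  moreover have "E n * real (i + 1) - E n * real i = E n" by (simp add: distrib_left)
  ultimately show ?thesis unfolding \<xi>(2) using e by (simp add: abs_mult mult.commute)
qed

lemma tested_deriv:
  assumes t: "t \<in> {0..T1}"
  shows "((\<lambda>s. S (E n) (\<phi> s) s) has_real_derivative D n t) (at t within {0..T1})"
proof -
  note e = E0[of n]
  interpret B: becker_doring \<eta> "E n" "\<alpha>\<epsilon> (E n)" "\<beta>\<epsilon> (E n)" "a\<epsilon> (E n)" "b\<epsilon> (E n)" "u (E n)" "c (E n)" "m\<epsilon> (E n)" K_a K_b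
    by (rule system[OF e])
  obtain N :: nat where N: "X / E n < real N" using reals_Archimedean2 by blast
  have far: "X \<le> E n * real (k + 2)" if "N \<le> k" for k
  proof -
    have "X < E n * real N" using N e by (simp add: divide_less_eq mult.commute)
    also have "\<dots> \<le> E n * real (k + 2)" using that e by (intro mult_left_mono) auto
    finally show ?thesis by simp
  qed
  have z: "\<phi> s (E n * real (k + 2)) = 0" "\<phi>t s (E n * real (k + 2)) = 0" if "N \<le> k" "s \<in> {0..T1}" for k s
    using zero[OF T1_sub(1)[OF that(2)], of "E n * real (k + 2)"] far[OF that(1)] e by auto
  define w where "w i = \<phi> t (E n * real i)" for i :: nat
  have fin: "S (E n) (\<phi> s) s = (\<Sum>k<Suc N. E n * \<phi> s (E n * real (k + 2)) * c (E n) (k + 2) s)" if "s \<in> {0..T1}" for s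
    unfolding S_def by (rule suminf_finite) (use z(1)[OF _ that] in \<open>auto simp del: add_2_eq_Suc'\<close>)
  have fint: "S (E n) (\<phi>t t) t = (\<Sum>k<Suc N. E n * \<phi>t t (E n * real (k + 2)) * c (E n) (k + 2) t)"
    unfolding S_def by (rule suminf_finite) (use z(2)[OF _ t] in \<open>auto simp del: add_2_eq_Suc'\<close>)
  have finQ: "Q n t = (\<Sum>k<N. (w (k + 3) - w (k + 2)) * Jn n (k + 2) t)"
    unfolding Q_def w_def
  proof (rule suminf_finite)
    fix k assume "k \<notin> {..<N}"
    then have "\<phi> t (E n * real (k + 2)) = 0" "\<phi> t (E n * real (Suc k + 2)) = 0" using z(1)[of k t] z(1)[of "Suc k" t] t by (auto simp del: add_2_eq_Suc')
    then show "(\<phi> t (E n * real (k + 3)) - \<phi> t (E n * real (k + 2))) * Jn n (k + 2) t = 0" by (simp add: numeral_eq_Suc)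
  qed simp
  have wN: "w (N + 2) = 0" unfolding w_def using z(1)[of N t] t by simp
  have "((\<lambda>s. \<Sum>k<Suc N. E n * \<phi> s (E n * real (k + 2)) * c (E n) (k + 2) s) has_real_derivative
     (\<Sum>k<Suc N. E n * \<phi>t t (E n * real (k + 2)) * c (E n) (k + 2) t + w (k + 2) * (Jn n (k + 1) t - Jn n (k + 2) t))) (at t within {0..T1})"
  proof (rule DERIV_sum)
    fix k
    have "((\<lambda>s. \<phi> s (E n * real (k + 2))) has_real_derivative \<phi>t t (E n * real (k + 2))) (at t within {0..T1})"
      by (rule DERIV_subset[OF C1_c_time_derivative[OF c1 T1_sub(1)[OF t]]]) (use e T1 in auto)
    moreover have "(c (E n) (k + 2) has_real_derivative (1 / E n) * (Jn n (k + 1) t - Jn n (k + 2) t)) (at t within {0..T1})"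
      by (rule DERIV_subset[OF B.c_deriv[OF T1_sub(3)[OF t]]]) auto
    ultimately have "((\<lambda>s. E n * \<phi> s (E n * real (k + 2)) * c (E n) (k + 2) s) has_real_derivative
       (E n * \<phi>t t (E n * real (k + 2))) * c (E n) (k + 2) t
        + ((1 / E n) * (Jn n (k + 1) t - Jn n (k + 2) t)) * (E n * \<phi> t (E n * real (k + 2)))) (at t within {0..T1})"
      by (intro DERIV_mult DERIV_cmult)
    also have "((1 / E n) * (Jn n (k + 1) t - Jn n (k + 2) t)) * (E n * \<phi> t (E n * real (k + 2))) = w (k + 2) * (Jn n (k + 1) t - Jn n (k + 2) t)"
      using e by (simp add: w_def)
    finally show "((\<lambda>s. E n * \<phi> s (E n * real (k + 2)) * c (E n) (k + 2) s) has_real_derivative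
       E n * \<phi>t t (E n * real (k + 2)) * c (E n) (k + 2) t + w (k + 2) * (Jn n (k + 1) t - Jn n (k + 2) t)) (at t within {0..T1})" .
  qed
  also have "(\<Sum>k<Suc N. E n * \<phi>t t (E n * real (k + 2)) * c (E n) (k + 2) t + w (k + 2) * (Jn n (k + 1) t - Jn n (k + 2) t)) = D n t"
    unfolding sum.distrib fint[symmetric] summation_by_parts_flux[of w "\<lambda>i. Jn n i t" N] D_def finQ wN
    by (simp add: w_def)
  finally have "((\<lambda>s. \<Sum>k<Suc N. E n * \<phi> s (E n * real (k + 2)) * c (E n) (k + 2) s) has_real_derivative D n t) (at t within {0..T1})" .
  then show ?thesis
    by (rule has_field_derivative_transform_within[OF _ zero_less_one t]) (simp only: fin)
qed

lemma D_has_integral: "(D n has_integral - S (E n) (\<phi> 0) 0) {0..T1}"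
proof -
  have "(D n has_integral S (E n) (\<phi> T1) T1 - S (E n) (\<phi> 0) 0) {0..T1}"
    using tested_deriv T1
    by (intro fundamental_theorem_of_calculus) (auto simp: has_real_derivative_iff_has_vector_derivative)
  moreover have "S (E n) (\<phi> T1) T1 = 0"
  proof -
    have "\<phi> T1 (E n * real (k + 2)) = 0" for k using zero[of T1 "E n * real (k + 2)"] T1 E0[of n] by simp
    then show ?thesis unfolding S_def by (simp only: mult_zero_right mult_zero_left suminf_zero)
  qed
  ultimately show ?thesis by simp
qed

lemma D_bounded:
  assumes t: "t \<in> {0..T1}"
  shows "\<bar>D n t\<bar> \<le> P * C + P * (C * C\<^sup>2 + C * C) + P * ((K_a * C + K_b) * (C + C))"
proof -
  note e = E0[of n]
  interpret B: becker_doring \<eta> "E n" "\<alpha>\<epsilon> (E n)" "\<beta>\<epsilon> (E n)" "a\<epsilon> (E n)" "b\<epsilon> (E n)" "u (E n)" "c (E n)" "m\<epsilon> (E n)" K_a K_b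
    by (rule system[OF e])
  note t0 = T1_sub(3)[OF t] and tT = T1_sub(2)[OF t]
  have "\<bar>S (E n) (\<phi>t t) t\<bar> \<le> P * number (E n) t" by (rule S_abs_le[OF e t0]) (use bound[OF t] in blast)
  also have "\<dots> \<le> P * C" using numC[OF tT, of n] P by (intro mult_left_mono) auto
  finally have 1: "\<bar>S (E n) (\<phi>t t) t\<bar> \<le> P * C" .
  have "0 \<le> E n * real 2" using e by simp
  then have 2: "\<bar>\<phi> t (E n * real 2) * Jn n 1 t\<bar> \<le> P * (C * C\<^sup>2 + C * C)"
    unfolding abs_mult using nucleation_bound(2)[OF bE tT, of n] bound[OF t] P
    by (intro mult_mono) auto
  have "E n * \<bar>Q n t\<bar> \<le> (E n * P) * ((K_a * m\<epsilon> (E n) + K_b) * (B.number t + m\<epsilon> (E n)))"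
    unfolding Q_def by (rule B.summable_increment_J(2)[OF t0, where g="\<lambda>i. \<phi> t (E n * real i)"]) (rule increment_bound[OF t])
  then have "\<bar>Q n t\<bar> \<le> P * ((K_a * m\<epsilon> (E n) + K_b) * (B.number t + m\<epsilon> (E n)))" using e by simp
  also have "\<dots> \<le> P * ((K_a * C + K_b) * (C + C))"
  proof -
    have "B.number t \<le> C" using numC[OF tT, of n] by (simp add: S_eq_mom[OF e])
    then show ?thesis using P mC[of n] growth_pos C B.m_nonneg B.number_nonneg[OF t0]
      by (intro mult_left_mono mult_mono add_mono) auto
  qed
  finally have 3: "\<bar>Q n t\<bar> \<le> P * ((K_a * C + K_b) * (C + C))" .
  show ?thesis unfolding D_def using 1 2 3 by linarith
qed

text \<open>The difference quotients of \<open>\<phi>\<close> and the discrete rates are replaced by \<open>\<phi>x\<close>, \<open>a\<close> and \<open>b\<close>, all uniformly on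
  the support; what remains is a difference of sampled sums. It converges because \<open>\<phi>x a\<close> and \<open>\<phi>x b\<close> are
  continuous up to the origin, even if the limit measure charges it.\<close>

lemma Q_limit:
  assumes t: "t \<in> {0..T1}"
  shows "(\<lambda>n. Q n t) \<longlonglongrightarrow> (\<integral>x. (a x * u0 t - b x) * \<phi>x t x \<partial>\<mu> t)"
proof -
  note t0 = T1_sub(3)[OF t] and tT = T1_sub(2)[OF t]
  note px = slices(3)[OF t] and pa = slices(4)[OF t] and pb = slices(5)[OF t]
  define R where "R n = S (E n) (\<lambda>x. \<phi>x t x * a x) t * u (E n) t - S (E n) (\<lambda>x. \<phi>x t x * b x) t" for n
  have "R \<longlonglongrightarrow> (\<integral>x. \<phi>x t x * a x \<partial>\<mu> t) * u0 t - (\<integral>x. \<phi>x t x * b x \<partial>\<mu> t)"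
    unfolding R_def by (intro tendsto_diff tendsto_mult S_limit pa pb u_limit tT)
  also have "(\<integral>x. \<phi>x t x * a x \<partial>\<mu> t) * u0 t - (\<integral>x. \<phi>x t x * b x \<partial>\<mu> t) = (\<integral>x. (a x * u0 t - b x) * \<phi>x t x \<partial>\<mu> t)"
  proof -
    have i: "integrable (\<mu> t) f" if f: "f \<in> C_c {0..}" for f
    proof -
      obtain B where "0 < B" "\<forall>x\<ge>0. \<bar>f x\<bar> \<le> B" using C_c_bounded[OF f] by (elim exE conjE) (rule that)
      then show ?thesis by (intro integrable_M_f[OF \<mu>_M_f[OF tT] C_c_continuous[OF f], where B=B]) auto
    qed
    have "(\<integral>x. (\<phi>x t x * a x) * u0 t - \<phi>x t x * b x \<partial>\<mu> t) = (\<integral>x. \<phi>x t x * a x \<partial>\<mu> t) * u0 t - (\<integral>x. \<phi>x t x * b x \<partial>\<mu> t)"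
      using i[OF pa] i[OF pb] by (subst Bochner_Integration.integral_diff) auto
    then show ?thesis by (simp add: algebra_simps)
  qed
  finally have Rlim: "R \<longlonglongrightarrow> (\<integral>x. (a x * u0 t - b x) * \<phi>x t x \<partial>\<mu> t)" .
  \<comment> \<open>the backward difference looks one cell to the left, and cells are no wider than 1\<close>
  define X2 where "X2 = X + 1"
  have X2: "0 < X2" using X by (simp add: X2_def)
  define A where "A = K_a * (1 + X2)"
  define B' where "B' = K_b * (1 + X2)"
  have AB: "0 \<le> A" "0 \<le> B'" using growth_pos X2 by (simp_all add: A_def B'_def)
  have cb: "compact (b ` {0..X2})" by (intro compact_continuous_image continuous_on_subset[OF b_cont(1)]) auto
  obtain b0 where b0: "\<forall>y\<in>b ` {0..X2}. norm y \<le> b0"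
    using compact_imp_bounded[OF cb] unfolding bounded_iff by (elim exE) (rule that)
  define Bb where "Bb = max 0 b0"
  have Bb: "0 \<le> Bb" "b x \<le> Bb" if "x \<in> {0..X2}" for x
  proof -
    have "norm (b x) \<le> b0" using b0 that by blast
    then show "0 \<le> Bb" "b x \<le> Bb" by (auto simp: Bb_def)
  qed
  define Z1 where "Z1 = A * C + P * C + B' + P"
  define Z where "Z = Z1 * C + P * Bb"
  have Bb0: "0 \<le> Bb" by (simp add: Bb_def)
  have Z1: "0 \<le> Z1" using AB C P by (simp add: Z1_def)
  have Z: "0 \<le> Z" using Z1 C P Bb0 by (simp add: Z_def)
  have close: "\<forall>\<^sub>F n in sequentially. \<bar>Q n t - R n\<bar> \<le> \<omega> * Z" if \<omega>: "0 < \<omega>" for \<omega>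
  proof -
    obtain d where d: "0 < d" "\<forall>x\<ge>0. \<forall>y\<ge>0. \<bar>x - y\<bar> \<le> d \<longrightarrow> \<bar>\<phi>x t x - \<phi>x t y\<bar> \<le> \<omega>"
      using C_c_uniformly_continuous[OF px \<omega>] by (elim exE conjE) (rule that)
    have ev1: "\<forall>\<^sub>F n in sequentially. E n < d" by (rule order_tendstoD(2)[OF El d(1)])
    have ev2: "\<forall>\<^sub>F n in sequentially. E n * c (E n) 2 t < \<omega>" by (rule order_tendstoD(2)[OF eps_c2_limit[OF tT] \<omega>])
    have cp: "compact {0..X2} \<and> {0..X2} \<subseteq> {0..}" by auto
    have "\<forall>\<^sub>F \<epsilon> in at_right 0. \<forall>x\<in>{0..X2}. dist (step_fun 2 \<epsilon> (a\<epsilon> \<epsilon>) x) (a x) < \<omega>"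
      using a_lim[rule_format, OF cp] \<omega> by (auto simp: uniform_limit_iff)
    then have ev3: "\<forall>\<^sub>F n in sequentially. \<forall>x\<in>{0..X2}. dist (step_fun 2 (E n) (a\<epsilon> (E n)) x) (a x) < \<omega>"
      using E_at_right unfolding filterlim_iff by blast
    have "\<forall>\<^sub>F \<epsilon> in at_right 0. \<forall>x\<in>{0..X2}. dist (step_fun 3 \<epsilon> (b\<epsilon> \<epsilon>) x) (b x) < \<omega>"
      using b_lim[rule_format, OF cp] \<omega> by (auto simp: uniform_limit_iff)
    then have ev4: "\<forall>\<^sub>F n in sequentially. \<forall>x\<in>{0..X2}. dist (step_fun 3 (E n) (b\<epsilon> (E n)) x) (b x) < \<omega>"
      using E_at_right unfolding filterlim_iff by blast
    from ev1 ev2 ev3 ev4 show ?thesis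
    proof eventually_elim
      case (elim n)
      note e = E0[of n] and e1 = E1[of n]
      interpret B: becker_doring \<eta> "E n" "\<alpha>\<epsilon> (E n)" "\<beta>\<epsilon> (E n)" "a\<epsilon> (E n)" "b\<epsilon> (E n)" "u (E n)" "c (E n)" "m\<epsilon> (E n)" K_a K_b
        by (rule system[OF e])
      define g where "g i = \<phi> t (E n * real i)" for i :: nat
      define V where "V = u (E n) t"
      have V: "0 \<le> V" "V \<le> C" using B.u_nonneg[OF t0] u_bounded[OF tT, of n] by (auto simp: V_def)
      define Y where "Y k = ((g (k + 3) - g (k + 2)) * (a\<epsilon> (E n) (k + 2) * V) - (g (k + 2) - g (k + 1)) * B.detach (k + 2)) * c (E n) (k + 2) t" for k
      define W where "W k = E n * (\<phi>x t (E n * real (k + 2)) * a (E n * real (k + 2))) * c (E n) (k + 2) t * V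
          - E n * (\<phi>x t (E n * real (k + 2)) * b (E n * real (k + 2))) * c (E n) (k + 2) t" for k
      define r where "r k = \<omega> * Z1 * (E n * 1 * c (E n) (k + 2) t) + P * Bb * (if k = 0 then E n * c (E n) 2 t else 0)" for k :: nat
      have Ys: "Y sums Q n t"
        unfolding Y_def Q_def V_def g_def
        by (rule B.flux_transport[OF t0, where g="\<lambda>i. \<phi> t (E n * real i)"]) (rule increment_bound[OF t])
      have Ws: "W sums R n"
      proof -
        have s: "(\<lambda>k. sample (E n) f k t) sums S (E n) f t" if f: "f \<in> C_c {0..}" for f
        proof -
          obtain B where "0 < B" "\<forall>x\<ge>0. \<bar>f x\<bar> \<le> B" using C_c_bounded[OF f] by (elim exE conjE) (rule that)
          then show ?thesis unfolding S_def by (intro summable_sums S_summable_bounded[OF e t0, where B=B]) auto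
        qed
        show ?thesis unfolding W_def R_def V_def[symmetric] by (intro sums_diff sums_mult2 s pa pb)
      qed
      have cn: "0 \<le> c (E n) (k + 2) t" for k by (rule c_nonneg[OF e t0]) simp
      have rs: "r sums (\<omega> * Z1 * number (E n) t + P * Bb * (E n * c (E n) 2 t))"
      proof -
        have "(\<lambda>k. E n * 1 * c (E n) (k + 2) t) sums number (E n) t"
          unfolding S_def by (intro summable_sums S_summable_bounded[OF e t0, where B=1]) simp
        moreover have "(\<lambda>k. if k = 0 then E n * c (E n) 2 t else 0) sums (E n * c (E n) 2 t)"
          using sums_single[of 0 "\<lambda>_. E n * c (E n) 2 t"] by simp
        ultimately show ?thesis unfolding r_def by (intro sums_add sums_mult)
      qed
      have YW: "norm (Y k - W k) \<le> r k" for k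
      proof -
        define x where "x = E n * real (k + 2)"
        have x: "2 * E n \<le> x" "0 \<le> x" using e by (auto simp: x_def)
        have g3: "g (k + 3) = \<phi> t (x + E n)" by (simp add: g_def x_def algebra_simps)
        have g2: "g (k + 2) = \<phi> t x" by (simp add: g_def x_def)
        have g1: "g (k + 1) = \<phi> t (x - E n)" by (simp add: g_def x_def algebra_simps)
        have rn: "0 \<le> r k" unfolding r_def using \<omega> Z1 e cn[of k] c_nonneg[OF e t0, of 2] P Bb0
          by (intro add_nonneg_nonneg mult_nonneg_nonneg) auto
        show ?thesis
        proof (cases "X2 \<le> x")
          case True
          then have "X \<le> x - E n" "X \<le> x" "X \<le> x + E n" using e e1 by (auto simp: X2_def)
          then have "\<phi> t (x - E n) = 0" "\<phi> t x = 0" "\<phi> t (x + E n) = 0" "\<phi>x t x = 0"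
            using zero[OF T1_sub(1)[OF t]] X by auto
          then have "Y k = 0" "W k = 0" unfolding Y_def W_def g1 g2 g3 x_def[symmetric] by simp_all
          then show ?thesis using rn by simp
        next
          case False
          then have xX: "x \<in> {0..X2}" using x by simp
          define f where "f = \<phi>x t x"
          have fP: "\<bar>f\<bar> \<le> P" using bound[OF t x(2)] by (simp add: f_def)
          define d1 where "d1 = g (k + 3) - g (k + 2)"
          define d0 where "d0 = g (k + 2) - g (k + 1)"
          have d1: "\<bar>d1 - E n * f\<bar> \<le> E n * \<omega>"
          proof -
            obtain \<xi> where \<xi>: "\<xi> \<in> {x..x + E n}" "\<phi> t (x + E n) - \<phi> t x = \<phi>x t \<xi> * (x + E n - x)"
              using space_increment[OF t x(2), of "x + E n"] e by auto
            have "\<bar>\<phi>x t \<xi> - f\<bar> \<le> \<omega>" unfolding f_def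
              by (rule d(2)[rule_format]) (use \<xi>(1) x elim(1) in auto)
            then have "E n * \<bar>\<phi>x t \<xi> - f\<bar> \<le> E n * \<omega>" using e by (intro mult_left_mono) auto
            moreover have "d1 - E n * f = E n * (\<phi>x t \<xi> - f)" unfolding d1_def g3 g2 \<xi>(2) by (simp add: algebra_simps)
            ultimately show ?thesis using e by (simp add: abs_mult)
          qed
          have d0: "\<bar>d0 - E n * f\<bar> \<le> E n * \<omega>"
          proof -
            obtain \<xi> where \<xi>: "\<xi> \<in> {x - E n..x}" "\<phi> t x - \<phi> t (x - E n) = \<phi>x t \<xi> * (x - (x - E n))"
              using space_increment[OF t, of "x - E n" x] e x by auto
            have "\<bar>\<phi>x t \<xi> - f\<bar> \<le> \<omega>" unfolding f_def
              by (rule d(2)[rule_format]) (use \<xi>(1) x e elim(1) in auto)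
            then have "E n * \<bar>\<phi>x t \<xi> - f\<bar> \<le> E n * \<omega>" using e by (intro mult_left_mono) auto
            moreover have "d0 - E n * f = E n * (\<phi>x t \<xi> - f)" unfolding d0_def g1 g2 \<xi>(2) by (simp add: algebra_simps)
            ultimately show ?thesis using e by (simp add: abs_mult)
          qed
          define p where "p = a\<epsilon> (E n) (k + 2)"
          define q where "q = B.detach (k + 2)"
          have pA: "0 \<le> p" "p \<le> A"
          proof -
            show "0 \<le> p" unfolding p_def using B.a_pos[of "k + 2"] by simp
            have "p \<le> K_a * (1 + x)" unfolding p_def x_def by (rule B.a_le) simp
            also have "\<dots> \<le> A" unfolding A_def using xX growth_pos by (intro mult_left_mono) auto
            finally show "p \<le> A" .
          qed
          have qB: "0 \<le> q" "q \<le> B'"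
          proof -
            show "0 \<le> q" unfolding q_def by (rule B.detach_nonneg)
            have "q \<le> K_b * (1 + x)" unfolding q_def x_def by (rule B.detach_le)
            also have "\<dots> \<le> B'" unfolding B'_def using xX growth_pos by (intro mult_left_mono) auto
            finally show "q \<le> B'" .
          qed
          have pa: "\<bar>p - a x\<bar> \<le> \<omega>"
            using bspec[OF elim(3) xX] step_fun_centre[OF e, of 2 "k + 2" "a\<epsilon> (E n)"]
            by (simp add: x_def p_def dist_real_def)
          have qb: "\<bar>q - b x\<bar> \<le> (if k = 0 then Bb else \<omega>)"
          proof (cases "k = 0")
            case True
            have "0 \<le> b x" using b_cont(2) x by simp
            then show ?thesis using True Bb(2)[OF xX] by (simp add: q_def B.detach_def)
          next
            case False
            then have "q = b\<epsilon> (E n) (k + 2)" by (simp add: q_def B.detach_def)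
            then show ?thesis
              using bspec[OF elim(4) xX] step_fun_centre[OF e, of 3 "k + 2" "b\<epsilon> (E n)"] False
              by (simp add: x_def dist_real_def)
          qed
          have i1: "\<bar>(d1 - E n * f) * p\<bar> \<le> (E n * \<omega>) * A"
            unfolding abs_mult using d1 pA e \<omega> by (intro mult_mono) auto
          have i2: "\<bar>(E n * f) * (p - a x)\<bar> \<le> (E n * P) * \<omega>"
            unfolding abs_mult using fP pa e P by (intro mult_mono) auto
          have "\<bar>d1 * p - E n * f * a x\<bar> \<le> (E n * \<omega>) * A + (E n * P) * \<omega>"
          proof -
            have "d1 * p - E n * f * a x = (d1 - E n * f) * p + (E n * f) * (p - a x)" by algebra
            then show ?thesis using i1 i2 by linarith
          qed
          then have j1: "\<bar>(d1 * p - E n * f * a x) * V\<bar> \<le> ((E n * \<omega>) * A + (E n * P) * \<omega>) * C"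
            unfolding abs_mult using V e \<omega> P AB by (intro mult_mono) auto
          have i3: "\<bar>(d0 - E n * f) * q\<bar> \<le> (E n * \<omega>) * B'"
            unfolding abs_mult using d0 qB e \<omega> by (intro mult_mono) auto
          have i4: "\<bar>(E n * f) * (q - b x)\<bar> \<le> (E n * P) * (if k = 0 then Bb else \<omega>)"
            unfolding abs_mult using fP qb e P by (intro mult_mono) auto
          have i5: "(E n * P) * (if k = 0 then Bb else \<omega>) \<le> (E n * P) * \<omega> + (if k = 0 then E n * P * Bb else 0)"
            using e P \<omega> by simp
          have j2: "\<bar>d0 * q - E n * f * b x\<bar> \<le> (E n * \<omega>) * B' + (E n * P) * \<omega> + (if k = 0 then E n * P * Bb else 0)"
          proof -
            have "d0 * q - E n * f * b x = (d0 - E n * f) * q + (E n * f) * (q - b x)" by algebra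
            then show ?thesis using i3 i4 i5 by linarith
          qed
          have "Y k - W k = ((d1 * p - E n * f * a x) * V - (d0 * q - E n * f * b x)) * c (E n) (k + 2) t"
            unfolding Y_def W_def d1_def d0_def p_def q_def f_def x_def by algebra
          then have "norm (Y k - W k) = \<bar>(d1 * p - E n * f * a x) * V - (d0 * q - E n * f * b x)\<bar> * c (E n) (k + 2) t"
            using cn[of k] by (simp add: abs_mult)
          also have "\<dots> \<le> (((E n * \<omega>) * A + (E n * P) * \<omega>) * C + ((E n * \<omega>) * B' + (E n * P) * \<omega> + (if k = 0 then E n * P * Bb else 0))) * c (E n) (k + 2) t"
            using j1 j2 by (intro mult_right_mono cn) linarith
          also have "\<dots> = r k"
            unfolding r_def Z1_def by (cases "k = 0") (simp_all add: algebra_simps numeral_2_eq_2)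
          finally show ?thesis .
        qed
      qed
      have "\<bar>Q n t - R n\<bar> \<le> \<omega> * Z1 * number (E n) t + P * Bb * (E n * c (E n) 2 t)"
        using norm_suminf_le[OF YW sums_summable[OF rs]] sums_unique[OF sums_diff[OF Ys Ws]] sums_unique[OF rs] by simp
      also have "\<dots> \<le> \<omega> * Z1 * C + P * Bb * \<omega>"
        using numC[OF tT, of n] elim(2) \<omega> Z1 P Bb0 by (intro add_mono mult_left_mono) auto
      also have "\<dots> = \<omega> * Z" by (simp add: Z_def algebra_simps)
      finally show ?case .
    qed
  qed
  have "(\<lambda>n. Q n t - R n) \<longlonglongrightarrow> 0"
  proof (rule tendstoI)
    fix \<theta> :: real assume \<theta>: "0 < \<theta>"
    define \<omega> where "\<omega> = \<theta> / (Z + 1)"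
    have \<omega>: "0 < \<omega>" using \<theta> Z by (simp add: \<omega>_def)
    have "\<omega> * Z < \<omega> * (Z + 1)" using \<omega> by simp
    also have "\<dots> = \<theta>" using Z by (simp add: \<omega>_def)
    finally have "\<omega> * Z < \<theta>" .
    then show "\<forall>\<^sub>F n in sequentially. dist (Q n t - R n) 0 < \<theta>"
      using close[OF \<omega>] by (auto elim!: eventually_mono)
  qed
  from tendsto_add[OF this Rlim] show ?thesis by simp
qed

end

text \<open>The value of \<open>h\<close> at \<open>T\<close> is arbitrary, so the two integrands agree only off a null set.\<close>

lemma integral_lebesgue_on_extend:
  fixes h :: "real \<Rightarrow> real"
  assumes T1: "0 < T1" "T1 < T" and h: "h absolutely_integrable_on {0..T1}"
    and z: "\<And>t. T1 < t \<Longrightarrow> t < T \<Longrightarrow> h t = 0"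
  shows "(\<integral>t. h t \<partial>lebesgue_on {0..T}) = integral {0..T1} h"
proof -
  have "(\<integral>t. h t \<partial>lebesgue_on {0..T}) = (\<integral>t. indicator {0..T} t *\<^sub>R h t \<partial>lebesgue)"
    by (rule integral_restrict_space) simp
  also have "\<dots> = (\<integral>t. indicator {0..T1} t *\<^sub>R h t \<partial>lebesgue)"
  proof (rule integral_discrete_difference[where X="{T}"])
    fix t assume "t \<notin> {T}"
    then show "indicator {0..T} t *\<^sub>R h t = indicator {0..T1} t *\<^sub>R h t"
      using z[of t] T1 by (auto simp: indicator_def)
  qed auto
  also have "\<dots> = integral {0..T1} h"
    using set_lebesgue_integral_eq_integral(2)[OF h] by (simp add: set_lebesgue_integral_def)
  finally show ?thesis .
qed

context becker_doring_test
begin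

definition F :: "real \<Rightarrow> real" where
  "F t = (\<integral>x. \<phi>t t x + (a x * u0 t - b x) * \<phi>x t x \<partial>\<mu> t)"

definition G :: "real \<Rightarrow> real" where
  "G t = \<phi> t 0 * (\<alpha> * (u0 t)\<^sup>2)"

lemma D_limit:
  assumes t: "t \<in> {0..T1}"
  shows "(\<lambda>n. D n t) \<longlonglongrightarrow> F t + G t"
proof -
  note tT = T1_sub(2)[OF t]
  have i: "integrable (\<mu> t) f" if f: "f \<in> C_c {0..}" for f
  proof -
    obtain B where "0 < B" "\<forall>x\<ge>0. \<bar>f x\<bar> \<le> B" using C_c_bounded[OF f] by (elim exE conjE) (rule that)
    then show ?thesis by (intro integrable_M_f[OF \<mu>_M_f[OF tT] C_c_continuous[OF f], where B=B]) auto
  qed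
  have "integrable (\<mu> t) (\<lambda>x. (\<phi>x t x * a x) * u0 t - \<phi>x t x * b x)"
    using i[OF slices(4)[OF t]] i[OF slices(5)[OF t]] by auto
  then have i2: "integrable (\<mu> t) (\<lambda>x. (a x * u0 t - b x) * \<phi>x t x)" by (simp add: algebra_simps)
  have F: "F t = (\<integral>x. \<phi>t t x \<partial>\<mu> t) + (\<integral>x. (a x * u0 t - b x) * \<phi>x t x \<partial>\<mu> t)"
    unfolding F_def by (rule Bochner_Integration.integral_add[OF i[OF slices(2)[OF t]] i2])
  have "(\<lambda>n. E n * real 2) \<longlonglongrightarrow> 0" using El by (rule tendsto_mult_left_zero)
  then have "(\<lambda>n. \<phi> t (E n * real 2)) \<longlonglongrightarrow> \<phi> t 0"
    by (rule continuous_on_tendsto_compose[OF C_c_continuous[OF slices(1)[OF t]]])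
       (use E0 in \<open>auto intro!: always_eventually simp: less_imp_le\<close>)
  then have "(\<lambda>n. S (E n) (\<phi>t t) t + \<phi> t (E n * real 2) * Jn n 1 t + Q n t) \<longlonglongrightarrow>
     (\<integral>x. \<phi>t t x \<partial>\<mu> t) + \<phi> t 0 * (\<alpha> * (u0 t)\<^sup>2) + (\<integral>x. (a x * u0 t - b x) * \<phi>x t x \<partial>\<mu> t)"
    by (intro tendsto_add tendsto_mult S_limit slices t tT nucleation_limit Q_limit)
  then show ?thesis unfolding D_def F G_def by (simp add: algebra_simps)
qed

lemma weak_identity: "((\<lambda>t. F t + G t) has_integral - (\<integral>x. \<phi> 0 x \<partial>\<mu>_in)) {0..T1}"
proof -
  define B where "B = P * C + P * (C * C\<^sup>2 + C * C) + P * ((K_a * C + K_b) * (C + C))"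
  have i: "D n integrable_on {0..T1}" for n using D_has_integral by blast
  have h: "(\<lambda>_. B) integrable_on {0..T1}" by (rule integrable_const_ivl)
  have bd: "norm (D n t) \<le> B" if "t \<in> {0..T1}" for n t using D_bounded[OF that] by (simp add: B_def)
  note dct = dominated_convergence[of D "{0..T1}" "\<lambda>_. B" "\<lambda>t. F t + G t", OF i h bd D_limit]
  have z: "(0 :: real) \<in> {0..T1}" "(0 :: real) \<in> {0..T}" using T1 T by auto
  have "integral {0..T1} (D n) = - S (E n) (\<phi> 0) 0" for n using D_has_integral by (rule integral_unique)
  then have "(\<lambda>n. - S (E n) (\<phi> 0) 0) \<longlonglongrightarrow> integral {0..T1} (\<lambda>t. F t + G t)" using dct(2) by simp
  moreover have "(\<lambda>n. - S (E n) (\<phi> 0) 0) \<longlonglongrightarrow> - (\<integral>x. \<phi> 0 x \<partial>\<mu>_in)"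
    using tendsto_minus[OF S_limit[OF slices(1)[OF z(1)] z(2)]] initial_measure[OF slices(1)[OF z(1)]] by simp
  ultimately have "integral {0..T1} (\<lambda>t. F t + G t) = - (\<integral>x. \<phi> 0 x \<partial>\<mu>_in)" by (rule LIMSEQ_unique)
  then show ?thesis using dct(1) integrable_integral by metis
qed

lemma weak_formulation:
  "(\<integral>t. (\<integral>x. \<phi>t t x + (a x * u0 t - b x) * \<phi>x t x \<partial>\<mu> t) \<partial>lebesgue_on {0..T}) +
     (\<integral>x. \<phi> 0 x \<partial>\<mu>_in) + (\<integral>s. \<phi> s 0 * (\<alpha> * (u0 s)\<^sup>2) \<partial>lebesgue_on {0..T}) = 0"
proof -
  have c\<phi>: "continuous_on {0..T1} (\<lambda>t. \<phi> t 0)"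
    unfolding continuous_on_eq_continuous_within
  proof
    fix t assume "t \<in> {0..T1}"
    then have "((\<lambda>s. \<phi> s 0) has_real_derivative \<phi>t t 0) (at t within {0..T1})"
      by (intro DERIV_subset[OF C1_c_time_derivative[OF c1 T1_sub(1)]]) (use T1 in auto)
    then show "continuous (at t within {0..T1}) (\<lambda>t. \<phi> t 0)" by (rule DERIV_continuous)
  qed
  have "continuous_on {0..T1} G"
    unfolding G_def using T1
    by (intro continuous_intros c\<phi> continuous_on_subset[OF u0_continuous]) auto
  then have G: "G absolutely_integrable_on {0..T1}" by (rule absolutely_integrable_continuous_real)
  define B where "B = P * C + P * (C * C\<^sup>2 + C * C) + P * ((K_a * C + K_b) * (C + C))"
  have "norm (F t + G t) \<le> B" if t: "t \<in> {0..T1}" for t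
  proof (rule LIMSEQ_le_const2[OF tendsto_norm[OF D_limit[OF t]]])
    show "\<exists>N. \<forall>n\<ge>N. norm (D n t) \<le> B" using D_bounded[OF t] by (simp add: B_def)
  qed
  then have FG: "(\<lambda>t. F t + G t) absolutely_integrable_on {0..T1}"
    using weak_identity by (intro absolutely_integrable_integrable_bound[where g="\<lambda>_. B"]) auto
  have "(\<lambda>t. (F t + G t) - G t) absolutely_integrable_on {0..T1}" by (rule set_integral_diff(1)[OF FG G])
  then have F: "F absolutely_integrable_on {0..T1}" by simp
  have F0: "F t = 0" if t: "T1 < t" "t < T" for t
  proof -
    have "t \<in> {0..<T}" "t \<in> {0..T}" using t T1 by auto
    then have "\<phi>t t x + (a x * u0 t - b x) * \<phi>x t x = 0" if "x \<in> space (\<mu> t)" for x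
      using zero[of t x] t that M_f_D(1)[OF \<mu>_M_f] by auto
    then have "F t = (\<integral>x. 0 \<partial>\<mu> t)" unfolding F_def by (intro Bochner_Integration.integral_cong) auto
    then show ?thesis by simp
  qed
  have G0: "G t = 0" if t: "T1 < t" "t < T" for t
    using zero[of t 0] t T1 by (simp add: G_def)
  have "integral {0..T1} F + integral {0..T1} G = integral {0..T1} (\<lambda>t. F t + G t)"
    using F G set_lebesgue_integral_eq_integral(1) by (intro Henstock_Kurzweil_Integration.integral_add[symmetric]) auto
  also have "\<dots> = - (\<integral>x. \<phi> 0 x \<partial>\<mu>_in)" by (rule integral_unique[OF weak_identity])
  finally show ?thesis
    using integral_lebesgue_on_extend[OF T1 F F0] integral_lebesgue_on_extend[OF T1 G G0]
    unfolding F_def G_def by linarith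
qed

end

context becker_doring_limit
begin

lemma measurable_lebesgue_on: "continuous_on {0..T} f \<Longrightarrow> f \<in> borel_measurable (lebesgue_on {0..T})"
  for f :: "real \<Rightarrow> real"
  by (intro continuous_imp_measurable_on_sets_lebesgue) auto

lemma limit_is_solution:
  assumes mass: "\<And>t. t \<in> {0..T} \<Longrightarrow> measure (\<mu> t) {0..} \<le> B"
  shows "N_solution a b \<rho> u_in \<mu>_in (u_in + (\<integral>x. x \<partial>\<mu>_in)) (\<lambda>v. \<alpha> * v\<^sup>2) T \<mu>"
  unfolding N_solution_def
proof (intro conjI exI[of _ u0])
  show "0 < T" by (rule T)
  show "(\<lambda>v. \<alpha> * v\<^sup>2) \<in> Linf_loc"
    unfolding Linf_loc_def
  proof (intro CollectI conjI allI)
    show "(\<lambda>v. \<alpha> * v\<^sup>2) \<in> borel_measurable (lebesgue_on {0..})"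
      by (intro continuous_imp_measurable_on_sets_lebesgue continuous_intros) auto
    fix R :: real
    have "\<bar>\<alpha> * v\<^sup>2\<bar> \<le> \<alpha> * R\<^sup>2" if "v \<in> {0..R}" for v
      using that limits_pos by (auto simp: abs_mult intro!: mult_left_mono power_mono)
    then show "\<exists>C. AE v in lebesgue_on {0..R}. \<bar>\<alpha> * v\<^sup>2\<bar> \<le> C"
      by (intro exI[of _ "\<alpha> * R\<^sup>2"] AE_I2) simp
  qed
  have cw: "\<mu> \<in> C_wstar T" using conv by (simp add: C_wstar_tendsto_def)
  show "\<mu> \<in> Linf_M_f T"
    unfolding Linf_M_f_def
  proof (intro CollectI conjI)
    show "\<forall>t\<in>{0..T}. \<mu> t \<in> M_f {0..}" using \<mu>_M_f by blast
    show "\<forall>\<phi>\<in>C_c {0..}. (\<lambda>t. \<integral>x. \<phi> x \<partial>\<mu> t) \<in> borel_measurable (lebesgue_on {0..T})"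
      using cw measurable_lebesgue_on unfolding C_wstar_def by blast
    show "\<exists>C. AE t in lebesgue_on {0..T}. measure (\<mu> t) {0..} \<le> C"
      using mass by (intro exI[of _ B] AE_I2) simp
  qed
  show "continuous_on {0..T} u0" by (rule u0_continuous)
  show "\<forall>t\<in>{0..T}. 0 \<le> u0 t" using u0_lower rho_nonneg \<delta> by fastforce
  show "u0 0 = u_in" by (rule u0_initial)
  have "\<rho> + \<delta> \<le> (INF t\<in>{0..T}. u0 t)" using T u0_lower by (intro cINF_greatest) auto
  then show "\<rho> < (INF t\<in>{0..T}. u0 t)" using \<delta> by linarith
  show "\<exists>\<nu>. (\<forall>t\<in>{0..T}. \<nu> t \<in> M_f {0..}) \<and> (AE t in lebesgue_on {0..T}. \<nu> t = \<mu> t) \<and>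
      (\<forall>t\<in>{0..T}. integrable (\<nu> t) (\<lambda>x. x) \<and> u0 t + (\<integral>x. x \<partial>\<nu> t) = u_in + (\<integral>x. x \<partial>\<mu>_in))"
    using \<mu>_M_f first_moment(1) by (intro exI[of _ \<mu>]) (simp add: u0_def)
  show "\<forall>\<phi> \<phi>t \<phi>x. C1_c T \<phi> \<phi>t \<phi>x \<longrightarrow>
      (\<integral>t. (\<integral>x. \<phi>t t x + (a x * u0 t - b x) * \<phi>x t x \<partial>\<mu> t) \<partial>lebesgue_on {0..T}) +
      (\<integral>x. \<phi> 0 x \<partial>\<mu>_in) + (\<integral>s. \<phi> s 0 * (\<alpha> * (u0 s)\<^sup>2) \<partial>lebesgue_on {0..T}) = 0"
  proof (intro allI impI)
    fix \<phi> \<phi>t \<phi>x :: "real \<Rightarrow> real \<Rightarrow> real" assume c1: "C1_c T \<phi> \<phi>t \<phi>x"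
    obtain T1 X P where *: "0 < T1" "T1 < T" "0 < X" "0 \<le> P"
      "\<forall>t\<in>{0..<T}. \<forall>x\<ge>0. T1 \<le> t \<or> X \<le> x \<longrightarrow> \<phi> t x = 0 \<and> \<phi>t t x = 0 \<and> \<phi>x t x = 0"
      "\<forall>t\<in>{0..T1}. \<forall>x\<ge>0. \<bar>\<phi> t x\<bar> \<le> P \<and> \<bar>\<phi>t t x\<bar> \<le> P \<and> \<bar>\<phi>x t x\<bar> \<le> P"
      using C1_c_support[OF c1 T] by (elim exE conjE) (rule that)
    interpret becker_doring_test where \<phi>=\<phi> and \<phi>t=\<phi>t and \<phi>x=\<phi>x and T1=T1 and X=X and P=P
      by unfold_locales (use c1 * in blast)+
    show "(\<integral>t. (\<integral>x. \<phi>t t x + (a x * u0 t - b x) * \<phi>x t x \<partial>\<mu> t) \<partial>lebesgue_on {0..T}) +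
      (\<integral>x. \<phi> 0 x \<partial>\<mu>_in) + (\<integral>s. \<phi> s 0 * (\<alpha> * (u0 s)\<^sup>2) \<partial>lebesgue_on {0..T}) = 0"
      by (rule weak_formulation)
  qed
qed

end

section \<open>Convergence to the Lifshitz-Slyozov equation\<close>

theorem theorem1:
  fixes \<eta> :: real
    and \<alpha>\<epsilon> \<beta>\<epsilon> m\<epsilon> :: "real \<Rightarrow> real"
    and a\<epsilon> b\<epsilon> :: "real \<Rightarrow> nat \<Rightarrow> real"
    and u :: "real \<Rightarrow> real \<Rightarrow> real"
    and c :: "real \<Rightarrow> nat \<Rightarrow> real \<Rightarrow> real"
    and \<alpha> \<beta> :: real
    and a b :: "real \<Rightarrow> real"
    and K_a K_b r_a r_b abar bbar \<rho> u_in :: real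
    and \<mu>_in :: "real measure"
    and \<Phi> :: "real \<Rightarrow> real"
    and e :: "nat \<Rightarrow> real"
  assumes eta_nonneg: "\<eta> \<ge> 0"
    and pos_coeffs: "\<forall>\<epsilon>>0. \<alpha>\<epsilon> \<epsilon> > 0 \<and> \<beta>\<epsilon> \<epsilon> > 0 \<and> (\<forall>i\<ge>2. a\<epsilon> \<epsilon> i > 0) \<and> (\<forall>i\<ge>3. b\<epsilon> \<epsilon> i > 0)"
    and increments: "\<forall>\<epsilon>>0. \<exists>K>0. (\<forall>i\<ge>2. a\<epsilon> \<epsilon> (i + 1) - a\<epsilon> \<epsilon> i \<le> K) \<and>
          (\<forall>i\<ge>3. b\<epsilon> \<epsilon> i - b\<epsilon> \<epsilon> (i + 1) \<le> K)"
    and solution: "\<forall>\<epsilon>>0. BD_solution \<eta> \<epsilon> (\<alpha>\<epsilon> \<epsilon>) (\<beta>\<epsilon> \<epsilon>) (a\<epsilon> \<epsilon>) (b\<epsilon> \<epsilon>) (u \<epsilon>) (c \<epsilon>)"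
    and mass_balance: "\<forall>\<epsilon>>0. \<forall>t\<ge>0.
          ((\<lambda>i. \<epsilon>\<^sup>2 * real i * c \<epsilon> i t) has_sum (m\<epsilon> \<epsilon> - u \<epsilon> t)) {2..}"
    and limits_pos: "\<alpha> > 0" "\<beta> > 0"
    and a_cont: "continuous_on {0..} a" "\<forall>x\<ge>0. a x \<ge> 0" "\<forall>x>0. a x > 0"
    and b_cont: "continuous_on {0..} b" "\<forall>x\<ge>0. b x \<ge> 0" "\<forall>x>0. b x > 0"
    and alpha_lim: "(\<alpha>\<epsilon> \<longlongrightarrow> \<alpha>) (at_right 0)"
    and beta_lim: "(\<beta>\<epsilon> \<longlongrightarrow> \<beta>) (at_right 0)"
    and a_lim: "\<forall>S. compact S \<and> S \<subseteq> {0..} \<longrightarrow>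
          uniform_limit S (\<lambda>\<epsilon>. step_fun 2 \<epsilon> (a\<epsilon> \<epsilon>)) a (at_right 0)"
    and b_lim: "\<forall>S. compact S \<and> S \<subseteq> {0..} \<longrightarrow>
          uniform_limit S (\<lambda>\<epsilon>. step_fun 3 \<epsilon> (b\<epsilon> \<epsilon>)) b (at_right 0)"
    and growth_pos: "K_a > 0" "K_b > 0"
    and a_growth: "\<forall>\<epsilon>>0. \<forall>x\<ge>0. step_fun 2 \<epsilon> (a\<epsilon> \<epsilon>) x \<le> K_a * (1 + x)"
    and b_growth: "\<forall>\<epsilon>>0. \<forall>x\<ge>0. step_fun 3 \<epsilon> (b\<epsilon> \<epsilon>) x \<le> K_b * (1 + x)"
    and exponents: "0 \<le> r_a" "r_a < 1" "r_b \<ge> r_a" "abar > 0" "bbar > 0"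
    and a_equiv: "a \<sim>[at_right 0] (\<lambda>x. abar * x powr r_a)"
    and b_equiv: "b \<sim>[at_right 0] (\<lambda>x. bbar * x powr r_b)"
    and a_small: "\<forall>\<delta>>0. \<exists>h>0. \<forall>\<epsilon>>0. \<forall>i\<ge>2. \<epsilon> * real i < h \<longrightarrow>
          \<bar>step_fun 2 \<epsilon> (a\<epsilon> \<epsilon>) (\<epsilon> * real i) - a (\<epsilon> * real i)\<bar> \<le> \<delta> * (\<epsilon> * real i) powr r_a"
    and b_small: "\<forall>\<delta>>0. \<exists>h>0. \<forall>\<epsilon>>0. \<forall>i\<ge>3. \<epsilon> * real i < h \<longrightarrow>
          \<bar>step_fun 3 \<epsilon> (b\<epsilon> \<epsilon>) (\<epsilon> * real i) - b (\<epsilon> * real i)\<bar> \<le> \<delta> * (\<epsilon> * real i) powr r_b"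
    and rho: "((\<lambda>x. b x / a x) \<longlongrightarrow> \<rho>) (at_right 0)"
    and u_in: "u_in > \<rho>" "((\<lambda>\<epsilon>. u \<epsilon> 0) \<longlongrightarrow> u_in) (at_right 0)"
    and mu_in: "\<mu>_in \<in> M_f {0..}"
      "wstar_tendsto (\<lambda>\<epsilon>. density_measure (step_fun 2 \<epsilon> (\<lambda>i. c \<epsilon> i 0))) \<mu>_in (at_right 0)"
    and weight: "\<Phi> \<in> superlinear_weights"
      "(SUP \<epsilon>\<in>{0<..}. \<integral>\<^sup>+x\<in>{0..}. ennreal (\<Phi> x * step_fun 2 \<epsilon> (\<lambda>i. c \<epsilon> i 0) x) \<partial>lborel) < \<infinity>"
    and exp_moments: "\<forall>z\<in>{0<..<1}.
          (SUP \<epsilon>\<in>{0<..}. \<Sum>\<^sub>\<infinity>i\<in>{2..}. ennreal (\<epsilon> powr r_a * c \<epsilon> i 0 * exp (- (real i * z)))) < \<infinity>"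
    and eta: "\<eta> > r_a"
    and e_seq: "\<forall>n. e n > 0" "e \<longlonglongrightarrow> 0"
  shows "\<exists>T>0. \<exists>\<sigma>. strict_mono (\<sigma> :: nat \<Rightarrow> nat) \<and> (\<exists>\<mu>.
           N_solution a b \<rho> u_in \<mu>_in (u_in + (\<integral>x. x \<partial>\<mu>_in)) (\<lambda>v. \<alpha> * v\<^sup>2) T \<mu> \<and>
           C_wstar_tendsto T
             (\<lambda>n t. density_measure (step_fun 2 (e (\<sigma> n)) (\<lambda>i. c (e (\<sigma> n)) i t))) \<mu>)"
proof -
  interpret becker_doring_family \<eta> \<alpha>\<epsilon> \<beta>\<epsilon> m\<epsilon> a\<epsilon> b\<epsilon> u c \<alpha> \<beta> a b K_a K_b r_a r_b abar bbar \<rho> u_in \<mu>_in \<Phi>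
    by unfold_locales (fact assms)+
  obtain T \<delta> C \<sigma> \<mu> where *: "0 < T" "0 < \<delta>" "0 < C" "strict_mono (\<sigma> :: nat \<Rightarrow> nat)" "\<forall>n. bounds T \<delta> C (e (\<sigma> n))"
    "\<forall>t\<in>{0..T}. measure (\<mu> t) {0..} \<le> 2 * C" "C_wstar_tendsto T (\<lambda>n t. \<nu> (e (\<sigma> n)) t) \<mu>"
    using compactness[OF e_seq(1)[rule_format] e_seq(2)] by (elim exE conjE) (rule that)
  interpret becker_doring_limit \<eta> \<alpha>\<epsilon> \<beta>\<epsilon> m\<epsilon> a\<epsilon> b\<epsilon> u c \<alpha> \<beta> a b K_a K_b r_a r_b abar bbar \<rho> u_in \<mu>_in \<Phi>
      "\<lambda>n. e (\<sigma> n)" T \<delta> C \<mu>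
    by unfold_locales (use * LIMSEQ_subseq_LIMSEQ[OF e_seq(2) *(4)] in \<open>auto simp: o_def\<close>)
  have "N_solution a b \<rho> u_in \<mu>_in (u_in + (\<integral>x. x \<partial>\<mu>_in)) (\<lambda>v. \<alpha> * v\<^sup>2) T \<mu>"
    by (rule limit_is_solution) (use *(6) in blast)
  then show ?thesis using *(1,4,7) by blast
qed

end
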